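(* Assume the Riemann Hypothesis. Suppose that $X=X(T)\to\infty$ as $T\to\infty$ and that $X\ll T$. There exists an absolute constant $c_2$ such that, for $T$ sufficiently large, \[ \beta_X\leq\frac12+\frac{c_2\log T}{\log X\,\log\log T} \] for all zeros $\rho_X=\beta_X+i\gamma_X$ of $F_X(s)=\sum_{n\leq X}n^{-s}$ with $X^{1/2}<\gamma_X\leq T$.
   Context: $s=\sigma+it$, $X\geq 2$ real, $F_X(s)=\sum_{n\leq X}n^{-s}$ is the partial sum of the Riemann zeta-function; zeros are written $\rho_X=\beta_X+i\gamma_X$. *)

theory Defs
  imports "HOL-Complex_Analysis.Complex_Analysis" "HOL-Library.Landau_Symbols"
begin

definition zeta_partial_sum :: "real \<Rightarrow> complex \<Rightarrow> complex" where
  "zeta_partial_sum X s = (\<Sum>n | 1 \<le> n \<and> real n \<le> X. of_nat n powr (- s))"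

text \<open>
  The Riemann zeta function is taken to be the analytic continuation of the Dirichlet series
  to the punctured half-plane \<open>Re s > 0\<close>, \<open>s \<noteq> 1\<close>, which contains the whole critical strip. Such a
  continuation exists and is unique there (proved below); at \<open>1\<close> and on \<open>Re s \<le> 0\<close> the value of
  \<open>zeta\<close> is unspecified and must not be used.
\<close>

definition is_zeta_continuation :: "(complex \<Rightarrow> complex) \<Rightarrow> bool" where
  "is_zeta_continuation f \<longleftrightarrow>
     f holomorphic_on {s. Re s > 0} - {1} \<and>
     (\<forall>s. Re s > 1 \<longrightarrow> (\<lambda>n. of_nat (Suc n) powr (- s)) sums f s)"

definition zeta :: "complex \<Rightarrow> complex" where
  "zeta = (SOME f. is_zeta_continuation f)"

text \<open>The nontrivial zeros are the zeros in the open strip \<open>0 < Re s < 1\<close>.\<close>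

definition Riemann_Hypothesis :: bool where
  "Riemann_Hypothesis \<longleftrightarrow>
     (\<forall>s. 0 < Re s \<and> Re s < 1 \<and> zeta s = 0 \<longrightarrow> Re s = 1 / 2)"

lemma is_zeta_continuation_unique:
  assumes f: "is_zeta_continuation f" and g: "is_zeta_continuation g"
    and s: "Re s > 0" "s \<noteq> 1"
  shows "f s = g s"
proof -
  have o: "open {s::complex. Re s > 0}" by (rule open_halfspace_Re_gt)
  have c: "connected {s::complex. Re s > 0}"
    by (intro convex_connected convex_halfspace_Re_gt)
  have conn: "connected ({s::complex. Re s > 0} - {1})"
    using connected_open_delete[OF o c] by simp
  have "f s - g s = 0"
  proof (rule analytic_continuation[where U = "{s. Re s > 1}" and \<xi> = 2
          and f = "\<lambda>s. f s - g s" and S = "{s. Re s > 0} - {1}"])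
    show "(\<lambda>s. f s - g s) holomorphic_on {s. Re s > 0} - {1}"
      using f g by (auto simp: is_zeta_continuation_def intro!: holomorphic_intros)
    show "open ({s::complex. Re s > 0} - {1})" using o by (intro open_delete)
    show "connected ({s::complex. Re s > 0} - {1})" by (rule conn)
    show "(2::complex) islimpt {s. Re s > 1}"
      by (rule interior_limit_point) (simp add: interior_open open_halfspace_Re_gt)
    show "f z - g z = 0" if "z \<in> {s. Re s > 1}" for z
      using f g that sums_unique2[of _ "f z" "g z"]
      unfolding is_zeta_continuation_def by fastforce
  qed (use s in auto)
  then show ?thesis by simp
qed

lemma is_zeta_continuation_exists: "\<exists>f. is_zeta_continuation f"
proof -
  define g :: "nat \<Rightarrow> complex \<Rightarrow> complex" where
    "g = (\<lambda>n s. of_nat (Suc n) powr (- s) -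
            (of_nat (Suc (Suc n)) powr (1 - s) - of_nat (Suc n) powr (1 - s)) / (1 - s))"
  define S where "S = {s::complex. Re s > 0} - {1}"
  have opS: "open S" unfolding S_def by (intro open_delete open_halfspace_Re_gt)
  have bound: "norm (g n s) \<le> norm s * real (Suc n) powr (- Re s - 1)" if s: "s \<in> S" for n s
  proof -
    define a where "a = complex_of_nat (Suc n)"
    have a_real: "a = of_real (real (Suc n))" by (simp add: a_def)
    define I where "I = closed_segment a (a + 1)"
    have I: "\<exists>x. real (Suc n) \<le> x \<and> x \<le> real (Suc n) + 1 \<and> z = of_real x" if z: "z \<in> I" for z
    proof -
      have "I = of_real ` closed_segment (real (Suc n)) (real (Suc n) + 1)"
        unfolding I_def a_real using closed_segment_of_real[of "real (Suc n)" "real (Suc n) + 1"] by simp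
      then show ?thesis using z by (auto simp: closed_segment_eq_real_ivl)
    qed
    have ends: "a \<in> I" "a + 1 \<in> I" by (auto simp: I_def)
    have cvx: "convex I" by (simp add: I_def)
    have dist1: "norm (z - a) \<le> 1" if zI: "z \<in> I" for z
    proof -
      obtain x where x: "real (Suc n) \<le> x" "x \<le> real (Suc n) + 1" "z = of_real x"
        using I[OF zI] by blast
      have "z - a = of_real (x - real (Suc n))" unfolding x(3) a_real by simp
      then have "norm (z - a) = \<bar>x - real (Suc n)\<bar>" by (simp only: norm_of_real)
      then show ?thesis using x(1,2) by linarith
    qed
    have B1: "norm (a powr (- s) - z powr (- s)) \<le> norm s * real (Suc n) powr (- Re s - 1)"
      if z: "z \<in> I" for z
    proof -
      have "norm (z powr (- s) - a powr (- s)) \<le>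
              (norm s * real (Suc n) powr (- Re s - 1)) * norm (z - a)"
      proof (rule field_differentiable_bound[OF cvx, where f' = "\<lambda>w. - s * w powr (- s - 1)"])
        fix w assume "w \<in> I"
        then obtain x where x: "real (Suc n) \<le> x" "w = of_real x" using I by blast
        have x0: "x > 0" using x(1) by simp
        show "((\<lambda>w. w powr (- s)) has_field_derivative - s * w powr (- s - 1)) (at w within I)"
          using x0 unfolding x(2)
          by (auto intro!: derivative_eq_intros)
        have "norm (w powr (- s - 1)) = x powr (- Re s - 1)"
          using x0 unfolding x(2) by (subst norm_powr_real_powr) auto
        also have "\<dots> \<le> real (Suc n) powr (- Re s - 1)"
          using x(1) s by (intro powr_mono2') (auto simp: S_def)
        finally show "norm (- s * w powr (- s - 1)) \<le> norm s * real (Suc n) powr (- Re s - 1)"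
          by (simp add: norm_mult mult_left_mono)
      qed (use z ends in auto)
      also have "\<dots> \<le> (norm s * real (Suc n) powr (- Re s - 1)) * 1"
        using dist1[OF z] by (intro mult_left_mono) auto
      finally show ?thesis by (simp add: norm_minus_commute)
    qed
    define h where "h = (\<lambda>z. a powr (- s) * z - z powr (1 - s) / (1 - s))"
    have "norm (h (a + 1) - h a) \<le>
            (norm s * real (Suc n) powr (- Re s - 1)) * norm (a + 1 - a)"
    proof (rule field_differentiable_bound[OF cvx, where f' = "\<lambda>w. a powr (- s) - w powr (- s)"])
      fix w assume w: "w \<in> I"
      then obtain x where x: "real (Suc n) \<le> x" "w = of_real x" using I by blast
      have x0: "x > 0" using x(1) by simp
      show "(h has_field_derivative a powr (- s) - w powr (- s)) (at w within I)"
        unfolding h_def using x0 s unfolding x(2)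
        by (auto intro!: derivative_eq_intros simp: S_def)
      show "norm (a powr (- s) - w powr (- s)) \<le> norm s * real (Suc n) powr (- Re s - 1)"
        by (rule B1[OF w])
    qed (use ends in auto)
    moreover have "h (a + 1) - h a = g n s"
      by (simp add: h_def g_def a_def algebra_simps diff_divide_distrib)
    ultimately show ?thesis by simp
  qed
  have hol: "(\<lambda>s. \<Sum>n. g n s) holomorphic_on S"
  proof (rule holomorphic_uniform_sequence[OF opS, where f = "\<lambda>n s. \<Sum>i<n. g i s"])
    fix n show "(\<lambda>s. \<Sum>i<n. g i s) holomorphic_on S"
      unfolding g_def S_def by (auto intro!: holomorphic_intros)
  next
    fix z assume z: "z \<in> S"
    obtain d0 where d0: "d0 > 0" "cball z d0 \<subseteq> S" using opS z by (meson open_contains_cball)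
    define d where "d = min d0 (Re z / 2)"
    have d: "d > 0" "cball z d \<subseteq> S" "d \<le> Re z / 2"
      using d0 z by (auto simp: d_def S_def)
    have "uniform_limit (cball z d) (\<lambda>n s. \<Sum>i<n. g i s) (\<lambda>s. \<Sum>n. g n s) sequentially"
    proof (rule Weierstrass_m_test)
      fix n s assume s: "s \<in> cball z d"
      have "norm (s - z) \<le> d" using s by (simp add: dist_norm norm_minus_commute)
      then have re: "Re s \<ge> Re z / 2" and no: "norm s \<le> norm z + d"
        using abs_Re_le_cmod[of "s - z"] d(3) norm_triangle_sub[of s z] by auto
      have "norm (g n s) \<le> norm s * real (Suc n) powr (- Re s - 1)"
        using bound s d(2) by blast
      also have "\<dots> \<le> (norm z + d) * real (Suc n) powr (- (Re z / 2) - 1)"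
        using re no d(1) by (intro mult_mono powr_mono) auto
      finally show "norm (g n s) \<le> (norm z + d) * real (Suc n) powr (- (Re z / 2) - 1)" .
    next
      have "summable (\<lambda>n. real n powr (- (Re z / 2) - 1))"
        using z by (subst summable_real_powr_iff) (auto simp: S_def)
      then show "summable (\<lambda>n. (norm z + d) * real (Suc n) powr (- (Re z / 2) - 1))"
        by (intro summable_mult) (subst summable_Suc_iff)
    qed
    then show "\<exists>d>0. cball z d \<subseteq> S \<and>
        uniform_limit (cball z d) (\<lambda>n s. \<Sum>i<n. g i s) (\<lambda>s. \<Sum>n. g n s) sequentially"
      using d by blast
  qed
  define f where "f = (\<lambda>s. 1 / (s - 1) + (\<Sum>n. g n s))"
  have "f holomorphic_on S"
    unfolding f_def using hol by (auto intro!: holomorphic_intros simp: S_def)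
  moreover have "(\<lambda>n. of_nat (Suc n) powr (- s)) sums f s" if s: "Re s > 1" for s
  proof -
    have sS: "s \<in> S" using s by (auto simp: S_def)
    have "summable (\<lambda>n. real n powr (- Re s - 1))"
      using s by (subst summable_real_powr_iff) auto
    then have "summable (\<lambda>n. norm s * real (Suc n) powr (- Re s - 1))"
      by (intro summable_mult) (subst summable_Suc_iff)
    then have "summable (\<lambda>n. g n s)"
      by (rule summable_comparison_test'[where N = 0]) (use bound[OF sS] in auto)
    then have gs: "(\<lambda>n. g n s) sums (\<Sum>n. g n s)" by (rule summable_sums)
    have "(\<lambda>n. complex_of_nat (Suc n) powr (1 - s)) \<longlonglongrightarrow> 0"
    proof (rule tendsto_norm_zero_cancel)
      have "(\<lambda>n. real (Suc n) powr (1 - Re s)) \<longlonglongrightarrow> 0"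
        by (rule tendsto_neg_powr[OF _ filterlim_compose[OF filterlim_real_sequentially filterlim_Suc]])
          (use s in simp)
      moreover have "norm (complex_of_nat (Suc n) powr (1 - s)) = real (Suc n) powr (1 - Re s)" for n
        by (subst norm_powr_real_powr) auto
      ultimately show "(\<lambda>n. norm (complex_of_nat (Suc n) powr (1 - s))) \<longlonglongrightarrow> 0"
        by simp
    qed
    from telescope_sums[OF this]
    have "(\<lambda>n. (of_nat (Suc (Suc n)) powr (1 - s) - of_nat (Suc n) powr (1 - s)) / (1 - s))
            sums ((0 - of_nat (Suc 0) powr (1 - s)) / (1 - s))"
      by (intro sums_divide)
    from sums_add[OF this gs]
    have "(\<lambda>n. of_nat (Suc n) powr (- s)) sums ((0 - of_nat (Suc 0) powr (1 - s)) / (1 - s) + (\<Sum>n. g n s))"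
      by (simp add: g_def)
    also have "(0 - of_nat (Suc 0) powr (1 - s)) / (1 - s) = 1 / (s - 1)"
      using minus_divide_divide[of 1 "s - 1"] by simp
    finally show ?thesis by (simp add: f_def)
  qed
  ultimately have "is_zeta_continuation f"
    by (auto simp: is_zeta_continuation_def S_def)
  then show ?thesis by blast
qed

lemma is_zeta_continuation_zeta: "is_zeta_continuation zeta"
  unfolding zeta_def using is_zeta_continuation_exists by (rule someI_ex)

end

theory Submission
  imports Defs "HOL-Real_Asymp.Real_Asymp"
begin

text \<open>
  Write \<open>L = ln T\<close> and \<open>l = ln L\<close>. Perron's formula, moved to the line \<open>Re w = b = 1/2 + 9/l\<close>, shows that
  at a zero \<open>s\<close> of the partial sum \<open>\<bar>zeta s\<bar> X^Re s\<close> is at most \<open>X / \<bar>s\<bar>\<close> plus \<open>X^b\<close> times a bound for \<open>zeta\<close>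
  on the line; the pole term is harmless because \<open>Im s > sqrt X\<close>. If both \<open>zeta\<close> and \<open>1 / zeta\<close> are
  bounded by \<open>exp (O(L / l))\<close> to the right of the line, this gives \<open>(Re s - b) ln X = O(L / l)\<close>, and
  \<open>9/l = O(L / (l ln X))\<close> as \<open>X = O(T)\<close>.

  The bound \<open>ln \<bar>zeta\<bar> = O(L / l)\<close> follows by integrating \<open>zeta' / zeta = O(L exp (- (Re s - 1/2) l / 4))\<close>.
  Landau's local factorization and the Riemann Hypothesis give
  \<open>Re (zeta' / zeta) \<ge> - O(L)\<close> for \<open>Re s > 1/2\<close>, since each zero contributes \<open>Re (1 / (s - a)) > 0\<close>. Such a
  one-sided bound suffices: in a Poisson-type formula with kernel \<open>x^w exp (w^2)\<close>, \<open>x = L^(1/4)\<close>, only the real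
  part enters on the left edge, its total mass is controlled by the same formula with \<open>x = 1\<close>, and
  it is damped by a factor \<open>x^(-dist)\<close>; on the far right edge \<open>zeta' / zeta\<close> is bounded.
\<close>

section \<open>Logarithmic derivatives near zeros\<close>

text \<open>The scales come from a balance. With \<open>x = L^(1/4)\<close> the far right edge costs
  \<open>x^(5/2) = L^(5/8)\<close>, still below \<open>L\<close>; the horizontal edges at height
  \<open>l\<close> cost a power of \<open>L\<close> times \<open>exp (- l^2)\<close>; and the
  damping at distance \<open>d\<close> from the critical line is \<open>exp (- d l / 4)\<close>,
  whose integral over \<open>d\<close> yields the factor \<open>1 / l\<close>. The unknown value of
  \<open>zeta' / zeta\<close> reappears on the right-hand side through the total mass. It can be
  absorbed once the damping is at most \<open>1/4\<close>, which is why the line stays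
  \<open>9/l\<close> away from \<open>1/2\<close>.

  The bounds for \<open>zeta\<close> need heights of at least a multiple of \<open>L\<close>, while
  the zeros are only assumed to lie above \<open>sqrt X\<close>. The case of small \<open>X\<close>
  is harmless: a zero has \<open>Re s < 2\<close>, so a violation of the claim forces
  \<open>ln X >= L / l\<close>, and then \<open>sqrt X >= exp (L / (2 l))\<close> eventually exceeds
  every multiple of \<open>L\<close>. Perron's integral is cut at height \<open>T^9\<close>, because
  \<open>X <= T^2\<close> for large \<open>T\<close> and the truncation error involves four factors
  of that size.\<close>

lemma DERIV_prod_list_mult:
  fixes p :: "'b \<Rightarrow> complex \<Rightarrow> complex"
  assumes "\<And>a. a \<in> set as \<Longrightarrow> (p a has_field_derivative p' a) (at z)"
    and "\<And>a. a \<in> set as \<Longrightarrow> p a z \<noteq> 0"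
    and "(g has_field_derivative g') (at z)" "g z \<noteq> 0"
  shows "((\<lambda>z. (\<Prod>a\<leftarrow>as. p a z) * g z) has_field_derivative
           ((\<Prod>a\<leftarrow>as. p a z) * g z) * ((\<Sum>a\<leftarrow>as. p' a / p a z) + g' / g z)) (at z)"
  using assms
proof (induction as)
  case Nil
  then show ?case by simp
next
  case (Cons a as)
  have "((\<lambda>z. p a z * ((\<Prod>a\<leftarrow>as. p a z) * g z)) has_field_derivative
      p' a * ((\<Prod>a\<leftarrow>as. p a z) * g z) +
      ((\<Prod>a\<leftarrow>as. p a z) * g z) * ((\<Sum>a\<leftarrow>as. p' a / p a z) + g' / g z) * p a z) (at z)"
    by (rule DERIV_mult) (use Cons in auto)
  note D = this
  have eq: "(\<lambda>z. (\<Prod>a\<leftarrow>a # as. p a z) * g z) = (\<lambda>z. p a z * ((\<Prod>a\<leftarrow>as. p a z) * g z))"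
    by (simp add: mult.assoc)
  have "p' a * P + P * (S + H) * p a z = p a z * P * (p' a / p a z + S + H)" for P S H
    using Cons.prems(2)[of a] by (simp add: field_simps)
  from this[of "(\<Prod>a\<leftarrow>as. p a z) * g z"] show ?case
    unfolding eq by (intro DERIV_cong[OF D]) (simp add: mult.assoc)
qed

section \<open>Roots in a disc, reflected root factors and Landau's factorization\<close>

lemma norm_prod_list: "norm (\<Prod>a\<leftarrow>as. (f a :: complex)) = (\<Prod>a\<leftarrow>as. norm (f a))"
  by (induction as) (auto simp: norm_mult)

lemma prod_list_le_power:
  fixes f :: "'b \<Rightarrow> real"
  assumes "\<And>a. a \<in> set as \<Longrightarrow> 0 \<le> f a \<and> f a \<le> r"
  shows "0 \<le> (\<Prod>a\<leftarrow>as. f a) \<and> (\<Prod>a\<leftarrow>as. f a) \<le> r ^ length as"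
  using assms
proof (induction as)
  case (Cons a as)
  then have "0 \<le> f a" "f a \<le> r" by auto
  moreover from this have "0 \<le> r" by linarith
  ultimately show ?case using Cons by (auto intro!: mult_mono)
qed auto

lemma holomorphic_on_prod_list:
  assumes "\<And>a. a \<in> set as \<Longrightarrow> p a holomorphic_on S"
  shows "(\<lambda>z. \<Prod>a\<leftarrow>as. p a z) holomorphic_on S"
  using assms by (induction as) (auto intro!: holomorphic_intros)

lemma norm_sum_list_le:
  fixes f :: "'b \<Rightarrow> complex"
  assumes "\<And>a. a \<in> set as \<Longrightarrow> norm (f a) \<le> B"
  shows "norm (\<Sum>a\<leftarrow>as. f a) \<le> real (length as) * B"
  using assms
proof (induction as)
  case (Cons a as)
  have "norm (f a + (\<Sum>a\<leftarrow>as. f a)) \<le> B + real (length as) * B"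
    using Cons by (intro norm_triangle_le add_mono) auto
  then show ?case by (simp add: algebra_simps)
qed auto

text \<open>On the circle \<open>R^2 = z * cnj z\<close>, so \<open>R - cnj a * z / R\<close> and
  \<open>z - a\<close> have equal modulus; their quotient is a Blaschke factor. The reflected factor
  has no zero in the closed disc when \<open>norm a < R\<close>.\<close>

lemma norm_prod_list_diff_sphere:
  fixes z :: complex
  assumes R: "R > 0" "norm z = R"
  shows "norm (\<Prod>a\<leftarrow>as. of_real R - cnj a * z / of_real R) = norm (\<Prod>a\<leftarrow>as. z - a)"
proof -
  have "norm (of_real R - cnj a * z / of_real R) = norm (z - a)" for a
  proof -
    have "of_real R * of_real R = z * cnj z"
      using R by (simp add: complex_norm_square[symmetric] power2_eq_square)
    then have "of_real R * (of_real R - cnj a * z / of_real R) = z * cnj (z - a)"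
      using R by (simp add: algebra_simps)
    then have "R * norm (of_real R - cnj a * z / of_real R) = R * norm (z - a)"
      using R by (metis complex_mod_cnj norm_mult norm_of_real abs_of_pos)
    then show ?thesis using R by simp
  qed
  then show ?thesis by (simp add: norm_prod_list)
qed

text \<open>Reflecting every root factor keeps the modulus on the circle, so the bound for
  \<open>f\<close> there spreads to the whole disc by the maximum modulus principle. Working with
  the cofactor \<open>g\<close> avoids a division at the roots.\<close>

lemma blaschke_bound:
  assumes S: "open S" "cball 0 R \<subseteq> S" "R > 0"
    and g: "g holomorphic_on S"
    and fg: "\<And>z. z \<in> S \<Longrightarrow> f z = (\<Prod>a\<leftarrow>as. z - a) * g z"
    and M: "\<And>z. norm z = R \<Longrightarrow> norm (f z) \<le> M"
    and z: "norm z \<le> R"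
  shows "norm (g z * (\<Prod>a\<leftarrow>as. of_real R - cnj a * z / of_real R)) \<le> M"
proof (rule maximum_modulus_frontier[where S = "cball 0 R"
      and f = "\<lambda>z. g z * (\<Prod>a\<leftarrow>as. of_real R - cnj a * z / of_real R)"])
  have hol: "(\<lambda>z. g z * (\<Prod>a\<leftarrow>as. of_real R - cnj a * z / of_real R)) holomorphic_on S"
    using S(3) by (intro holomorphic_intros g holomorphic_on_prod_list) auto
  show "(\<lambda>z. g z * (\<Prod>a\<leftarrow>as. of_real R - cnj a * z / of_real R)) holomorphic_on interior (cball 0 R)"
    by (rule holomorphic_on_subset[OF hol]) (use S interior_subset in blast)
  show "continuous_on (closure (cball 0 R)) (\<lambda>z. g z * (\<Prod>a\<leftarrow>as. of_real R - cnj a * z / of_real R))"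
    by (rule holomorphic_on_imp_continuous_on, rule holomorphic_on_subset[OF hol]) (use S in auto)
next
  fix w :: complex assume "w \<in> frontier (cball 0 R)"
  then have w: "norm w = R" using S(3) by auto
  then have "w \<in> S" using S by auto
  then have "norm (g w * (\<Prod>a\<leftarrow>as. of_real R - cnj a * w / of_real R)) = norm (f w)"
    by (simp add: fg norm_mult norm_prod_list_diff_sphere[OF S(3) w])
  then show "norm (g w * (\<Prod>a\<leftarrow>as. of_real R - cnj a * w / of_real R)) \<le> M"
    using M[OF w] by simp
qed (use z in auto)

text \<open>Jensen's inequality in disguise: at \<open>0\<close> each reflected factor has modulus
  \<open>R\<close>, whereas the corresponding factor of \<open>f 0\<close> has modulus at most
  \<open>r\<close>. The first conclusion expresses that reflecting the roots cannot decrease the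
  modulus at \<open>0\<close>.\<close>

lemma zero_count_bound:
  assumes S: "open S" "cball 0 R \<subseteq> S" "0 < r" "r < R"
    and g: "g holomorphic_on S"
    and fg: "\<And>z. z \<in> S \<Longrightarrow> f z = (\<Prod>a\<leftarrow>as. z - a) * g z"
    and as: "set as \<subseteq> cball 0 r"
    and M: "\<And>z. norm z = R \<Longrightarrow> norm (f z) \<le> M"
    and f0: "f 0 \<noteq> 0"
  shows "norm (f 0) \<le> norm (g 0) * R ^ length as"
    and "real (length as) * ln (R / r) \<le> ln (M / norm (f 0))"
proof -
  have "0 \<in> S" using S by auto
  then have f0': "norm (f 0) = (\<Prod>a\<leftarrow>as. norm a) * norm (g 0)"
    by (simp add: fg norm_mult norm_prod_list)
  also have le: "\<dots> \<le> r ^ length as * norm (g 0)"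
    by (intro mult_right_mono prod_list_le_power[THEN conjunct2]) (use as in auto)
  finally have 1: "norm (f 0) \<le> r ^ length as * norm (g 0)" .
  also have "\<dots> \<le> R ^ length as * norm (g 0)"
    using S by (intro mult_right_mono power_mono) auto
  finally show "norm (f 0) \<le> norm (g 0) * R ^ length as" by (simp add: mult.commute)
  have "norm (g 0) * R ^ length as \<le> M"
    using blaschke_bound[OF S(1,2) _ g fg M, of 0] S(3,4)
    by (simp add: norm_mult norm_power map_replicate_const)
  then have "norm (f 0) * (R / r) ^ length as \<le> M"
    using 1 S(3,4)
    by (smt (verit, ccfv_SIG) divide_pos_pos mult.commute mult_right_mono nonzero_mult_div_cancel_left power_divide
        times_divide_eq_right zero_le_divide_iff zero_less_power pos_divide_le_eq)
  then have "(R / r) ^ length as \<le> M / norm (f 0)"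
    using f0 by (simp add: field_simps)
  moreover have "(R / r) ^ length as > 0" using S by simp
  ultimately have "ln ((R / r) ^ length as) \<le> ln (M / norm (f 0))"
    by (meson ln_le_cancel_iff order_less_le_trans)
  then show "real (length as) * ln (R / r) \<le> ln (M / norm (f 0))"
    using S by (simp add: ln_realpow)
qed

text \<open>Take a list of roots of maximal length; lengths are bounded by
  \<open>zero_count_bound\<close>. A root of the cofactor in the disc could be divided out and
  prefixed to the list, against maximality. Lists are used so that roots are repeated according to
  multiplicity.\<close>

lemma zero_factorization_cball:
  assumes S: "open S" "cball 0 R \<subseteq> S" "0 < r" "r < R"
    and f: "f holomorphic_on S" "f 0 \<noteq> 0"
    and M: "\<And>z. norm z = R \<Longrightarrow> norm (f z) \<le> M"
  obtains as g where "set as \<subseteq> cball 0 r" "\<And>a. a \<in> set as \<Longrightarrow> f a = 0"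
    "g holomorphic_on S" "\<And>z. z \<in> S \<Longrightarrow> f z = (\<Prod>a\<leftarrow>as. z - a) * g z"
    "\<And>z. norm z \<le> r \<Longrightarrow> g z \<noteq> 0"
proof -
  define P where "P = (\<lambda>n. \<exists>as g. length as = n \<and> set as \<subseteq> cball 0 r \<and> (\<forall>a\<in>set as. f a = 0) \<and>
     g holomorphic_on S \<and> (\<forall>z\<in>S. f z = (\<Prod>a\<leftarrow>as. z - a) * g z))"
  have "P 0" unfolding P_def using f by (intro exI[of _ "[]"] exI[of _ f]) auto
  moreover have "n \<le> nat \<lfloor>ln (M / norm (f 0)) / ln (R / r)\<rfloor>" if "P n" for n
  proof -
    obtain as g where *: "length as = n" "set as \<subseteq> cball 0 r" "g holomorphic_on S"
      "\<And>z. z \<in> S \<Longrightarrow> f z = (\<Prod>a\<leftarrow>as. z - a) * g z"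
      using \<open>P n\<close> unfolding P_def by blast
    have "real n * ln (R / r) \<le> ln (M / norm (f 0))"
      using zero_count_bound(2)[OF S *(3,4,2) M f(2)] *(1) by simp
    moreover have "ln (R / r) > 0" using S by simp
    ultimately have "real n \<le> ln (M / norm (f 0)) / ln (R / r)" by (simp add: field_simps)
    then show ?thesis by linarith
  qed
  ultimately have "\<exists>n. P n \<and> (\<forall>m. P m \<longrightarrow> m \<le> n)"
    using ex_has_greatest_nat[of P 0 "\<lambda>n. n"] by (metis le_imp_less_Suc)
  then obtain n where n: "P n" "\<not> P (Suc n)" using Suc_n_not_le_n by blast
  then obtain as g where *: "length as = n" "set as \<subseteq> cball 0 r" "\<And>a. a \<in> set as \<Longrightarrow> f a = 0"
      "g holomorphic_on S" "\<And>z. z \<in> S \<Longrightarrow> f z = (\<Prod>a\<leftarrow>as. z - a) * g z"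
    unfolding P_def by blast
  have "g b \<noteq> 0" if b: "norm b \<le> r" for b
  proof
    assume gb: "g b = 0"
    have bS: "b \<in> S" using b S by auto
    define h where "h = (\<lambda>z. if z = b then deriv g b else (g z - g b) / (z - b))"
    have "h holomorphic_on S"
      unfolding h_def by (rule pole_lemma[OF *(4)]) (use bS S in \<open>auto simp: interior_open\<close>)
    moreover have "g z = (z - b) * h z" for z using gb by (simp add: h_def)
    ultimately have "P (Suc n)" unfolding P_def
      using * b gb bS by (intro exI[of _ "b # as"] exI[of _ h]) (auto simp: mult_ac)
    then show False using n by simp
  qed
  then show ?thesis using that * by blast
qed

text \<open>The Moebius map \<open>v / (4 K - v)\<close> sends the half plane
  \<open>Re v <= K\<close> into the unit disc and fixes \<open>0\<close>, so the Schwarz lemma turns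
  the one-sided bound into a bound for \<open>norm q\<close> at distance \<open>d\<close> inside the
  disc. Cauchy's estimate on a circle of radius \<open>d\<close> costs the second
  \<open>d\<close>.\<close>

lemma borel_caratheodory_deriv:
  assumes q: "q holomorphic_on ball 0 r" "q 0 = 0"
    and K: "K > 0" "\<And>z. norm z < r \<Longrightarrow> Re (q z) \<le> K"
    and z: "norm z \<le> r - 2 * d" "d > 0" "r > 0"
  shows "norm (deriv q z) \<le> 4 * K * r / d\<^sup>2"
proof -
  have nz: "4 * of_real K - q w \<noteq> 0" if "norm w < r" for w
  proof
    assume "4 * of_real K - q w = 0"
    then have "Re (4 * of_real K - q w) = 0" by simp
    then show False using K(2)[OF that] K(1) by simp
  qed
  have bd: "norm (q w) \<le> 4 * K * r / d" if w: "norm w \<le> r - d" for w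
  proof -
    define \<phi> where "\<phi> = (\<lambda>u. q (of_real r * u) / (4 * of_real K - q (of_real r * u)))"
    have wr: "norm (of_real r * u) < r" if "norm u < 1" for u :: complex
      using that z by (simp add: norm_mult)
    have "(\<lambda>u. q (of_real r * u)) holomorphic_on ball 0 1"
      using holomorphic_on_compose_gen[of "\<lambda>u. of_real r * u" "ball 0 1" q "ball 0 r"] q(1) wr
      by (force simp: o_def intro!: holomorphic_intros)
    then have hol: "\<phi> holomorphic_on ball 0 1"
      unfolding \<phi>_def using nz wr by (intro holomorphic_intros) auto
    have "norm (\<phi> u) < 1" if "norm u < 1" for u
    proof -
      define v where "v = q (of_real r * u)"
      have v: "Re v \<le> K" "4 * of_real K - v \<noteq> 0" using K(2) nz wr[OF that] by (auto simp: v_def)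
      \<comment> \<open>\<open>norm v < norm (4 K - v)\<close> amounts to \<open>Re v < 2 K\<close>.
        The constant \<open>4 K\<close> in place of the usual \<open>2 K\<close> makes this strict,
        as the Schwarz lemma demands.\<close>
      have "Re v ^ 2 < (4 * K - Re v) ^ 2" using v(1) K(1) by (simp add: power2_eq_square algebra_simps)
      then have "(norm v)\<^sup>2 < (norm (4 * of_real K - v))\<^sup>2" by (simp add: cmod_power2)
      then have "norm v < norm (4 * of_real K - v)" by (rule power2_less_imp_less) simp
      then show ?thesis using v(2) by (simp add: \<phi>_def v_def[symmetric] norm_divide)
    qed
    moreover have "norm (w / of_real r) < 1" using w z by (simp add: norm_divide)
    ultimately have "norm (\<phi> (w / of_real r)) \<le> norm (w / of_real r)"
      by (intro Schwarz_Lemma(1)[OF hol]) (use q(2) in \<open>auto simp: \<phi>_def\<close>)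
    then have "norm (q w) / norm (4 * of_real K - q w) \<le> norm w / r"
      using z by (simp add: \<phi>_def norm_divide)
    moreover have "norm (4 * of_real K - q w) > 0" using nz[of w] w z by simp
    ultimately have "norm (q w) * r \<le> norm w * norm (4 * of_real K - q w)"
      using z by (simp add: field_simps)
    also have "\<dots> \<le> norm w * (4 * K + norm (q w))"
      using norm_triangle_ineq4[of "4 * of_real K" "q w"] K by (intro mult_left_mono) auto
    also have "\<dots> \<le> (r - d) * (4 * K + norm (q w))"
      using w K by (intro mult_right_mono) auto
    finally have "norm (q w) * d \<le> (r - d) * (4 * K)" by (simp add: algebra_simps)
    also have "\<dots> \<le> r * (4 * K)" using K z by (intro mult_right_mono) auto
    finally show ?thesis using z by (simp add: field_simps)
  qed
  have sub: "cball z d \<subseteq> {w. norm w \<le> r - d}"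
  proof
    fix w assume "w \<in> cball z d"
    then have "norm (w - z) \<le> d" by (simp add: dist_norm norm_minus_commute)
    then show "w \<in> {w. norm w \<le> r - d}" using z norm_triangle_sub[of w z] by simp
  qed
  have sub2: "cball z d \<subseteq> ball 0 r" using sub z by fastforce
  have "norm ((deriv ^^ 1) q z) \<le> fact 1 * (4 * K * r / d) / d ^ 1"
  proof (rule Cauchy_inequality)
    show "q holomorphic_on ball z d"
      by (rule holomorphic_on_subset[OF q(1)]) (use sub2 ball_subset_cball in blast)
    show "continuous_on (cball z d) q"
      by (rule holomorphic_on_imp_continuous_on, rule holomorphic_on_subset[OF q(1) sub2])
    show "norm (q x) \<le> 4 * K * r / d" if "norm (z - x) = d" for x
      by (rule bd) (use that sub in \<open>auto simp: dist_norm\<close>)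
  qed (use z in auto)
  then show ?thesis by (simp add: power2_eq_square)
qed

text \<open>Let \<open>h\<close> be \<open>f\<close> with its roots in the disc of radius
  \<open>r\<close> reflected. Then \<open>h\<close> is zero-free there, bounded by \<open>M\<close>,
  and at \<open>0\<close> at least as large as \<open>f\<close>, so the logarithm of
  \<open>h / h 0\<close> has real part at most \<open>ln (M / norm (f 0))\<close> and
  Borel-Caratheodory bounds its derivative. Passing back to \<open>f\<close> adds the sum over the
  roots and the logarithmic derivatives of the reflected factors; each of the latter is at most
  \<open>1 / (R - r)\<close>, and their number is controlled by the root count.\<close>

lemma landau_log_deriv:
  assumes S: "open S" "cball 0 R \<subseteq> S" "0 < d" "2 * d < r" "r < R"
    and f: "f holomorphic_on S" "f 0 \<noteq> 0"
    and M: "\<And>z. norm z = R \<Longrightarrow> norm (f z) \<le> M" "norm (f 0) < M"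
  obtains as where "\<And>a. a \<in> set as \<Longrightarrow> norm a \<le> r \<and> f a = 0"
    "real (length as) \<le> ln (M / norm (f 0)) / ln (R / r)"
    "\<And>z. \<lbrakk>norm z \<le> r - 2 * d; f z \<noteq> 0\<rbrakk> \<Longrightarrow>
       norm (deriv f z / f z - (\<Sum>a\<leftarrow>as. 1 / (z - a)))
         \<le> (4 * r / d\<^sup>2 + 1 / (ln (R / r) * (R - r))) * ln (M / norm (f 0))"
proof -
  define K where "K = ln (M / norm (f 0))"
  have r0: "0 < r" "0 < R" using S by auto
  have K: "K > 0" unfolding K_def using M(2) f(2) by (intro ln_gt_zero) (simp add: field_simps)
  obtain as g where *: "set as \<subseteq> cball 0 r" "\<And>a. a \<in> set as \<Longrightarrow> f a = 0"
    "g holomorphic_on S" "\<And>z. z \<in> S \<Longrightarrow> f z = (\<Prod>a\<leftarrow>as. z - a) * g z"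
    "\<And>z. norm z \<le> r \<Longrightarrow> g z \<noteq> 0"
    using zero_factorization_cball[OF S(1,2) r0(1) S(5) f M(1)] by metis
  have len: "real (length as) \<le> K / ln (R / r)"
    using zero_count_bound(2)[OF S(1,2) r0(1) S(5) *(3,4,1) M(1) f(2)] S r0
    by (simp add: K_def field_simps)
  define b where "b = (\<lambda>a z. of_real R - cnj a * z / of_real R)"
  have b: "norm (b a z) \<ge> R - r" if "norm a \<le> r" "norm z \<le> r" for a z
  proof -
    have "norm (cnj a * z / of_real R) \<le> r"
    proof -
      have "norm a * norm z \<le> r * R" using that r0 S by (intro mult_mono) auto
      then show ?thesis using r0 by (simp add: norm_divide norm_mult field_simps)
    qed
    then show ?thesis unfolding b_def using norm_triangle_ineq2[of "of_real R" "cnj a * z / of_real R"] r0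
      by simp
  qed
  have b0: "b a z \<noteq> 0" if "norm a \<le> r" "norm z \<le> r" for a z
    using b[OF that] S by auto
  define h where "h = (\<lambda>z. (\<Prod>a\<leftarrow>as. b a z) * g z)"
  have hM: "norm (h z) \<le> M" if "norm z \<le> R" for z
    using blaschke_bound[OF S(1,2) r0(2) *(3,4) M(1) that] by (simp add: h_def b_def mult.commute)
  have h0: "norm (f 0) \<le> norm (h 0)"
    using zero_count_bound(1)[OF S(1,2) r0(1) S(5) *(3,4,1) M(1) f(2)] r0
    by (simp add: h_def b_def norm_mult norm_power map_replicate_const mult.commute)
  have hol: "h holomorphic_on S" unfolding h_def b_def
    using r0 by (intro holomorphic_intros *(3) holomorphic_on_prod_list) auto
  have h00: "norm (h 0) > 0" using h0 f(2) by auto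
  have nz: "h z \<noteq> 0" if "norm z \<le> r" for z
    unfolding h_def using *(1,5) b0 that by (auto simp: prod_list_zero_iff)
  have ballS: "ball 0 r \<subseteq> S" using S by auto
  obtain q0 where q0: "q0 holomorphic_on ball 0 r" "\<And>z. z \<in> ball 0 r \<Longrightarrow> exp (q0 z) = h z"
    using holomorphic_logarithm_exists[of "ball 0 r" h 0] holomorphic_on_subset[OF hol ballS] nz r0
    by (metis convex_ball open_ball mem_ball_0 order_less_imp_le norm_zero)
  define q where "q = (\<lambda>z. q0 z - q0 0)"
  have q: "q holomorphic_on ball 0 r" "q 0 = 0" using q0(1) by (auto simp: q_def intro!: holomorphic_intros)
  have reK: "Re (q z) \<le> K" if "norm z < r" for z
  proof -
    have "exp (q z) = h z / h 0" using q0(2)[of z] q0(2)[of 0] that r0 by (simp add: q_def exp_diff)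
    then have "exp (Re (q z)) = norm (h z) / norm (h 0)" by (metis norm_divide norm_exp_eq_Re)
    also have "\<dots> \<le> M / norm (f 0)"
      using hM[of z] h0 h00 f(2) M(2) that S norm_ge_zero[of "f 0"]
      by (intro frac_le) (auto intro: order_trans[OF norm_ge_zero])
    also have "\<dots> = exp K"
    proof -
      have "M > 0" using M(2) norm_ge_zero[of "f 0"] by linarith
      then show ?thesis using f(2) by (simp add: K_def)
    qed
    finally show ?thesis by simp
  qed
  have main: "norm (deriv f z / f z - (\<Sum>a\<leftarrow>as. 1 / (z - a)))
         \<le> (4 * r / d\<^sup>2 + 1 / (ln (R / r) * (R - r))) * K"
    if z: "norm z \<le> r - 2 * d" and fz: "f z \<noteq> 0" for z
  proof -
    have zr: "norm z < r" and zS: "z \<in> S" using z S by auto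
    have dg: "(g has_field_derivative deriv g z) (at z)" using *(3) S(1) zS by (rule holomorphic_derivI)
    have gz: "g z \<noteq> 0" using *(5) zr by simp
    have za: "z - a \<noteq> 0" if "a \<in> set as" for a using *(2) that fz by auto
    have "((\<lambda>z. (\<Prod>a\<leftarrow>as. z - a) * g z) has_field_derivative
             ((\<Prod>a\<leftarrow>as. z - a) * g z) * ((\<Sum>a\<leftarrow>as. 1 / (z - a)) + deriv g z / g z)) (at z)"
      by (rule DERIV_prod_list_mult) (use za gz dg in \<open>auto intro!: derivative_eq_intros\<close>)
    then have "(f has_field_derivative
             ((\<Prod>a\<leftarrow>as. z - a) * g z) * ((\<Sum>a\<leftarrow>as. 1 / (z - a)) + deriv g z / g z)) (at z)"
      by (rule DERIV_cong_ev[THEN iffD1, rotated -1])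
        (use *(4) eventually_nhds_in_open[OF S(1) zS] in \<open>auto elim!: eventually_mono\<close>)
    then have 1: "deriv f z / f z = (\<Sum>a\<leftarrow>as. 1 / (z - a)) + deriv g z / g z"
      using fz *(4)[OF zS] by (simp add: DERIV_imp_deriv)
    have bz: "b a z \<noteq> 0" "norm (b a z) \<ge> R - r" "norm a \<le> r" if "a \<in> set as" for a
      using *(1) that zr b0[of a z] b[of a z] by auto
    have db: "(b a has_field_derivative - cnj a / of_real R) (at z)" for a
      unfolding b_def using r0 by (auto intro!: derivative_eq_intros)
    have dh: "(h has_field_derivative h z * ((\<Sum>a\<leftarrow>as. (- cnj a / of_real R) / b a z) + deriv g z / g z)) (at z)"
      unfolding h_def by (rule DERIV_prod_list_mult) (use bz db dg gz in auto)
    have "((\<lambda>z. exp (q0 z)) has_field_derivative exp (q0 z) * deriv q0 z) (at z)"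
      by (rule DERIV_fun_exp) (rule holomorphic_derivI[OF q0(1)], use zr in auto)
    moreover have "deriv q z = deriv q0 z"
      unfolding q_def
      by (rule DERIV_imp_deriv) (use holomorphic_derivI[OF q0(1), of z UNIV] zr in \<open>auto intro!: derivative_eq_intros\<close>)
    ultimately have "((\<lambda>z. exp (q0 z)) has_field_derivative h z * deriv q z) (at z)"
      using q0(2)[of z] zr by simp
    then have "(h has_field_derivative h z * deriv q z) (at z)"
      by (rule DERIV_cong_ev[THEN iffD1, rotated -1])
        (use q0(2) eventually_nhds_in_open[of "ball 0 r" z] zr in \<open>auto elim!: eventually_mono\<close>)
    \<comment> \<open>The derivative of \<open>h\<close> has been computed twice, from the product
      and from the logarithm. The comparison expresses \<open>g' / g\<close> by controlled
      quantities, and \<open>1\<close> links it to \<open>f' / f\<close>.\<close>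
    then have "h z * deriv q z = h z * ((\<Sum>a\<leftarrow>as. (- cnj a / of_real R) / b a z) + deriv g z / g z)"
      using dh DERIV_unique by blast
    then have 2: "deriv g z / g z = deriv q z - (\<Sum>a\<leftarrow>as. (- cnj a / of_real R) / b a z)"
      using nz[of z] zr by simp
    have n1: "norm (deriv q z) \<le> 4 * K * r / d\<^sup>2"
      by (rule borel_caratheodory_deriv[OF q K reK z S(3) r0(1)])
    have n2: "norm (\<Sum>a\<leftarrow>as. (- cnj a / of_real R) / b a z) \<le> real (length as) * (1 / (R - r))"
    proof (rule norm_sum_list_le)
      fix a assume a: "a \<in> set as"
      have "norm ((- cnj a / of_real R) / b a z) = (norm a / R) / norm (b a z)"
        using r0 by (simp add: norm_divide norm_mult)
      also have "\<dots> \<le> 1 / (R - r)" using bz[OF a] r0 S by (intro frac_le) auto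
      finally show "norm ((- cnj a / of_real R) / b a z) \<le> 1 / (R - r)" .
    qed
    also have "\<dots> \<le> K / ln (R / r) * (1 / (R - r))"
      using len S by (intro mult_right_mono) auto
    finally have n2: "norm (\<Sum>a\<leftarrow>as. (- cnj a / of_real R) / b a z) \<le> K / ln (R / r) * (1 / (R - r))" .
    have "norm (deriv f z / f z - (\<Sum>a\<leftarrow>as. 1 / (z - a))) =
       norm (deriv q z - (\<Sum>a\<leftarrow>as. (- cnj a / of_real R) / b a z))"
      using 1 2 by simp
    also have "\<dots> \<le> 4 * K * r / d\<^sup>2 + K / ln (R / r) * (1 / (R - r))"
      using n1 n2 norm_triangle_ineq4 by (smt (verit, best))
    finally show ?thesis by (simp add: algebra_simps)
  qed
  show ?thesis
  proof (rule that[of as])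
    show "norm a \<le> r \<and> f a = 0" if "a \<in> set as" for a using that *(1,2) by auto
  qed (use len main in \<open>auto simp: K_def\<close>)
qed

section \<open>The zeta function\<close>

lemma zeta_sums: "Re s > 1 \<Longrightarrow> (\<lambda>n. of_nat (Suc n) powr (- s)) sums zeta s"
  using is_zeta_continuation_zeta by (auto simp: is_zeta_continuation_def)

lemma zeta_holomorphic: "zeta holomorphic_on {s. Re s > 0} - {1}"
  using is_zeta_continuation_zeta by (auto simp: is_zeta_continuation_def)

section \<open>Series for the continuation of zeta and its polynomial growth\<close>

lemma norm_nat_powr: "norm (complex_of_nat (Suc n) powr s) = real (Suc n) powr Re s"
  by (subst norm_powr_real_powr) auto

text \<open>The subtracted quotient is the integral of \<open>x powr (- s)\<close> over the interval
  from \<open>n + 1\<close> to \<open>n + 2\<close>, so the series of these terms compares the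
  Dirichlet series with an integral and still converges for \<open>Re s > 0\<close>.\<close>

definition zeta_term :: "nat \<Rightarrow> complex \<Rightarrow> complex" where
  "zeta_term n s = of_nat (Suc n) powr (- s) -
     (of_nat (Suc (Suc n)) powr (1 - s) - of_nat (Suc n) powr (1 - s)) / (1 - s)"

text \<open>Integration by parts: the function \<open>\<phi>\<close> below has increment \<open>zeta_term n s\<close> over the unit
  interval and derivative \<open>s (n + 2 - x) x powr (- s - 1)\<close>.\<close>

lemma norm_zeta_term_le:
  assumes s: "Re s > 0" "s \<noteq> 1"
  shows "norm (zeta_term n s) \<le> norm s * real (Suc n) powr (- Re s - 1)"
proof -
  define a where "a = complex_of_nat (Suc n)"
  define I where "I = closed_segment a (a + 1)"
  have I: "\<exists>x. real (Suc n) \<le> x \<and> x \<le> real (Suc n) + 1 \<and> z = of_real x" if z: "z \<in> I" for z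
  proof -
    have "I = of_real ` closed_segment (real (Suc n)) (real (Suc n) + 1)"
      unfolding I_def a_def using closed_segment_of_real[of "real (Suc n)" "real (Suc n) + 1"] by simp
    then show ?thesis using z by (auto simp: closed_segment_eq_real_ivl)
  qed
  define \<phi> where "\<phi> = (\<lambda>x. (x - (a + 1)) * x powr (- s) - x powr (1 - s) / (1 - s))"
  have "norm (\<phi> (a + 1) - \<phi> a) \<le> norm s * real (Suc n) powr (- Re s - 1) * norm (a + 1 - a)"
  proof (rule field_differentiable_bound[where S = I
        and f' = "\<lambda>x. - s * (x - (a + 1)) * x powr (- s - 1)"])
    fix w assume "w \<in> I"
    then obtain x where x: "real (Suc n) \<le> x" "x \<le> real (Suc n) + 1" "w = of_real x" using I by blast
    have x0: "x > 0" using x(1) by simp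
    have "complex_of_real x powr (- s) = of_real x * of_real x powr (- s - 1)"
      using x0 powr_add[of "of_real x" 1 "- s - 1"] by simp
    then show "(\<phi> has_field_derivative - s * (w - (a + 1)) * w powr (- s - 1)) (at w within I)"
      unfolding \<phi>_def using x0 s unfolding x(3)
      by (auto intro!: derivative_eq_intros)
    have "w - (a + 1) = of_real (x - (real (Suc n) + 1))"
      by (simp add: x(3) a_def)
    then have "norm (w - (a + 1)) \<le> 1" using x by (simp only: norm_of_real)
    moreover have "norm (w powr (- s - 1)) \<le> real (Suc n) powr (- Re s - 1)"
      using x0 x(1) s unfolding x(3) by (subst norm_powr_real_powr) (auto intro!: powr_mono2')
    ultimately show "norm (- s * (w - (a + 1)) * w powr (- s - 1)) \<le> norm s * real (Suc n) powr (- Re s - 1)"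
      unfolding norm_mult norm_minus_cancel mult.assoc
      using mult_mono[of "norm (w - (a + 1))" 1 "norm (w powr (- s - 1))" "real (Suc n) powr (- Re s - 1)"]
      by (intro mult_left_mono) auto
  qed (auto simp: I_def)
  moreover have "\<phi> (a + 1) - \<phi> a = zeta_term n s"
    using s by (simp add: \<phi>_def zeta_term_def a_def algebra_simps diff_divide_distrib)
  ultimately show ?thesis by simp
qed

text \<open>For \<open>Re s > 1\<close> the subtracted integrals telescope, with total
  \<open>1 / (s - 1)\<close>. The series is holomorphic on the punctured half plane by locally
  uniform convergence, so together with the pole term it is a continuation. As \<open>zeta\<close>
  is merely a chosen continuation, uniqueness is what identifies the two.\<close>

lemma zeta_term_sums:
  assumes s: "Re s > 0" "s \<noteq> 1"
  shows "(\<lambda>n. zeta_term n s) sums (zeta s - 1 / (s - 1))"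
proof -
  define S where "S = {s::complex. Re s > 0} - {1}"
  have opS: "open S" unfolding S_def by (intro open_delete open_halfspace_Re_gt)
  have summ: "summable (\<lambda>n. norm s * real (Suc n) powr (- Re s - 1))" if "Re s > 0" for s :: complex
  proof -
    have "summable (\<lambda>n. real n powr (- Re s - 1))"
      using that by (subst summable_real_powr_iff) auto
    then show ?thesis by (intro summable_mult) (subst summable_Suc_iff)
  qed
  have summable: "summable (\<lambda>n. zeta_term n s)" if "s \<in> S" for s
    by (rule summable_comparison_test'[where N = 0, OF summ[of s]])
      (use norm_zeta_term_le that in \<open>auto simp: S_def\<close>)
  have hol: "(\<lambda>s. \<Sum>n. zeta_term n s) holomorphic_on S"
  proof (rule holomorphic_uniform_sequence[OF opS, where f = "\<lambda>n s. \<Sum>i<n. zeta_term i s"])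
    fix n show "(\<lambda>s. \<Sum>i<n. zeta_term i s) holomorphic_on S"
      unfolding zeta_term_def S_def by (auto intro!: holomorphic_intros)
  next
    fix z assume z: "z \<in> S"
    obtain d0 where d0: "d0 > 0" "cball z d0 \<subseteq> S" using opS z by (meson open_contains_cball)
    define d where "d = min d0 (Re z / 2)"
    have d: "d > 0" "cball z d \<subseteq> S" "d \<le> Re z / 2"
      using d0 z by (auto simp: d_def S_def)
    have "uniform_limit (cball z d) (\<lambda>n s. \<Sum>i<n. zeta_term i s) (\<lambda>s. \<Sum>n. zeta_term n s) sequentially"
    proof (rule Weierstrass_m_test)
      fix n s assume s: "s \<in> cball z d"
      have "norm (s - z) \<le> d" using s by (simp add: dist_norm norm_minus_commute)
      then have re: "Re s \<ge> Re z / 2" and no: "norm s \<le> norm z + d"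
        using abs_Re_le_cmod[of "s - z"] d(3) norm_triangle_sub[of s z] by auto
      have "norm (zeta_term n s) \<le> norm s * real (Suc n) powr (- Re s - 1)"
        using norm_zeta_term_le[of s n] s d(2) unfolding S_def by blast
      also have "\<dots> \<le> (norm z + d) * real (Suc n) powr (- (Re z / 2) - 1)"
        using re no d(1) by (intro mult_mono powr_mono) auto
      finally show "norm (zeta_term n s) \<le> (norm z + d) * real (Suc n) powr (- (Re z / 2) - 1)" .
    next
      have "summable (\<lambda>n. real n powr (- (Re z / 2) - 1))"
        using z by (subst summable_real_powr_iff) (auto simp: S_def)
      then show "summable (\<lambda>n. (norm z + d) * real (Suc n) powr (- (Re z / 2) - 1))"
        by (intro summable_mult) (subst summable_Suc_iff)
    qed
    then show "\<exists>d>0. cball z d \<subseteq> S \<and>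
        uniform_limit (cball z d) (\<lambda>n s. \<Sum>i<n. zeta_term i s) (\<lambda>s. \<Sum>n. zeta_term n s) sequentially"
      using d by blast
  qed
  have "is_zeta_continuation (\<lambda>s. 1 / (s - 1) + (\<Sum>n. zeta_term n s))"
    unfolding is_zeta_continuation_def
  proof (intro conjI allI impI)
    show "(\<lambda>s. 1 / (s - 1) + (\<Sum>n. zeta_term n s)) holomorphic_on {s. Re s > 0} - {1}"
      using hol unfolding S_def by (auto intro!: holomorphic_intros)
  next
    fix s :: complex assume s: "Re s > 1"
    have "(\<lambda>n. complex_of_nat (Suc n) powr (1 - s)) \<longlonglongrightarrow> 0"
    proof (rule tendsto_norm_zero_cancel)
      show "(\<lambda>n. norm (complex_of_nat (Suc n) powr (1 - s))) \<longlonglongrightarrow> 0"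
        unfolding norm_nat_powr
        by (rule tendsto_neg_powr[OF _ filterlim_compose[OF filterlim_real_sequentially filterlim_Suc]])
          (use s in simp)
    qed
    from sums_add[OF sums_divide[OF telescope_sums[OF this], of "1 - s"] summable_sums[OF summable[of s]]]
    have "(\<lambda>n. of_nat (Suc n) powr (- s)) sums ((0 - of_nat (Suc 0) powr (1 - s)) / (1 - s) + (\<Sum>n. zeta_term n s))"
      using s by (force simp: zeta_term_def S_def)
    also have "(0 - of_nat (Suc 0) powr (1 - s)) / (1 - s) = 1 / (s - 1)"
      using minus_divide_divide[of 1 "s - 1"] by simp
    finally show "(\<lambda>n. of_nat (Suc n) powr (- s)) sums (1 / (s - 1) + (\<Sum>n. zeta_term n s))" .
  qed
  from is_zeta_continuation_unique[OF is_zeta_continuation_zeta this s]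
  show ?thesis using summable_sums[OF summable, of s] s by (simp add: S_def)
qed

text \<open>For \<open>Re s >= 1/4\<close> all terms are dominated by \<open>norm s\<close> times
  one convergent series. The abscissa \<open>1/4\<close> is the leftmost point of the discs of
  radius \<open>7/4\<close> about points with real part \<open>2\<close> used later.\<close>

lemma zeta_minus_pole_bound:
  "\<exists>C\<ge>0. \<forall>s. Re s \<ge> 1 / 4 \<and> s \<noteq> 1 \<longrightarrow> norm (zeta s - 1 / (s - 1)) \<le> C * norm s"
proof -
  define C where "C = (\<Sum>n. real (Suc n) powr (- 5 / 4))"
  have "summable (\<lambda>n. real n powr (- 5 / 4))" by (subst summable_real_powr_iff) auto
  then have su: "summable (\<lambda>n. real (Suc n) powr (- 5 / 4))" by (subst summable_Suc_iff)
  have "norm (zeta s - 1 / (s - 1)) \<le> C * norm s" if s: "Re s \<ge> 1 / 4" "s \<noteq> 1" for s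
  proof -
    have *: "norm (zeta_term n s) \<le> norm s * real (Suc n) powr (- 5 / 4)" for n
    proof -
      have "norm (zeta_term n s) \<le> norm s * real (Suc n) powr (- Re s - 1)"
        using s by (intro norm_zeta_term_le) auto
      also have "\<dots> \<le> norm s * real (Suc n) powr (- 5 / 4)"
        using s by (intro mult_left_mono powr_mono) auto
      finally show ?thesis .
    qed
    have "norm (\<Sum>n. zeta_term n s) \<le> (\<Sum>n. norm s * real (Suc n) powr (- 5 / 4))"
      by (rule norm_suminf_le[OF *]) (intro summable_mult su)
    also have "\<dots> = C * norm s" unfolding C_def using suminf_mult[OF su, of "norm s"] by simp
    also have "(\<Sum>n. zeta_term n s) = zeta s - 1 / (s - 1)"
      using sums_unique[OF zeta_term_sums[of s]] s by simp
    finally show ?thesis .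
  qed
  moreover have "C \<ge> 0" unfolding C_def by (intro suminf_nonneg su) auto
  ultimately show ?thesis by blast
qed

text \<open>The linear growth bound gives boundedness near \<open>1\<close>, so the singularity of
  the difference is removable. The regular part serves to take limits at the pole and to separate
  the residue at \<open>1\<close> in Perron's formula.\<close>

lemma zeta_regular_part:
  obtains E where "E holomorphic_on {s. Re s > 0}" "\<And>s. Re s > 0 \<Longrightarrow> s \<noteq> 1 \<Longrightarrow> zeta s = 1 / (s - 1) + E s"
proof -
  obtain C where C: "C \<ge> 0" "\<And>s. Re s \<ge> 1 / 4 \<Longrightarrow> s \<noteq> 1 \<Longrightarrow> norm (zeta s - 1 / (s - 1)) \<le> C * norm s"
    using zeta_minus_pole_bound by blast
  have "\<exists>g. g holomorphic_on {s. Re s > 0} \<and> (\<forall>z\<in>{s. Re s > 0} - {1}. g z = zeta z - 1 / (z - 1))"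
  proof (subst holomorphic_on_extend_bounded)
    show "(\<lambda>z. zeta z - 1 / (z - 1)) holomorphic_on {s. Re s > 0} - {1}"
      using zeta_holomorphic by (auto intro!: holomorphic_intros)
    have "eventually (\<lambda>z::complex. norm (zeta z - 1 / (z - 1)) \<le> C * 2) (at 1)"
      unfolding eventually_at
    proof (intro exI[of _ "1/2"] conjI ballI impI)
      fix z :: complex assume z: "z \<noteq> 1 \<and> dist z 1 < 1 / 2"
      then have "norm (z - 1) < 1 / 2" by (simp add: dist_norm)
      then have "Re z \<ge> 1 / 4" "norm z \<le> 2"
        using abs_Re_le_cmod[of "z - 1"] norm_triangle_sub[of z 1] by auto
      then show "norm (zeta z - 1 / (z - 1)) \<le> C * 2"
        using C(2)[of z] z C(1) by (meson mult_left_mono order_trans)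
    qed auto
    then show "\<exists>B. eventually (\<lambda>z::complex. norm (zeta z - 1 / (z - 1)) \<le> B) (at 1)" by blast
  qed (simp add: interior_open open_halfspace_Re_gt)
  then show ?thesis using that by (metis (no_types, lifting) DiffI mem_Collect_eq singletonD add_diff_cancel_left' diff_add_cancel add.commute)
qed

lemma zeta_bound:
  "\<exists>C\<ge>0. \<forall>s. Re s \<ge> 1 / 4 \<and> s \<noteq> 1 \<longrightarrow> norm (zeta s) \<le> 1 / norm (s - 1) + C * norm s"
proof -
  obtain C where C: "C \<ge> 0" "\<And>s. Re s \<ge> 1 / 4 \<Longrightarrow> s \<noteq> 1 \<Longrightarrow> norm (zeta s - 1 / (s - 1)) \<le> C * norm s"
    using zeta_minus_pole_bound by blast
  have "norm (zeta s) \<le> 1 / norm (s - 1) + C * norm s" if "Re s \<ge> 1 / 4" "s \<noteq> 1" for s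
    using C(2)[OF that] norm_triangle_sub[of "zeta s" "1 / (s - 1)"] by (simp add: norm_divide)
  then show ?thesis using C(1) by blast
qed

section \<open>Elementary estimates for \<open>Re s >= 2\<close>\<close>

lemma norm_nat_powr_le_telescope:
  assumes "Re s \<ge> 2"
  shows "norm (of_nat (Suc (Suc n)) powr (- s)) \<le> 1 / (real n + 3 / 2) - 1 / (real (Suc n) + 3 / 2)"
proof -
  have "norm (of_nat (Suc (Suc n)) powr (- s)) = real (Suc (Suc n)) powr (- Re s)"
    by (subst norm_nat_powr) simp
  also have "\<dots> \<le> real (Suc (Suc n)) powr (- 2)" using assms by (intro powr_mono) auto
  also have "\<dots> = 1 / (real n + 2) ^ 2"
    by (subst powr_minus, subst powr_numeral) (auto simp: field_simps)
  \<comment> \<open>The two half-integers have product \<open>(n + 2)^2 - 1/4\<close> and differ by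
    \<open>1\<close>, so the reciprocal of their product is a telescoping difference.\<close>
  also have "\<dots> \<le> 1 / ((real n + 3 / 2) * (real n + 5 / 2))"
  proof (intro divide_left_mono)
    show "(real n + 3 / 2) * (real n + 5 / 2) \<le> (real n + 2)\<^sup>2"
      by (simp add: power2_eq_square algebra_simps)
    show "0 < (real n + 2)\<^sup>2 * ((real n + 3 / 2) * (real n + 5 / 2))"
      by (intro mult_pos_pos zero_less_power) auto
  qed simp
  also have "\<dots> = 1 / (real n + 3 / 2) - 1 / (real (Suc n) + 3 / 2)"
    by (simp add: divide_simps)
  finally show ?thesis .
qed

text \<open>The telescoping majorant of the terms from index \<open>2\<close> on sums to
  \<open>1 / (3/2)\<close>. Since this is below \<open>1\<close>, it keeps \<open>zeta\<close> away
  from \<open>0\<close>; a cruder comparison of the series would not.\<close>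

lemma norm_zeta_minus_1_le:
  assumes "Re s \<ge> 2"
  shows "norm (zeta s - 1) \<le> 2 / 3"
proof -
  have "(\<lambda>n. of_nat (Suc (Suc n)) powr (- s)) sums (zeta s - 1)"
    using zeta_sums[of s] assms by (subst sums_Suc_iff) simp
  then have eq: "zeta s - 1 = (\<Sum>n. of_nat (Suc (Suc n)) powr (- s))" by (rule sums_unique)
  have "(\<lambda>n. 1 / (real n + 3 / 2)) \<longlonglongrightarrow> 0" by real_asymp
  from telescope_sums'[OF this]
  have tel: "(\<lambda>n. 1 / (real n + 3 / 2) - 1 / (real (Suc n) + 3 / 2)) sums (2 / 3)" by simp
  have "norm (\<Sum>n. of_nat (Suc (Suc n)) powr (- s)) \<le> (\<Sum>n. 1 / (real n + 3 / 2) - 1 / (real (Suc n) + 3 / 2))"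
    by (rule norm_suminf_le[OF norm_nat_powr_le_telescope[OF assms]]) (use tel sums_summable in blast)
  then show ?thesis using sums_unique[OF tel] eq by simp
qed

lemma norm_zeta_Re_ge_2:
  assumes "Re s \<ge> 2"
  shows "norm (zeta s) \<ge> 1 / 3" "norm (zeta s) \<le> 2"
  using norm_zeta_minus_1_le[OF assms] norm_triangle_ineq2[of 1 "1 - zeta s"]
    norm_triangle_sub[of "zeta s" 1]
  by (auto simp: norm_minus_commute)

lemma zeta_nonzero_Re_ge_2: "Re s \<ge> 2 \<Longrightarrow> zeta s \<noteq> 0"
  using norm_zeta_Re_ge_2(1)[of s] by auto

text \<open>The closed unit disc about \<open>s\<close> stays in \<open>Re >= 2\<close>, where
  \<open>norm zeta <= 2\<close>; Cauchy's estimate and the lower bound \<open>1/3\<close> give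
  \<open>6\<close>. This bounds the far right edge of the rectangle used later.\<close>

lemma norm_log_deriv_zeta_le:
  assumes s: "Re s \<ge> 3"
  shows "norm (deriv zeta s / zeta s) \<le> 6"
proof -
  have re: "Re x \<ge> 2" if "norm (s - x) \<le> 1" for x
    using abs_Re_le_cmod[of "s - x"] that s by simp
  have sub: "cball s 1 \<subseteq> {s. Re s > 0} - {1}" using re by (force simp: dist_norm)
  have "norm ((deriv ^^ 1) zeta s) \<le> fact 1 * 2 / 1 ^ 1"
  proof (rule Cauchy_inequality)
    show "zeta holomorphic_on ball s 1"
      by (rule holomorphic_on_subset[OF zeta_holomorphic]) (use sub ball_subset_cball in blast)
    show "continuous_on (cball s 1) zeta"
      by (rule holomorphic_on_imp_continuous_on, rule holomorphic_on_subset[OF zeta_holomorphic sub])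
    show "norm (zeta x) \<le> 2" if "norm (s - x) = 1" for x
      using norm_zeta_Re_ge_2(2)[OF re] that by simp
  qed auto
  then have "norm (deriv zeta s) / norm (zeta s) \<le> 2 / (1 / 3)"
    using norm_zeta_Re_ge_2(1)[of s] s by (intro frac_le) auto
  then show ?thesis by (simp add: norm_divide)
qed

section \<open>The finite Euler product and non-vanishing\<close>

definition rough_numbers :: "nat \<Rightarrow> nat set" where
  "rough_numbers k = {n. n \<ge> 1 \<and> (\<forall>p. prime p \<longrightarrow> p \<le> k \<longrightarrow> \<not> p dvd n)}"

lemma rough_numbers_0: "rough_numbers 0 = {1..}"
proof -
  have "\<not> prime p" if "p \<le> 0" for p :: nat using that by simp
  then show ?thesis unfolding rough_numbers_def by blast
qed
text \<open>A multiple of a prime \<open>Suc k\<close> that is free of smaller primes has a cofactor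
  free of smaller primes. Writing the removed numbers as an image makes the series over them a
  reindexed, rescaled copy of the series over \<open>rough_numbers k\<close>.\<close>

lemma rough_numbers_Suc:
  "rough_numbers (Suc k) = (if prime (Suc k) then rough_numbers k - (\<lambda>m. Suc k * m) ` rough_numbers k
     else rough_numbers k)"
proof (cases "prime (Suc k)")
  case True
  have "n \<in> (\<lambda>m. Suc k * m) ` rough_numbers k \<longleftrightarrow> Suc k dvd n" if n: "n \<in> rough_numbers k" for n
  proof
    assume "Suc k dvd n"
    then obtain m where m: "n = Suc k * m" by (elim dvdE)
    have "m \<noteq> 0" using n m by (cases m) (auto simp: rough_numbers_def)
    then have "m \<in> rough_numbers k" using n m by (auto simp: rough_numbers_def)
    then show "n \<in> (\<lambda>m. Suc k * m) ` rough_numbers k" using m by blast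
  qed (auto simp del: mult_Suc)
  moreover have "rough_numbers (Suc k) = {n \<in> rough_numbers k. \<not> Suc k dvd n}"
    using True unfolding rough_numbers_def le_Suc_eq by blast
  ultimately show ?thesis using True by auto
next
  case False
  then show ?thesis unfolding rough_numbers_def le_Suc_eq by auto
qed

lemma rough_numbers_subset: "rough_numbers k \<subseteq> insert 1 {k<..}"
proof
  fix n assume n: "n \<in> rough_numbers k"
  show "n \<in> insert 1 {k<..}"
  proof (cases "n = 1")
    case False
    then obtain p where p: "prime p" "p dvd n" using prime_factor_nat by blast
    then have "p \<le> n" using n by (intro dvd_imp_le) (auto simp: rough_numbers_def)
    moreover have "k < p" using n p not_le by (auto simp: rough_numbers_def)
    ultimately show ?thesis by simp
  qed auto
qed

lemma zeta_has_sum: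
  assumes "Re s > 1"
  shows "((\<lambda>n. of_nat n powr (- s)) has_sum zeta s) {1..}"
proof -
  have "summable (\<lambda>n. real n powr (- Re s))" using assms by (subst summable_real_powr_iff) auto
  then have "summable (\<lambda>n. real (Suc n) powr (- Re s))" by (subst summable_Suc_iff)
  then have "summable (\<lambda>n. norm (of_nat (Suc n) powr (- s)))"
    by (subst norm_nat_powr) simp
  then have "((\<lambda>n. of_nat (Suc n) powr (- s)) has_sum zeta s) UNIV"
    by (rule norm_summable_imp_has_sum) (rule zeta_sums[OF assms])
  then have "((\<lambda>n. of_nat n powr (- s)) has_sum zeta s) (range Suc)"
    by (subst has_sum_reindex) (auto simp: o_def)
  moreover have "range Suc = {1..}" by (auto simp: image_iff Suc_le_eq gr0_conv_Suc)
  ultimately show ?thesis by simp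
qed

text \<open>The sieve of Eratosthenes: multiplication by \<open>1 - p powr (- s)\<close> deletes the
  terms whose index is divisible by \<open>p\<close>. Finite products suffice below, so no infinite
  product is formed.\<close>

lemma zeta_partial_euler_product:
  assumes "Re s > 1"
  shows "((\<lambda>n. of_nat n powr (- s)) has_sum
           (zeta s * (\<Prod>p | prime p \<and> p \<le> k. 1 - of_nat p powr (- s)))) (rough_numbers k)"
proof (induction k)
  case 0
  have "{p::nat. prime p \<and> p \<le> 0} = {}" by auto
  then show ?case using zeta_has_sum[OF assms] by (simp add: rough_numbers_0)
next
  case (Suc k)
  let ?P = "\<lambda>k. zeta s * (\<Prod>p | prime p \<and> p \<le> k. 1 - of_nat p powr (- s))"
  show ?case
  proof (cases "prime (Suc k)")
    case True
    have fin: "finite {p::nat. prime p \<and> p \<le> k}" by (rule finite_subset[of _ "{..k}"]) auto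
    have "{p. prime p \<and> p \<le> Suc k} = insert (Suc k) {p. prime p \<and> p \<le> k}"
      using True by (auto simp: le_Suc_eq)
    then have P: "?P (Suc k) = ?P k - of_nat (Suc k) powr (- s) * ?P k"
      using fin by (simp add: prod.insert algebra_simps del: of_nat_Suc)
    have "((\<lambda>n. of_nat (Suc k) powr (- s) * of_nat n powr (- s)) has_sum (of_nat (Suc k) powr (- s) * ?P k))
        (rough_numbers k)"
      by (intro has_sum_cmult_right Suc.IH)
    also have "?this \<longleftrightarrow> ((\<lambda>n. of_nat (Suc k * n) powr (- s)) has_sum (of_nat (Suc k) powr (- s) * ?P k))
        (rough_numbers k)"
      by (intro has_sum_cong, subst of_nat_mult, subst powr_times_real) (auto simp del: of_nat_Suc)
    finally have "((\<lambda>n. of_nat n powr (- s)) has_sum (of_nat (Suc k) powr (- s) * ?P k))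
        ((\<lambda>m. Suc k * m) ` rough_numbers k)"
      by (subst has_sum_reindex) (auto simp: o_def inj_on_def simp del: mult_Suc of_nat_Suc)
    moreover have "(\<lambda>m. Suc k * m) ` rough_numbers k \<subseteq> rough_numbers k"
    proof safe
      fix m assume m: "m \<in> rough_numbers k"
      have "\<not> p dvd Suc k * m" if "prime p" "p \<le> k" for p
        using m that True primes_dvd_imp_eq[of p "Suc k"] by (auto simp: rough_numbers_def prime_dvd_mult_iff simp del: mult_Suc)
      then show "Suc k * m \<in> rough_numbers k" using m by (auto simp: rough_numbers_def)
    qed
    ultimately have "((\<lambda>n. of_nat n powr (- s)) has_sum (?P k - of_nat (Suc k) powr (- s) * ?P k))
        (rough_numbers k - (\<lambda>m. Suc k * m) ` rough_numbers k)"
      by (intro has_sum_Diff Suc.IH)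
    then show ?thesis using True P by (simp add: rough_numbers_Suc)
  next
    case False
    then have "{p. prime p \<and> p \<le> Suc k} = {p. prime p \<and> p \<le> k}" by (auto simp: le_Suc_eq)
    then show ?thesis using False Suc.IH by (simp add: rough_numbers_Suc)
  qed
qed

text \<open>Apart from \<open>1\<close>, every index that survives the sieve exceeds
  \<open>k\<close>, so the difference from \<open>1\<close> is dominated by a tail of a convergent
  series.\<close>

lemma zeta_euler_product_tendsto:
  assumes s: "Re s > 1"
  shows "(\<lambda>k. zeta s * (\<Prod>p | prime p \<and> p \<le> k. 1 - of_nat p powr (- s))) \<longlonglongrightarrow> 1"
proof (rule LIMSEQ_I)
  fix e :: real assume e: "e > 0"
  let ?P = "\<lambda>k. zeta s * (\<Prod>p | prime p \<and> p \<le> k. 1 - of_nat p powr (- s))"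
  have "summable (\<lambda>n. real n powr (- Re s))" using s by (subst summable_real_powr_iff) auto
  from suminf_exist_split[OF e this]
  obtain N where N: "\<And>n. n \<ge> N \<Longrightarrow> norm (\<Sum>i. real (i + n) powr (- Re s)) < e"
    by blast
  have su: "summable (\<lambda>i. real (i + n) powr (- Re s))" for n
    using \<open>summable (\<lambda>n. real n powr (- Re s))\<close> by (subst summable_iff_shift)
  have "norm (?P k - 1) < e" if k: "k \<ge> N" for k
  proof -
    have 1: "1 \<in> rough_numbers k" by (auto simp: rough_numbers_def)
    have main: "((\<lambda>n. of_nat n powr (- s)) has_sum (?P k - 1)) (rough_numbers k - {1})"
    proof (rule has_sum_Diff[OF zeta_partial_euler_product[OF s, of k]])
      show "((\<lambda>n. of_nat n powr (- s)) has_sum 1) {1::nat}" by (rule has_sum_finiteI) auto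
    qed (use 1 in auto)
    have "((\<lambda>i. real (i + Suc k) powr (- Re s)) has_sum (\<Sum>i. real (i + Suc k) powr (- Re s))) UNIV"
      by (rule norm_summable_imp_has_sum) (use su[of "Suc k"] summable_sums in auto)
    then have "((\<lambda>n. real n powr (- Re s)) has_sum (\<Sum>i. real (i + Suc k) powr (- Re s))) (range (\<lambda>i. i + Suc k))"
      by (subst has_sum_reindex) (auto simp: o_def inj_on_def)
    then have hs: "((\<lambda>n. real n powr (- Re s)) has_sum (\<Sum>i. real (i + Suc k) powr (- Re s))) {k<..}"
    proof -
      have "range (\<lambda>i. i + Suc k) = {k<..}"
      proof safe
        fix n assume "k < n"
        then show "n \<in> range (\<lambda>i. i + Suc k)" by (intro image_eqI[of _ _ "n - Suc k"]) auto
      qed auto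
      then show ?thesis
        using \<open>((\<lambda>n. real n powr (- Re s)) has_sum _) (range _)\<close> by simp
    qed
    have nn: "norm (of_nat n powr (- s)) = real n powr (- Re s)" if "n > 0" for n
      using that by (subst norm_powr_real_powr) auto
    have sub: "rough_numbers k - {1} \<subseteq> {k<..}" using rough_numbers_subset by blast
    have sumr: "(\<lambda>n. real n powr (- Re s)) summable_on (rough_numbers k - {1})"
      by (rule summable_on_subset_banach[OF has_sum_imp_summable[OF hs] sub])
    have "norm (?P k - 1) \<le> infsum (\<lambda>n. real n powr (- Re s)) (rough_numbers k - {1})"
    proof -
      have "norm (infsum (\<lambda>n. complex_of_nat n powr (- s)) (rough_numbers k - {1}))
          \<le> infsum (\<lambda>n. real n powr (- Re s)) (rough_numbers k - {1})"
      proof (rule norm_infsum_le[OF has_sum_infsum has_sum_infsum[OF sumr]])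
        show "(\<lambda>n. complex_of_nat n powr - s) summable_on rough_numbers k - {1}"
          using main by (rule has_sum_imp_summable)
        show "norm (complex_of_nat n powr - s) \<le> real n powr - Re s" if "n \<in> rough_numbers k - {1}" for n
          using nn[of n] that by (auto simp: rough_numbers_def)
      qed
      then show ?thesis using infsumI[OF main] by simp
    qed
    also have "\<dots> \<le> infsum (\<lambda>n. real n powr (- Re s)) {k<..}"
      by (rule infsum_mono2[OF sumr has_sum_imp_summable[OF hs] sub]) auto
    also have "\<dots> = (\<Sum>i. real (i + Suc k) powr (- Re s))" by (rule infsumI[OF hs])
    also have "\<dots> < e" using N[of "Suc k"] k by (simp del: of_nat_Suc of_nat_add add_Suc_right)
    finally show ?thesis .
  qed
  then show "\<exists>N. \<forall>k\<ge>N. norm (?P k - 1) < e" by blast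
qed

section \<open>Non-vanishing for \<open>Re s >= 1\<close> apart from the pole\<close>

lemma zeta_nonzero_Re_gt_1:
  assumes "Re s > 1" shows "zeta s \<noteq> 0"
proof
  assume "zeta s = 0"
  then have "(\<lambda>k::nat. 0::complex) \<longlonglongrightarrow> 1" using zeta_euler_product_tendsto[OF assms] by simp
  then show False using LIMSEQ_unique[OF tendsto_const] by fastforce
qed

text \<open>Compare the power series of the logarithms and use \<open>3 + 4 cos \<theta> + cos 2\<theta> = 2 (1 + cos \<theta>)^2\<close>.\<close>

lemma three_four_one_factor:
  fixes r :: real and u :: complex
  assumes r: "0 \<le> r" "r < 1" and u: "norm u = 1"
  shows "(1 - r) ^ 3 * norm (1 - of_real r * u) ^ 4 * norm (1 - of_real r * u ^ 2) \<le> 1"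
proof -
  \<comment> \<open>The series may start at \<open>n = 0\<close>, since division by zero makes that
    term \<open>0\<close>.\<close>
  have lnsum: "(\<lambda>n. - Re (z ^ n) / real n) sums ln (norm (1 - z))" if "norm z < 1" for z :: complex
  proof -
    have "(\<lambda>n. Re (- ((- (- z)) ^ n) / of_nat n)) sums Re (ln (1 + - z))"
      by (rule sums_Re[OF Ln_series']) (use that in simp)
    moreover have "1 - z \<noteq> 0" using that by auto
    ultimately show ?thesis by simp
  qed
  have nz: "norm (of_real r * w) < 1" "1 - of_real r * w \<noteq> 0" if "norm w = 1" for w :: complex
  proof -
    show "norm (of_real r * w) < 1" using r that by (simp add: norm_mult)
    then show "1 - of_real r * w \<noteq> 0" by auto
  qed
  have u2: "norm (u ^ 2) = 1" using u by (simp add: norm_power)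
  let ?a = "\<lambda>n. 3 * (- Re ((of_real r * 1) ^ n) / real n) + 4 * (- Re ((of_real r * u) ^ n) / real n)
      + (- Re ((of_real r * u ^ 2) ^ n) / real n)"
  have S: "?a sums (3 * ln (norm (1 - of_real r * (1::complex))) + 4 * ln (norm (1 - of_real r * u))
      + ln (norm (1 - of_real r * u ^ 2)))"
    by (intro sums_add sums_mult lnsum nz u u2) auto
  have neg: "?a n \<le> 0" for n
  proof -
    define c where "c = Re (u ^ n)"
    have "norm (u ^ n) = 1" using u by (simp add: norm_power)
    then have "c\<^sup>2 + (Im (u ^ n))\<^sup>2 = 1" unfolding c_def by (metis cmod_power2 one_power2)
    moreover have "Re ((u ^ 2) ^ n) = c\<^sup>2 - (Im (u ^ n))\<^sup>2"
    proof -
      have "(u ^ 2) ^ n = (u ^ n) ^ 2" by (simp only: power_mult[symmetric] mult.commute)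
      then show ?thesis by (simp add: c_def Re_power2)
    qed
    ultimately have c2: "Re ((u ^ 2) ^ n) = 2 * c\<^sup>2 - 1" by simp
    have "Re ((of_real r * w) ^ n) = r ^ n * Re (w ^ n)" for w :: complex
    proof -
      have "(of_real r * w) ^ n = of_real (r ^ n) * w ^ n" by (simp add: power_mult_distrib)
      then show ?thesis by (metis Re_complex_of_real Im_complex_of_real times_complex.simps(1) mult_zero_left diff_zero)
    qed
    note re = this[of 1] this[of u] this[of "u ^ 2"]
    have "3 * (- y / m) + 4 * (- (y * c) / m) + (- (y * (2 * c\<^sup>2 - 1)) / m)
       = - (y * (2 * (1 + c)\<^sup>2)) / m" for y m
      by (simp add: power2_eq_square algebra_simps add_divide_distrib diff_divide_distrib)
    then have "?a n = - (r ^ n * (2 * (1 + c)\<^sup>2)) / real n"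
      unfolding re c2 c_def[symmetric] by simp
    also have "\<dots> \<le> 0" using r by (intro divide_nonpos_nonneg) auto
    finally show ?thesis .
  qed
  have le0: "3 * ln (norm (1 - of_real r * (1::complex))) + 4 * ln (norm (1 - of_real r * u))
      + ln (norm (1 - of_real r * u ^ 2)) \<le> 0"
    by (rule sums_le[OF neg S sums_zero])
  have "norm (1 - of_real r * (1::complex)) = 1 - r"
  proof -
    have "1 - of_real r * (1::complex) = of_real (1 - r)" by simp
    then show ?thesis using r by (simp only: norm_of_real)
  qed
  with le0 have "ln ((1 - r) ^ 3 * norm (1 - of_real r * u) ^ 4 * norm (1 - of_real r * u ^ 2)) \<le> 0"
    using r nz[OF u] nz[OF u2] by (simp add: ln_mult ln_realpow)
  moreover have "(1 - r) ^ 3 * norm (1 - of_real r * u) ^ 4 * norm (1 - of_real r * u ^ 2) > 0"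
    using r nz[OF u] nz[OF u2] by (intro mult_pos_pos zero_less_power) auto
  ultimately show ?thesis by simp
qed

text \<open>The factorwise inequality bounds the combination \<open>3, 4, 1\<close> of the finite
  Euler products by \<open>1\<close>, and \<open>zeta\<close> times each product tends to
  \<open>1\<close>. So the same combination of the values of \<open>zeta\<close> dominates a
  sequence with limit \<open>1\<close>.\<close>

lemma three_four_one_zeta:
  fixes \<sigma> t :: real
  assumes \<sigma>: "\<sigma> > 1"
  shows "norm (zeta (of_real \<sigma>)) ^ 3 * norm (zeta (Complex \<sigma> t)) ^ 4 * norm (zeta (Complex \<sigma> (2 * t))) \<ge> 1"
proof -
  define P where "P = (\<lambda>s k. \<Prod>p | prime p \<and> p \<le> k. 1 - complex_of_nat p powr (- s))"
  define f where "f = (\<lambda>s k. zeta s * P s k)"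
  let ?s1 = "complex_of_real \<sigma>" and ?s2 = "Complex \<sigma> t" and ?s3 = "Complex \<sigma> (2 * t)"
  have lim: "f s \<longlonglongrightarrow> 1" if "Re s > 1" for s
    using zeta_euler_product_tendsto[OF that] by (simp add: f_def P_def)
  have "(\<lambda>k. norm (f ?s1 k) ^ 3 * norm (f ?s2 k) ^ 4 * norm (f ?s3 k)) \<longlonglongrightarrow> norm (1::complex) ^ 3 * norm (1::complex) ^ 4 * norm (1::complex)"
    by (intro tendsto_mult tendsto_power tendsto_norm lim) (use \<sigma> in auto)
  moreover have "norm (f ?s1 k) ^ 3 * norm (f ?s2 k) ^ 4 * norm (f ?s3 k)
      \<le> norm (zeta ?s1) ^ 3 * norm (zeta ?s2) ^ 4 * norm (zeta ?s3)" for k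
  proof -
    have "norm (P ?s1 k) ^ 3 * norm (P ?s2 k) ^ 4 * norm (P ?s3 k) =
      (\<Prod>p | prime p \<and> p \<le> k. norm (1 - of_nat p powr (- ?s1)) ^ 3 * norm (1 - of_nat p powr (- ?s2)) ^ 4
         * norm (1 - of_nat p powr (- ?s3)))"
      by (simp add: P_def prod_norm[symmetric] prod.distrib prod_power_distrib)
    also have "\<dots> \<le> (\<Prod>p::nat | prime p \<and> p \<le> k. 1)"
    proof (intro prod_mono conjI)
      fix p :: nat assume "p \<in> {p. prime p \<and> p \<le> k}"
      then have p: "p \<ge> 2" using prime_ge_2_nat by blast
      define r where "r = real p powr (- \<sigma>)"
      define u where "u = complex_of_nat p powr (- (\<i> * of_real t))"
      have r: "0 \<le> r" "r < 1" using p \<sigma> by (auto simp: r_def powr_less_one)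
      have u: "norm u = 1" unfolding u_def using p by (subst norm_powr_real_powr) auto
      have r': "of_nat p powr (- complex_of_real \<sigma>) = of_real r"
      proof -
        have "of_nat p powr (- complex_of_real \<sigma>) = of_real (real p) powr of_real (- \<sigma>)" by simp
        then show ?thesis using p by (simp only: powr_of_real r_def of_nat_0_le_iff)
      qed
      have e2: "- ?s2 = - of_real \<sigma> + - (\<i> * of_real t)" by (simp add: complex_eq_iff)
      have e3: "- ?s3 = - of_real \<sigma> + (- (\<i> * of_real t) + - (\<i> * of_real t))" by (simp add: complex_eq_iff)
      have s2: "of_nat p powr (- ?s2) = of_real r * u"
        unfolding e2 powr_add r' u_def ..
      have s3: "of_nat p powr (- ?s3) = of_real r * u ^ 2"
        unfolding e3 powr_add r' u_def power2_eq_square ..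
      have n1: "norm (1 - complex_of_real r) = 1 - r"
      proof -
        have "1 - complex_of_real r = of_real (1 - r)" by simp
        then show ?thesis using r by (simp only: norm_of_real)
      qed
      show "norm (1 - of_nat p powr (- ?s1)) ^ 3 * norm (1 - of_nat p powr (- ?s2)) ^ 4
         * norm (1 - of_nat p powr (- ?s3)) \<le> 1"
        unfolding s2 s3 r' n1 by (rule three_four_one_factor[OF r u])
    qed auto
    finally have "norm (P ?s1 k) ^ 3 * norm (P ?s2 k) ^ 4 * norm (P ?s3 k) \<le> 1" by simp
    then have "(norm (zeta ?s1) ^ 3 * norm (zeta ?s2) ^ 4 * norm (zeta ?s3)) *
        (norm (P ?s1 k) ^ 3 * norm (P ?s2 k) ^ 4 * norm (P ?s3 k))
       \<le> (norm (zeta ?s1) ^ 3 * norm (zeta ?s2) ^ 4 * norm (zeta ?s3)) * 1"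
      by (intro mult_left_mono) auto
    then show ?thesis by (simp add: f_def norm_mult power_mult_distrib mult_ac)
  qed
  ultimately have "norm (1::complex) ^ 3 * norm (1::complex) ^ 4 * norm (1::complex)
     \<le> norm (zeta ?s1) ^ 3 * norm (zeta ?s2) ^ 4 * norm (zeta ?s3)"
    by (intro LIMSEQ_le_const2) auto
  then show ?thesis by simp
qed

text \<open>As \<open>h\<close> tends to \<open>0\<close> from the right, the pole at
  \<open>1\<close> contributes at most order \<open>h^(-3)\<close>, while a zero at
  \<open>1 + i t\<close> would contribute \<open>h^4\<close> and the third factor stays bounded.
  Their product would tend to \<open>0\<close>, against the lower bound \<open>1\<close>.\<close>

lemma zeta_nonzero_Re_eq_1:
  assumes t: "t \<noteq> 0"
  shows "zeta (Complex 1 t) \<noteq> 0"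
proof
  assume 0: "zeta (Complex 1 t) = 0"
  obtain E where E: "E holomorphic_on {s. Re s > 0}"
    "\<And>s. Re s > 0 \<Longrightarrow> s \<noteq> 1 \<Longrightarrow> zeta s = 1 / (s - 1) + E s"
    using zeta_regular_part by blast
  have op: "open {s::complex. Re s > 0}" "open ({s::complex. Re s > 0} - {1})"
    by (auto intro!: open_delete open_halfspace_Re_gt)
  have ct: "((\<lambda>h::real. Complex (1 + h) y) \<longlongrightarrow> Complex 1 y) (at_right 0)" for y
    unfolding Complex_eq by (auto intro!: tendsto_eq_intros)
  have 1: "((\<lambda>h. of_real h * zeta (of_real (1 + h))) \<longlongrightarrow> 1) (at_right 0)"
  proof -
    have "isCont E 1"
      using holomorphic_on_imp_continuous_on[OF E(1)] op by (auto simp: continuous_on_eq_continuous_at)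
    then have "((\<lambda>h. E (Complex (1 + h) 0)) \<longlongrightarrow> E (Complex 1 0)) (at_right 0)"
      by (intro isCont_tendsto_compose[OF _ ct]) (simp add: one_complex.code)
    moreover have ch: "Complex (1 + h) 0 = of_real (1 + h)" for h by (simp add: complex_of_real_def)
    ultimately have "((\<lambda>h. 1 + of_real h * E (of_real (1 + h))) \<longlongrightarrow> 1 + of_real 0 * E (of_real 1)) (at_right 0)"
      unfolding ch by (intro tendsto_intros) (auto simp: complex_of_real_def)
    moreover have "eventually (\<lambda>h::real. 1 + of_real h * E (of_real (1 + h)) = of_real h * zeta (of_real (1 + h))) (at_right 0)"
      using eventually_at_right_less[of "0::real"]
    proof eventually_elim
      case (elim h)
      then have "complex_of_real (1 + h) \<noteq> 1" by (metis add_cancel_right_right of_real_eq_1_iff order_less_irrefl)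
      then show ?case using elim E(2)[of "of_real (1 + h)"] by (simp add: field_simps)
    qed
    ultimately show ?thesis by (auto elim: Lim_transform_eventually)
  qed
  have 2: "((\<lambda>h. zeta (Complex (1 + h) t) / of_real h) \<longlongrightarrow> deriv zeta (Complex 1 t)) (at_right 0)"
  proof -
    have "(zeta has_field_derivative deriv zeta (Complex 1 t)) (at (Complex 1 t))"
      by (rule holomorphic_derivI[OF zeta_holomorphic op(2)]) (use t in \<open>auto simp: complex_eq_iff\<close>)
    then have "((\<lambda>k. zeta (Complex 1 t + k) / k) \<longlongrightarrow> deriv zeta (Complex 1 t)) (at 0)"
      using 0 by (simp add: DERIV_def)
    moreover have "filterlim complex_of_real (at 0) (at_right 0)"
      unfolding filterlim_at
      by (auto intro!: tendsto_eq_intros simp: eventually_at_right_less eventually_at_filter)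
    ultimately have "((\<lambda>h. zeta (Complex 1 t + of_real h) / of_real h) \<longlongrightarrow> deriv zeta (Complex 1 t)) (at_right 0)"
      by (rule filterlim_compose)
    moreover have "Complex 1 t + of_real h = Complex (1 + h) t" for h by (simp add: complex_eq_iff)
    ultimately show ?thesis by simp
  qed
  have 3: "((\<lambda>h. zeta (Complex (1 + h) (2 * t))) \<longlongrightarrow> zeta (Complex 1 (2 * t))) (at_right 0)"
  proof (rule isCont_tendsto_compose[OF _ ct])
    show "isCont zeta (Complex 1 (2 * t))"
      using holomorphic_on_imp_continuous_on[OF zeta_holomorphic] op t
      by (auto simp: continuous_on_eq_continuous_at complex_eq_iff)
  qed
  have hlim: "((\<lambda>h::real. h) \<longlongrightarrow> 0) (at_right 0)" by (auto intro!: tendsto_eq_intros)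
  \<comment> \<open>The powers \<open>h^3\<close>, \<open>h^(-4)\<close> and \<open>h\<close>
    cancel, so \<open>?G\<close> is the original product rewritten such that every factor has a
    finite limit and the last one tends to \<open>0\<close>.\<close>
  let ?G = "\<lambda>h. norm (of_real h * zeta (of_real (1 + h))) ^ 3 * norm (zeta (Complex (1 + h) t) / of_real h) ^ 4
      * norm (zeta (Complex (1 + h) (2 * t))) * h"
  have "(?G \<longlongrightarrow> norm (1::complex) ^ 3 * norm (deriv zeta (Complex 1 t)) ^ 4 * norm (zeta (Complex 1 (2 * t))) * 0) (at_right 0)"
    by (intro tendsto_mult tendsto_power tendsto_norm 1 2 3 hlim)
  moreover have "eventually (\<lambda>h. 1 \<le> ?G h) (at_right 0)"
    using eventually_at_right_less[of "0::real"]
  proof eventually_elim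
    case (elim h)
    have "1 \<le> norm (zeta (of_real (1 + h))) ^ 3 * norm (zeta (Complex (1 + h) t)) ^ 4 * norm (zeta (Complex (1 + h) (2 * t)))"
      using three_four_one_zeta[of "1 + h" t] elim by simp
    also have "\<dots> = ?G h"
    proof -
      have "a ^ 3 * b ^ 4 * c = (h * a) ^ 3 * (b / h) ^ 4 * c * h" for a b c :: real
        using elim by (simp add: eval_nat_numeral)
      then show ?thesis unfolding norm_mult norm_divide norm_of_real abs_of_pos[OF elim] .
    qed
    finally show ?case .
  qed
  ultimately have "(1::real) \<le> norm (1::complex) ^ 3 * norm (deriv zeta (Complex 1 t)) ^ 4 * norm (zeta (Complex 1 (2 * t))) * 0"
    by (rule tendsto_lowerbound) simp
  then show False by simp
qed

text \<open>\<open>Riemann_Hypothesis\<close> only speaks of the open strip. The line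
  \<open>Re s = 1\<close> and the half plane beyond it have to be excluded by the Euler product
  arguments.\<close>

lemma RH_zeta_zero:
  assumes RH: "Riemann_Hypothesis" and s: "Re s > 0" "s \<noteq> 1" "zeta s = 0"
  shows "Re s = 1 / 2"
proof -
  consider "Re s < 1" | "Re s = 1" | "Re s > 1" by linarith
  then show ?thesis
  proof cases
    case 1
    then show ?thesis using RH s by (auto simp: Riemann_Hypothesis_def)
  next
    case 2
    then have "Im s \<noteq> 0" using s(2) by (auto simp: complex_eq_iff)
    then show ?thesis using zeta_nonzero_Re_eq_1[of "Im s"] 2 s(3) by (metis complex_surj)
  next
    case 3
    then show ?thesis using zeta_nonzero_Re_gt_1 s(3) by blast
  qed
qed

section \<open>Consequences of the Riemann Hypothesis\<close>

lemma Re_sum_list: "Re (\<Sum>a\<leftarrow>as. f a) = (\<Sum>a\<leftarrow>as. Re (f a))"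
  by (induction as) auto

text \<open>Landau's factorization in discs about \<open>2 + i t\<close>, where
  \<open>norm zeta >= 1/3\<close>, with \<open>R = 7/4\<close>, \<open>r = 13/8\<close>,
  \<open>d = 1/16\<close>. The large disc stays in \<open>Re >= 1/4\<close>, where growth is
  polynomial, and \<open>r - 2 d = 3/2\<close> just reaches the critical line. The norm bound, which
  degenerates at the critical line, is meant for the horizontal edges, where the kernel is tiny; the
  one-sided bound is uniform.\<close>

lemma RH_log_deriv_zeta:
  assumes RH: "Riemann_Hypothesis"
  obtains K where "K > 0"
    "\<And>s. \<lbrakk>1 / 2 < Re s; Re s \<le> 3; 2 \<le> \<bar>Im s\<bar>\<rbrakk> \<Longrightarrow> Re (deriv zeta s / zeta s) \<ge> - K * ln \<bar>Im s\<bar>"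
    "\<And>s. \<lbrakk>1 / 2 < Re s; Re s \<le> 3; 2 \<le> \<bar>Im s\<bar>\<rbrakk> \<Longrightarrow>
       norm (deriv zeta s / zeta s) \<le> K * ln \<bar>Im s\<bar> * (1 + 1 / (Re s - 1 / 2))"
proof -
  obtain C where C: "C \<ge> 0" "\<And>s. Re s \<ge> 1 / 4 \<Longrightarrow> s \<noteq> 1 \<Longrightarrow> norm (zeta s) \<le> 1 / norm (s - 1) + C * norm s"
    using zeta_bound by blast
  define M1 where "M1 = 4 + 4 * C"
  \<comment> \<open>\<open>D1\<close> and \<open>D2\<close> are the error constant and the
    root-count constant of \<open>landau_log_deriv\<close> for these radii; \<open>D3\<close> turns
    \<open>ln (M / norm (f 0))\<close> into a multiple of \<open>ln (abs t)\<close>, using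
    \<open>ln (abs t) >= ln 2\<close>.\<close>
  define D1 :: real where "D1 = 4 * (13 / 8) / (1 / 16)\<^sup>2 + 1 / (ln ((7 / 4) / (13 / 8)) * (7 / 4 - 13 / 8))"
  define D2 :: real where "D2 = 1 / ln ((7 / 4) / (13 / 8))"
  define D3 where "D3 = ln (3 * M1) / ln 2 + 1"
  have ln0: "ln ((7 / 4) / (13 / 8) :: real) > 0" by (intro ln_gt_zero) auto
  have D: "D1 > 0" "D2 > 0" "D3 > 0"
  proof -
    show "D1 > 0" unfolding D1_def using ln0 by (intro add_pos_pos) auto
    show "D2 > 0" unfolding D2_def using ln0 by simp
    have "ln (3 * M1) \<ge> 0" using C(1) by (intro ln_ge_zero) (auto simp: M1_def)
    then show "D3 > 0" unfolding D3_def by (intro add_nonneg_pos divide_nonneg_pos) auto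
  qed
  define K where "K = (D1 + D2) * D3"
  have main: "Re (deriv zeta s / zeta s) \<ge> - K * ln \<bar>Im s\<bar> \<and>
      norm (deriv zeta s / zeta s) \<le> K * ln \<bar>Im s\<bar> * (1 + 1 / (Re s - 1 / 2))"
    if s: "1 / 2 < Re s" "Re s \<le> 3" "2 \<le> \<bar>Im s\<bar>" for s
  proof -
    define t where "t = Im s"
    have t: "\<bar>t\<bar> \<ge> 2" using s by (simp add: t_def)
    define c where "c = Complex 2 t"
    define f where "f = (\<lambda>z. zeta (c + z))"
    define S where "S = (\<lambda>z. c + z) -` ({s. Re s > 0} - {1})"
    have opS: "open S" unfolding S_def
      by (intro open_vimage open_delete open_halfspace_Re_gt continuous_intros)
    have norm_c: "norm (c - 1) \<ge> 2" using abs_Im_le_cmod[of "c - 1"] t by (simp add: c_def)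
    have dist1: "norm (c + z - 1) \<ge> 1 / 4" "Re (c + z) \<ge> 1 / 4" if "norm z \<le> 7 / 4" for z
    proof -
      show "norm (c + z - 1) \<ge> 1 / 4"
        using norm_triangle_ineq2[of "c - 1" "- z"] norm_c that by (simp add: algebra_simps)
      show "Re (c + z) \<ge> 1 / 4" using abs_Re_le_cmod[of z] that by (simp add: c_def)
    qed
    have subS: "cball 0 (7 / 4) \<subseteq> S"
    proof
      fix z :: complex assume "z \<in> cball 0 (7 / 4)"
      then have "norm z \<le> 7 / 4" by simp
      from dist1[OF this] show "z \<in> S" by (auto simp: S_def)
    qed
    have holf: "f holomorphic_on S" unfolding f_def
    proof -
      have "(\<lambda>z. c + z) holomorphic_on S" by (intro holomorphic_intros)
      from holomorphic_on_compose_gen[OF this zeta_holomorphic]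
      show "(\<lambda>z. zeta (c + z)) holomorphic_on S" by (simp add: o_def S_def)
    qed
    have df: "deriv f z = deriv zeta (c + z)" if "z \<in> S" for z
    proof -
      have "(zeta has_field_derivative deriv zeta (c + z)) (at (c + z))"
        by (rule holomorphic_derivI[OF zeta_holomorphic]) (use that in \<open>auto simp: S_def intro!: open_delete open_halfspace_Re_gt\<close>)
      then show ?thesis unfolding f_def
        using DERIV_shift[of zeta "deriv zeta (c + z)" z c]
        by (intro DERIV_imp_deriv) (simp add: add.commute)
    qed
    have f0: "norm (f 0) \<ge> 1 / 3" "norm (f 0) \<le> 2" "f 0 \<noteq> 0"
      using norm_zeta_Re_ge_2[of c] zeta_nonzero_Re_ge_2[of c] by (auto simp: f_def c_def)
    define M where "M = M1 * \<bar>t\<bar>"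
    have M: "norm (f z) \<le> M" if z: "norm z = 7 / 4" for z
    proof -
      have d: "norm (c + z - 1) \<ge> 1 / 4" "Re (c + z) \<ge> 1 / 4" using dist1 z by auto
      then have "c + z \<noteq> 1" by auto
      then have "norm (f z) \<le> 1 / norm (c + z - 1) + C * norm (c + z)"
        unfolding f_def using C(2) d by blast
      also have "1 / norm (c + z - 1) \<le> 1 / (1 / 4)" using d by (intro divide_left_mono) auto
      also have "norm (c + z) \<le> (2 + \<bar>t\<bar>) + 7 / 4"
        using norm_triangle_ineq[of c z] cmod_le[of c] z by (simp add: c_def)
      also have "\<dots> \<le> 4 * \<bar>t\<bar>" using t by simp
      finally have "norm (f z) \<le> 4 + C * (4 * \<bar>t\<bar>)" using C(1) by (simp add: mult_left_mono)
      also have "\<dots> \<le> M" using t by (simp add: M_def M1_def algebra_simps)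
      finally show ?thesis .
    qed
    have "M \<ge> 4 * 2" unfolding M_def M1_def using C(1) t by (intro mult_mono) auto
    then have Mf: "norm (f 0) < M" using f0 by simp
    have B: "ln (M / norm (f 0)) \<le> D3 * ln \<bar>t\<bar>" "ln (M / norm (f 0)) \<ge> 0"
    proof -
      have "M / norm (f 0) \<le> M / (1 / 3)" using f0 \<open>M \<ge> 4 * 2\<close> by (intro divide_left_mono) auto
      then have "ln (M / norm (f 0)) \<le> ln (3 * M1 * \<bar>t\<bar>)"
        using f0 \<open>M \<ge> 4 * 2\<close> by (intro ln_mono) (auto simp: M_def)
      also have "\<dots> = ln (3 * M1) + ln \<bar>t\<bar>"
        using t C(1) by (subst ln_mult) (auto simp: M1_def)
      also have "ln (3 * M1) \<le> ln (3 * M1) / ln 2 * ln \<bar>t\<bar>"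
      proof -
        have "ln (3 * M1) \<ge> 0" using C(1) by (intro ln_ge_zero) (auto simp: M1_def)
        moreover have "ln \<bar>t\<bar> \<ge> ln 2" using t by (intro ln_mono) auto
        ultimately have "ln (3 * M1) * ln 2 \<le> ln (3 * M1) * ln \<bar>t\<bar>" by (intro mult_left_mono)
        then show ?thesis by (simp add: field_simps)
      qed
      finally show "ln (M / norm (f 0)) \<le> D3 * ln \<bar>t\<bar>" by (simp add: D3_def algebra_simps)
      show "ln (M / norm (f 0)) \<ge> 0" using Mf f0(3) by (intro ln_ge_zero) (simp add: field_simps)
    qed
    obtain as where as: "\<And>a. a \<in> set as \<Longrightarrow> norm a \<le> 13 / 8 \<and> f a = 0"
      "real (length as) \<le> ln (M / norm (f 0)) / ln ((7 / 4) / (13 / 8))"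
      "\<And>z. \<lbrakk>norm z \<le> 13 / 8 - 2 * (1 / 16); f z \<noteq> 0\<rbrakk> \<Longrightarrow>
         norm (deriv f z / f z - (\<Sum>a\<leftarrow>as. 1 / (z - a))) \<le> D1 * ln (M / norm (f 0))"
      unfolding D1_def
      by (rule landau_log_deriv[OF opS subS _ _ _ holf f0(3) M Mf, of "1/16" "13/8"]) auto
    define z where "z = s - c"
    have z: "z = of_real (Re s - 2)" by (simp add: z_def c_def t_def complex_eq_iff)
    have nz: "norm z \<le> 3 / 2" unfolding z norm_of_real using s by linarith
    have zS: "z \<in> S" using nz subS by auto
    have fz: "f z = zeta s" by (simp add: f_def z_def)
    have zs0: "zeta s \<noteq> 0"
    proof
      have "s \<noteq> 1" using s(3) by force
      moreover assume "zeta s = 0"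
      ultimately show False using RH_zeta_zero[OF RH, of s] s by linarith
    qed
    have dz: "deriv f z = deriv zeta s" using df[OF zS] by (simp add: z_def)
    have e: "norm (deriv zeta s / zeta s - (\<Sum>a\<leftarrow>as. 1 / (z - a))) \<le> D1 * ln (M / norm (f 0))"
      using as(3)[of z] nz zs0 fz dz by simp
    also have "\<dots> \<le> D1 * (D3 * ln \<bar>t\<bar>)" using B D by (intro mult_left_mono) auto
    finally have e: "norm (deriv zeta s / zeta s - (\<Sum>a\<leftarrow>as. 1 / (z - a))) \<le> D1 * D3 * ln \<bar>t\<bar>"
      by (simp add: mult.assoc)
    \<comment> \<open>Under the hypothesis all roots of \<open>f\<close> in the disc lie on one
      vertical line, and \<open>z\<close> is real, so \<open>Re (z - a)\<close> has the same
      positive value for every root.\<close>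
    have rea: "Re (z - a) = Re s - 1 / 2" if a: "a \<in> set as" for a
    proof -
      have na: "norm a \<le> 7 / 4" "zeta (c + a) = 0" using as(1)[OF a] by (auto simp: f_def)
      from dist1[OF na(1)] have "Re (c + a) > 0" "c + a \<noteq> 1" by auto
      then have "Re (c + a) = 1 / 2" using RH_zeta_zero[OF RH] na(2) by blast
      then show ?thesis by (simp add: z c_def)
    qed
    have r1: "Re (\<Sum>a\<leftarrow>as. 1 / (z - a)) \<ge> 0"
      unfolding Re_sum_list
    proof (intro sum_list_nonneg, clarsimp)
      fix a assume "a \<in> set as"
      then show "0 \<le> Re (1 / (z - a))" using rea[of a] s unfolding Re_divide by simp
    qed
    have len: "real (length as) \<le> D2 * D3 * ln \<bar>t\<bar>"
    proof -
      have "real (length as) \<le> D2 * ln (M / norm (f 0))" using as(2) by (simp add: D2_def)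
      also have "\<dots> \<le> D2 * (D3 * ln \<bar>t\<bar>)" using B D by (intro mult_left_mono) auto
      finally show ?thesis by (simp add: mult.assoc)
    qed
    have lt: "ln \<bar>t\<bar> \<ge> 0" using t by simp
    have r2: "norm (\<Sum>a\<leftarrow>as. 1 / (z - a)) \<le> real (length as) * (1 / (Re s - 1 / 2))"
    proof (rule norm_sum_list_le)
      fix a assume "a \<in> set as"
      then have "norm (z - a) \<ge> Re s - 1 / 2" using rea complex_Re_le_cmod by metis
      then show "norm (1 / (z - a)) \<le> 1 / (Re s - 1 / 2)"
        using s by (simp add: norm_divide frac_le)
    qed
    also have "\<dots> \<le> D2 * D3 * ln \<bar>t\<bar> * (1 / (Re s - 1 / 2))"
      using len s by (intro mult_right_mono) auto
    finally have r2: "norm (\<Sum>a\<leftarrow>as. 1 / (z - a)) \<le> D2 * D3 * ln \<bar>t\<bar> * (1 / (Re s - 1 / 2))" .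
    have "Re (deriv zeta s / zeta s) \<ge> - (D1 * D3 * ln \<bar>t\<bar>)"
      using r1 e abs_Re_le_cmod[of "deriv zeta s / zeta s - (\<Sum>a\<leftarrow>as. 1 / (z - a))"] by simp
    moreover have "D1 * D3 * ln \<bar>t\<bar> \<le> K * ln \<bar>t\<bar>"
      using D lt by (intro mult_right_mono) (auto simp: K_def algebra_simps)
    moreover have "norm (deriv zeta s / zeta s) \<le> D1 * D3 * ln \<bar>t\<bar> + D2 * D3 * ln \<bar>t\<bar> * (1 / (Re s - 1 / 2))"
      using e r2 norm_triangle_sub[of "deriv zeta s / zeta s" "\<Sum>a\<leftarrow>as. 1 / (z - a)"] by linarith
    moreover have "D1 * D3 * ln \<bar>t\<bar> + D2 * D3 * ln \<bar>t\<bar> * (1 / (Re s - 1 / 2))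
        \<le> K * ln \<bar>t\<bar> + K * ln \<bar>t\<bar> * (1 / (Re s - 1 / 2))"
      using D lt s by (intro add_mono mult_right_mono) (auto simp: K_def algebra_simps)
    ultimately show ?thesis unfolding t_def[symmetric] by (simp add: algebra_simps)
  qed
  have "K > 0" using D by (simp add: K_def)
  then show ?thesis using main that by blast
qed

section \<open>A Poisson formula with a smoothing kernel\<close>

lemma rectpath_integral_split:
  assumes "continuous_on (cbox p q - box p q) g" "Re p \<le> Re q" "Im p \<le> Im q"
  shows "contour_integral (rectpath p q) g =
    contour_integral (linepath p (Complex (Re q) (Im p))) g +
    contour_integral (linepath (Complex (Re q) (Im p)) q) g +
    contour_integral (linepath q (Complex (Re p) (Im q))) g -
    contour_integral (linepath p (Complex (Re p) (Im q))) g"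
    and "g contour_integrable_on linepath p (Complex (Re q) (Im p))"
    "g contour_integrable_on linepath (Complex (Re q) (Im p)) q"
    "g contour_integrable_on linepath q (Complex (Re p) (Im q))"
    "g contour_integrable_on linepath p (Complex (Re p) (Im q))"
proof -
  let ?a = "Complex (Re q) (Im p)" and ?b = "Complex (Re p) (Im q)"
  have pi: "path_image (rectpath p q) = closed_segment p ?a \<union> closed_segment ?a q \<union> closed_segment q ?b \<union> closed_segment ?b p"
    by (simp add: rectpath_def Let_def path_image_join Un_assoc)
  have sub: "closed_segment p ?a \<union> closed_segment ?a q \<union> closed_segment q ?b \<union> closed_segment ?b p \<subseteq> cbox p q - box p q"
    unfolding pi[symmetric] by (subst path_image_rectpath_cbox_minus_box) (use assms in auto)
  have c: "continuous_on (closed_segment p ?a) g" "continuous_on (closed_segment ?a q) g"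
    "continuous_on (closed_segment q ?b) g" "continuous_on (closed_segment ?b p) g"
    using sub by (auto intro: continuous_on_subset[OF assms(1)])
  then have c': "continuous_on (closed_segment p ?b) g" by (simp add: closed_segment_commute)
  show i: "g contour_integrable_on linepath p ?a" "g contour_integrable_on linepath ?a q"
     "g contour_integrable_on linepath q ?b" "g contour_integrable_on linepath p ?b"
    using c c' by (auto intro: contour_integrable_continuous_linepath)
  have i4: "g contour_integrable_on linepath ?b p" using c by (auto intro: contour_integrable_continuous_linepath)
  have rev: "contour_integral (linepath ?b p) g = - contour_integral (linepath p ?b) g"
    using contour_integral_reversepath[of "linepath ?b p" g] by simp
  show "contour_integral (rectpath p q) g = contour_integral (linepath p ?a) g +
    contour_integral (linepath ?a q) g + contour_integral (linepath q ?b) g - contour_integral (linepath p ?b) g"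
    using i i4 by (simp add: rectpath_def Let_def rev)
qed

text \<open>Both vertical edges are parametrized upwards, hence the opposite signs. An edge must be
  kept as an exact integral where information beyond its size is used: conjugate symmetry in the
  kernel formula, cancellation between two adjacent rectangles in Perron's formula.\<close>

lemma rectpath_integral_vertical_edges:
  assumes cont: "continuous_on (cbox p q - box p q) g" and pq: "Re p \<le> Re q" "Im p < Im q"
    and I: "(g has_contour_integral I) (rectpath p q)"
    and B1: "B\<^sub>1 \<ge> 0" "\<And>w. \<lbrakk>w \<in> cbox p q; Im w = Im p \<or> Im w = Im q\<rbrakk> \<Longrightarrow> norm (g w) \<le> B\<^sub>1"
  shows "norm (I + \<i> * integral {Im p..Im q} (\<lambda>y. g (Complex (Re p) y))
                - \<i> * integral {Im p..Im q} (\<lambda>y. g (Complex (Re q) y)))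
           \<le> 2 * B\<^sub>1 * (Re q - Re p)"
proof -
  let ?a = "Complex (Re q) (Im p)" and ?b = "Complex (Re p) (Im q)"
  note split = rectpath_integral_split[OF cont pq(1) order_less_imp_le[OF pq(2)]]
  have seg: "closed_segment p ?a = {w. Im w = Im p \<and> Re w \<in> {Re p..Re q}}"
    "closed_segment q ?b = {w. Im w = Im q \<and> Re w \<in> {Re p..Re q}}"
    using pq by (auto simp: closed_segment_same_Im closed_segment_same_Re closed_segment_eq_real_ivl)
  have "norm (contour_integral (linepath p ?a) g) \<le> B\<^sub>1 * norm (?a - p)"
    by (rule contour_integral_bound_linepath[OF split(2) B1(1)])
      (rule B1(2), use seg pq in \<open>auto simp: in_cbox_complex_iff\<close>)
  moreover have "norm (?a - p) = Re q - Re p"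
  proof -
    have "?a - p = of_real (Re q - Re p)" by (simp add: complex_eq_iff)
    then have "norm (?a - p) = \<bar>Re q - Re p\<bar>" by (simp only: norm_of_real)
    then show ?thesis using pq by linarith
  qed
  moreover have "norm (contour_integral (linepath q ?b) g) \<le> B\<^sub>1 * norm (?b - q)"
    by (rule contour_integral_bound_linepath[OF split(4) B1(1)])
      (rule B1(2), use seg pq in \<open>auto simp: in_cbox_complex_iff\<close>)
  moreover have "norm (?b - q) = Re q - Re p"
  proof -
    have "?b - q = - of_real (Re q - Re p)" by (simp add: complex_eq_iff)
    then have "norm (?b - q) = \<bar>Re q - Re p\<bar>" by (simp only: norm_of_real norm_minus_cancel)
    then show ?thesis using pq by linarith
  qed
  moreover have "contour_integral (linepath p ?b) g = \<i> * integral {Im p..Im q} (\<lambda>y. g (Complex (Re p) y))"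
    by (rule contour_integral_linepath_same_Re) (use pq in auto)
  moreover have "contour_integral (linepath ?a q) g = \<i> * integral {Im p..Im q} (\<lambda>y. g (Complex (Re q) y))"
    by (rule contour_integral_linepath_same_Re) (use pq in auto)
  moreover have "I = contour_integral (rectpath p q) g" using I by (simp add: contour_integral_unique)
  ultimately show ?thesis
    using split(1) norm_triangle_ineq[of "contour_integral (linepath p ?a) g" "contour_integral (linepath q ?b) g"]
    by (simp add: algebra_simps)
qed

lemma norm_integral_vertical_line_le:
  assumes "c \<le> d" "continuous_on {c..d} (\<lambda>y. g (Complex u y))"
    and "\<And>y. \<lbrakk>c \<le> y; y \<le> d\<rbrakk> \<Longrightarrow> norm (g (Complex u y)) \<le> B"
  shows "norm (\<i> * integral {c..d} (\<lambda>y. g (Complex u y))) \<le> B * (d - c)"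
proof -
  have "norm (integral {c..d} (\<lambda>y. g (Complex u y))) \<le> B * (d - c)"
    by (rule integral_bound) (use assms in auto)
  then show ?thesis by (simp add: norm_mult)
qed

lemma continuous_on_vertical_line:
  assumes "continuous_on S g" "\<And>y. y \<in> T \<Longrightarrow> Complex u y \<in> S"
  shows "continuous_on T (\<lambda>y. g (Complex u y))"
proof -
  have "continuous_on T (\<lambda>y. Complex u y)" unfolding Complex_eq by (intro continuous_intros)
  then show ?thesis using assms by (intro continuous_on_compose2[OF assms(1)]) auto
qed

lemma rectpath_integral_left_edge:
  assumes cont: "continuous_on (cbox p q - box p q) g" and pq: "Re p \<le> Re q" "Im p < Im q"
    and I: "(g has_contour_integral I) (rectpath p q)"
    and B1: "B\<^sub>1 \<ge> 0" "\<And>w. \<lbrakk>w \<in> cbox p q; Im w = Im p \<or> Im w = Im q\<rbrakk> \<Longrightarrow> norm (g w) \<le> B\<^sub>1"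
    and B2: "\<And>w. \<lbrakk>w \<in> cbox p q; Re w = Re q\<rbrakk> \<Longrightarrow> norm (g w) \<le> B\<^sub>2"
  shows "norm (I + \<i> * integral {Im p..Im q} (\<lambda>y. g (Complex (Re p) y)))
           \<le> 2 * B\<^sub>1 * (Re q - Re p) + B\<^sub>2 * (Im q - Im p)"
proof -
  have "norm (\<i> * integral {Im p..Im q} (\<lambda>y. g (Complex (Re q) y))) \<le> B\<^sub>2 * (Im q - Im p)"
    by (intro norm_integral_vertical_line_le continuous_on_vertical_line[OF cont] B2)
      (use pq in \<open>auto simp: in_cbox_complex_iff in_box_complex_iff\<close>)
  then show ?thesis
    using rectpath_integral_vertical_edges[OF cont pq I B1]
      norm_triangle_sub[of "I + \<i> * integral {Im p..Im q} (\<lambda>y. g (Complex (Re p) y))"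
        "\<i> * integral {Im p..Im q} (\<lambda>y. g (Complex (Re q) y))"] by linarith
qed

lemma rectpath_integral_right_edge:
  assumes cont: "continuous_on (cbox p q - box p q) g" and pq: "Re p \<le> Re q" "Im p < Im q"
    and I: "(g has_contour_integral I) (rectpath p q)"
    and B1: "B\<^sub>1 \<ge> 0" "\<And>w. \<lbrakk>w \<in> cbox p q; Im w = Im p \<or> Im w = Im q\<rbrakk> \<Longrightarrow> norm (g w) \<le> B\<^sub>1"
    and B2: "\<And>w. \<lbrakk>w \<in> cbox p q; Re w = Re p\<rbrakk> \<Longrightarrow> norm (g w) \<le> B\<^sub>2"
  shows "norm (I - \<i> * integral {Im p..Im q} (\<lambda>y. g (Complex (Re q) y)))
           \<le> 2 * B\<^sub>1 * (Re q - Re p) + B\<^sub>2 * (Im q - Im p)"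
proof -
  let ?P = "\<i> * integral {Im p..Im q} (\<lambda>y. g (Complex (Re p) y))"
    and ?Q = "\<i> * integral {Im p..Im q} (\<lambda>y. g (Complex (Re q) y))"
  have "norm ?P \<le> B\<^sub>2 * (Im q - Im p)"
    by (intro norm_integral_vertical_line_le continuous_on_vertical_line[OF cont] B2)
      (use pq in \<open>auto simp: in_cbox_complex_iff in_box_complex_iff\<close>)
  moreover have "norm (I - ?Q) \<le> norm (I + ?P - ?Q) + norm ?P"
    using norm_triangle_ineq4[of "I + ?P - ?Q" ?P] by simp
  ultimately show ?thesis
    using rectpath_integral_vertical_edges[OF cont pq I B1] by linarith
qed

text \<open>Without the exponential weight the integrand is the Poisson kernel of the right half
  plane, up to normalization. Its primitive is \<open>2 * arctan (y / \<eta>)\<close>, so the total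
  mass is at most \<open>2 * pi\<close> for every \<open>\<eta>\<close>.\<close>

lemma integral_poisson_le:
  fixes \<eta> Y :: real
  assumes "\<eta> > 0" "Y > 0"
  shows "integral {-Y..Y} (\<lambda>y. exp (- y\<^sup>2 - \<eta>\<^sup>2) * (2 * \<eta> / (y\<^sup>2 + \<eta>\<^sup>2))) \<le> 2 * pi"
proof -
  have nz: "y\<^sup>2 + \<eta>\<^sup>2 \<noteq> 0" "y\<^sup>2 + \<eta>\<^sup>2 > 0" for y using assms by (auto simp: add_nonneg_pos add_nonneg_eq_0_iff)
  have "((\<lambda>y. 2 * \<eta> / (y\<^sup>2 + \<eta>\<^sup>2)) has_integral (2 * arctan (Y / \<eta>) - 2 * arctan (- Y / \<eta>))) {-Y..Y}"
  proof (rule fundamental_theorem_of_calculus)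
    fix y :: real
    have "((\<lambda>y. 2 * arctan (y / \<eta>)) has_real_derivative 2 * (1 / \<eta> / (1 + (y / \<eta>)\<^sup>2))) (at y within {-Y..Y})"
      using assms by (auto intro!: derivative_eq_intros simp: divide_inverse)
    moreover have "2 * (1 / \<eta> / (1 + (y / \<eta>)\<^sup>2)) = 2 * \<eta> / (y\<^sup>2 + \<eta>\<^sup>2)"
      using assms nz[of y] by (simp add: divide_simps) (simp add: power2_eq_square algebra_simps)
    ultimately show "((\<lambda>y. 2 * arctan (y / \<eta>)) has_vector_derivative 2 * \<eta> / (y\<^sup>2 + \<eta>\<^sup>2)) (at y within {-Y..Y})"
      by (simp add: has_real_derivative_iff_has_vector_derivative)
  qed (use assms in auto)
  note hi = this
  have "integral {-Y..Y} (\<lambda>y. exp (- y\<^sup>2 - \<eta>\<^sup>2) * (2 * \<eta> / (y\<^sup>2 + \<eta>\<^sup>2))) \<le> integral {-Y..Y} (\<lambda>y. 2 * \<eta> / (y\<^sup>2 + \<eta>\<^sup>2))"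
  proof (rule integral_le)
    show "(\<lambda>y. exp (- y\<^sup>2 - \<eta>\<^sup>2) * (2 * \<eta> / (y\<^sup>2 + \<eta>\<^sup>2))) integrable_on {-Y..Y}"
      using nz by (intro integrable_continuous_interval continuous_intros) auto
    show "exp (- y\<^sup>2 - \<eta>\<^sup>2) * (2 * \<eta> / (y\<^sup>2 + \<eta>\<^sup>2)) \<le> 2 * \<eta> / (y\<^sup>2 + \<eta>\<^sup>2)" for y
    proof -
      have "exp (- y\<^sup>2 - \<eta>\<^sup>2) \<le> 1" by simp
      then show ?thesis using assms nz(2)[of y] by (intro mult_left_le_one_le) auto
    qed
  qed (use hi in auto)
  also have "\<dots> = 2 * arctan (Y / \<eta>) - 2 * arctan (- Y / \<eta>)" using hi by (rule integral_unique)
  also have "\<dots> \<le> 2 * pi" using arctan_ubound[of "Y / \<eta>"] arctan_lbound[of "- Y / \<eta>"] by linarith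
  finally show ?thesis .
qed

text \<open>A localized Poisson formula for the right half plane. The weight \<open>exp (w^2)\<close> truncates the
  integral, and on the imaginary axis the kernels belonging to \<open>x\<close> and \<open>1 / x\<close> are conjugate up to
  a constant. Hence only \<open>Re G\<close> enters on that edge, where it is bounded below.\<close>

lemma positive_real_part_kernel_bound:
  fixes G :: "complex \<Rightarrow> complex" and a Y \<eta> x K B :: real
  assumes hol: "G holomorphic_on cbox (Complex 0 (- Y)) (Complex a Y)"
    and \<eta>: "0 < \<eta>" "\<eta> < a" and Y: "Y > 0" and x: "x \<ge> 1" "x powr (- \<eta>) \<le> 1 / 4"
    and K: "K \<ge> 0" "\<And>y. \<bar>y\<bar> \<le> Y \<Longrightarrow> Re (G (Complex 0 y)) \<ge> - K"
    and B: "B \<ge> 0" "\<And>w. \<lbrakk>0 \<le> Re w; Re w \<le> a; \<bar>Im w\<bar> \<le> Y; Re w = a \<or> \<bar>Im w\<bar> = Y\<rbrakk> \<Longrightarrow>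
      norm (G w) * x powr Re w * exp ((Re w)\<^sup>2 - (Im w)\<^sup>2) * (2 * \<eta> / norm (w\<^sup>2 - of_real (\<eta>\<^sup>2))) \<le> B"
  shows "norm (G (of_real \<eta>)) \<le> x powr (- \<eta>) * (2 * (B * (2 * a + 2 * Y)) + 10 * K)"
proof -
  define p q where "p = Complex 0 (- Y)" and "q = Complex a Y"
  define P where "P = (\<lambda>y::real. exp (- y\<^sup>2 - \<eta>\<^sup>2) * (2 * \<eta> / (y\<^sup>2 + \<eta>\<^sup>2)))"
  \<comment> \<open>The last factor is \<open>1 / (w - \<eta>) - 1 / (w + \<eta>)\<close>: its only
    pole in the rectangle is at \<open>\<eta>\<close>, and on the imaginary axis it is minus the
    Poisson kernel. Both exponentials equal \<open>1\<close> at \<open>\<eta>\<close>, so the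
    residue of \<open>G * k l\<close> is \<open>G \<eta>\<close> for every \<open>l\<close>; the
    values used are \<open>ln x\<close>, \<open>- ln x\<close> and \<open>0\<close>.\<close>
  define k where "k = (\<lambda>l::real. \<lambda>w::complex. exp ((w - of_real \<eta>) * of_real l) * exp (w\<^sup>2 - of_real (\<eta>\<^sup>2)) *
     (2 * of_real \<eta> / ((w + of_real \<eta>) * (w - of_real \<eta>))))"
  define Jint where "Jint = (\<lambda>l. integral {-Y..Y} (\<lambda>y. G (Complex 0 y) * k l (Complex 0 y)))"
  define g0 where "g0 = G (of_real \<eta>)"
  define c where "c = B * (2 * a + 2 * Y)"
  have a0: "a > 0" using \<eta> by simp
  have c0: "c \<ge> 0" unfolding c_def using B(1) a0 Y by simp
  have etabox: "of_real \<eta> \<in> box p q" using \<eta> Y by (auto simp: p_def q_def in_box_complex_iff)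
  have wne: "w + of_real \<eta> \<noteq> 0" if "Re w \<ge> 0" for w
  proof
    assume "w + of_real \<eta> = 0"
    then have "Re (w + of_real \<eta>) = 0" by simp
    then show False using that \<eta> by simp
  qed
  have wne': "w - of_real \<eta> \<noteq> 0" if "w \<in> cbox p q - box p q" for w using that etabox by auto
  have hol': "G holomorphic_on cbox p q" using hol by (simp add: p_def q_def)
  have residue: "((\<lambda>w. G w * k l w) has_contour_integral (2 * pi * \<i> * g0)) (rectpath p q)" for l
  proof -
    define f where "f = (\<lambda>w. G w * exp ((w - of_real \<eta>) * of_real l) * exp (w\<^sup>2 - of_real (\<eta>\<^sup>2)) * (2 * of_real \<eta> / (w + of_real \<eta>)))"
    have "((\<lambda>w. f w / (w - of_real \<eta>)) has_contour_integral
        (2 * pi * \<i> * winding_number (rectpath p q) (of_real \<eta>) * f (of_real \<eta>))) (rectpath p q)"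
    proof (rule Cauchy_integral_formula_convex_simple[where S = "cbox p q"])
      show "f holomorphic_on cbox p q" unfolding f_def
        by (intro holomorphic_intros hol') (use wne in \<open>auto simp: p_def in_cbox_complex_iff\<close>)
      show "path_image (rectpath p q) \<subseteq> cbox p q - {of_real \<eta>}"
        using etabox Y a0 by (subst path_image_rectpath_cbox_minus_box) (auto simp: p_def q_def)
    qed (use etabox in \<open>auto simp: interior_cbox\<close>)
    moreover have "winding_number (rectpath p q) (of_real \<eta>) = 1"
      using etabox by (intro winding_number_rectpath)
    moreover have "f (of_real \<eta>) = g0" using \<eta> by (simp add: f_def g0_def)
    moreover have "(\<lambda>w. f w / (w - of_real \<eta>)) = (\<lambda>w. G w * k l w)"
      by (auto simp: f_def k_def)
    ultimately show ?thesis by simp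
  qed
  have contk: "continuous_on (cbox p q - box p q) (\<lambda>w. G w * k l w)" for l
    unfolding k_def
    by (intro continuous_intros continuous_on_subset[OF holomorphic_on_imp_continuous_on[OF hol']])
      (use wne wne' in \<open>auto simp: p_def in_cbox_complex_iff\<close>)
  have normk: "norm (k l w) = exp ((Re w - \<eta>) * l) * exp ((Re w)\<^sup>2 - (Im w)\<^sup>2 - \<eta>\<^sup>2) * (2 * \<eta> / norm (w\<^sup>2 - of_real (\<eta>\<^sup>2)))" for l w
  proof -
    have "(w + of_real \<eta>) * (w - of_real \<eta>) = w\<^sup>2 - of_real (\<eta>\<^sup>2)" by (simp add: power2_eq_square algebra_simps)
    then have 1: "norm (2 * of_real \<eta> / ((w + of_real \<eta>) * (w - of_real \<eta>))) = 2 * \<eta> / norm (w\<^sup>2 - of_real (\<eta>\<^sup>2))"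
      using \<eta> by (simp only: norm_divide norm_mult) simp
    have 2: "Re (w\<^sup>2 - of_real (\<eta>\<^sup>2)) = (Re w)\<^sup>2 - (Im w)\<^sup>2 - \<eta>\<^sup>2" by (simp add: Re_power2)
    have 3: "Re ((w - of_real \<eta>) * of_real l) = (Re w - \<eta>) * l" by simp
    show ?thesis unfolding k_def norm_mult[of "exp _ * exp _"] norm_mult[of "exp _"] norm_exp_eq_Re 1 2 3 ..
  qed
  \<comment> \<open>The assumption on the three outer edges is stated for the weight
    \<open>x powr Re w\<close>. The factor \<open>D\<close> compares the kernel for \<open>l\<close>
    with that weight, so that one estimate serves all three values of \<open>l\<close>.\<close>
  have edge: "norm (2 * pi * g0 + Jint l) \<le> D * c" if D: "D \<ge> 0"
     "\<And>u. \<lbrakk>0 \<le> u; u \<le> a\<rbrakk> \<Longrightarrow> exp ((u - \<eta>) * l) \<le> D * x powr u" for l D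
  proof -
    have "norm (2 * pi * \<i> * g0 + \<i> * integral {Im p..Im q} (\<lambda>y. G (Complex (Re p) y) * k l (Complex (Re p) y)))
           \<le> 2 * (D * B) * (Re q - Re p) + (D * B) * (Im q - Im p)"
    proof -
      have *: "norm (G w * k l w) \<le> D * B"
        if w: "w \<in> cbox p q" "Re w = Re q \<or> Im w = Im p \<or> Im w = Im q" for w
      proof -
        from w have w': "0 \<le> Re w" "Re w \<le> a" "\<bar>Im w\<bar> \<le> Y" "Re w = a \<or> \<bar>Im w\<bar> = Y"
          using Y by (auto simp: p_def q_def in_cbox_complex_iff)
        have "norm (G w * k l w) \<le> norm (G w) * ((D * x powr Re w) * exp ((Re w)\<^sup>2 - (Im w)\<^sup>2) * (2 * \<eta> / norm (w\<^sup>2 - of_real (\<eta>\<^sup>2))))"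
          unfolding norm_mult normk using \<eta> D(1) w' by (intro mult_left_mono mult_mono D(2)) auto
        also have "\<dots> = D * (norm (G w) * x powr Re w * exp ((Re w)\<^sup>2 - (Im w)\<^sup>2) * (2 * \<eta> / norm (w\<^sup>2 - of_real (\<eta>\<^sup>2))))"
          by (simp add: mult_ac)
        also have "\<dots> \<le> D * B" using B(2)[OF w'] D(1) by (intro mult_left_mono) auto
        finally show "norm (G w * k l w) \<le> D * B" .
      qed
      show ?thesis
        by (rule rectpath_integral_left_edge[OF contk _ _ residue])
          (use D B Y a0 in \<open>auto intro!: * simp: p_def q_def\<close>)
    qed
    also have "2 * pi * \<i> * g0 + \<i> * integral {Im p..Im q} (\<lambda>y. G (Complex (Re p) y) * k l (Complex (Re p) y))
        = \<i> * (2 * pi * g0 + Jint l)"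
      by (simp add: Jint_def p_def q_def algebra_simps)
    finally have "norm (2 * pi * g0 + Jint l) \<le> 2 * (D * B) * a + D * B * (2 * Y)"
      by (simp add: norm_mult p_def q_def)
    then show ?thesis by (simp add: c_def distrib_left mult_ac)
  qed
  have cG: "continuous_on {-Y..Y} (\<lambda>y. G (Complex 0 y))"
  proof -
    have "continuous_on {-Y..Y} (\<lambda>y. Complex 0 y)" unfolding Complex_eq by (intro continuous_intros)
    then show ?thesis
      using a0 by (intro continuous_on_compose2[OF holomorphic_on_imp_continuous_on[OF hol]])
        (auto simp: in_cbox_complex_iff)
  qed
  have nz: "y\<^sup>2 + \<eta>\<^sup>2 \<noteq> 0" "y\<^sup>2 + \<eta>\<^sup>2 > 0" for y using \<eta> by (auto simp: add_nonneg_pos add_nonneg_eq_0_iff)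
  have cP: "continuous_on {-Y..Y} P" unfolding P_def using nz by (intro continuous_intros) auto
  have P0: "P y \<ge> 0" for y unfolding P_def using \<eta> nz(2)[of y] by simp
  have kaxis: "k l (Complex 0 y) = - (of_real (exp (- \<eta> * l) * P y) * cis (y * l))" for l y
  proof -
    have 1: "exp ((Complex 0 y - of_real \<eta>) * of_real l) = of_real (exp (- \<eta> * l)) * cis (y * l)"
      by (simp add: cis_conv_exp exp_of_real[symmetric] exp_add[symmetric] Complex_eq algebra_simps)
    have 2: "(Complex 0 y)\<^sup>2 - of_real (\<eta>\<^sup>2) = of_real (- y\<^sup>2 - \<eta>\<^sup>2)" by (simp add: complex_eq_iff Re_power2 Im_power2)
    have 3: "(Complex 0 y + of_real \<eta>) * (Complex 0 y - of_real \<eta>) = - of_real (y\<^sup>2 + \<eta>\<^sup>2)"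
      by (simp add: complex_eq_iff power2_eq_square)
    have 4: "2 * of_real \<eta> / - of_real (y\<^sup>2 + \<eta>\<^sup>2) = - complex_of_real (2 * \<eta> / (y\<^sup>2 + \<eta>\<^sup>2))"
      by (simp only: of_real_divide of_real_mult of_real_numeral divide_minus_right)
    show ?thesis unfolding k_def 1 2 3 4 P_def exp_of_real of_real_mult by (simp only: mult_minus_right mult_ac)
  qed
  define U where "U = (\<lambda>y. Re (G (Complex 0 y)))"
  have cU: "continuous_on {-Y..Y} U" unfolding U_def by (intro continuous_intros cG)
  define q0 where "q0 = x powr (- \<eta>)"
  have q0: "0 < q0" "q0 \<le> 1 / 4" using x by (auto simp: q0_def)
  have x0: "x > 0" using x by simp
  have el: "exp (u * ln x) = x powr u" for u using x0 by (simp add: powr_def mult.commute)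
  have e1: "norm (2 * pi * g0 + Jint (ln x)) \<le> q0 * c"
  proof (rule edge)
    fix u :: real assume "0 \<le> u"
    then show "exp ((u - \<eta>) * ln x) \<le> q0 * x powr u"
      by (simp add: el q0_def flip: powr_add)
  qed (use q0 in auto)
  \<comment> \<open>A generous bound: the loss \<open>1 / q0\<close> is repaid when this identity is
    multiplied by \<open>q0^2\<close> below.\<close>
  have e2: "norm (2 * pi * g0 + Jint (- ln x)) \<le> (1 / q0) * c"
  proof (rule edge)
    fix u :: real assume "0 \<le> u"
    have "exp ((u - \<eta>) * - ln x) = x powr (\<eta> - u)" using el[of "\<eta> - u"] by (simp add: algebra_simps)
    also have "\<dots> \<le> x powr (\<eta> + u)" using x \<open>0 \<le> u\<close> by (intro powr_mono) auto
    also have "\<dots> = 1 / q0 * x powr u" by (simp add: q0_def powr_minus powr_add divide_inverse)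
    finally show "exp ((u - \<eta>) * - ln x) \<le> 1 / q0 * x powr u" .
  qed (use q0 in auto)
  have e3: "norm (2 * pi * g0 + Jint 0) \<le> 1 * c"
    by (rule edge) (use x in \<open>auto intro: ge_one_powr_ge_zero\<close>)
  have iU: "(\<lambda>y. U y * P y) integrable_on {-Y..Y}" by (intro integrable_continuous_interval continuous_intros cU cP)
  have iG: "(\<lambda>y. G (Complex 0 y) * (of_real (P y) * cis (y * l))) integrable_on {-Y..Y}" for l
    unfolding cis_conv_exp by (intro integrable_continuous_interval continuous_intros cG cP)
  have J0: "Re (Jint 0) = - integral {-Y..Y} (\<lambda>y. U y * P y)"
  proof -
    have "Jint 0 = - integral {-Y..Y} (\<lambda>y. G (Complex 0 y) * (of_real (P y) * cis (y * 0)))"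
      unfolding Jint_def kaxis by simp
    then have "Re (Jint 0) = - Re (integral {-Y..Y} (\<lambda>y. G (Complex 0 y) * (of_real (P y) * cis (y * 0))))" by simp
    also have "Re (integral {-Y..Y} (\<lambda>y. G (Complex 0 y) * (of_real (P y) * cis (y * 0)))) =
        integral {-Y..Y} (\<lambda>y. Re (G (Complex 0 y) * (of_real (P y) * cis (y * 0))))"
      using integral_linear[OF iG[of 0] bounded_linear_Re] by (simp add: o_def)
    finally show ?thesis by (simp add: U_def)
  qed
  have "integral {-Y..Y} (\<lambda>y. U y * P y) \<le> norm (2 * pi * g0) + c"
    using e3 J0 abs_Re_le_cmod[of "Jint 0"] norm_triangle_ineq2[of "Jint 0" "- (2 * pi * g0)"]
    by (simp add: add.commute)
  then have intU: "integral {-Y..Y} (\<lambda>y. U y * P y) \<le> 2 * pi * norm g0 + c" by (simp add: norm_mult)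
  \<comment> \<open>The one-sided bound suffices here: \<open>\<bar>U\<bar> \<le> U + 2 K\<close>,
    the integral of \<open>U * P\<close> is known from the case \<open>l = 0\<close>, and
    \<open>P\<close> has mass at most \<open>2 * pi\<close>.\<close>
  have absU: "integral {-Y..Y} (\<lambda>y. \<bar>U y\<bar> * P y) \<le> 2 * pi * norm g0 + c + 4 * pi * K"
  proof -
    have iP: "P integrable_on {-Y..Y}" by (intro integrable_continuous_interval cP)
    have "integral {-Y..Y} (\<lambda>y. \<bar>U y\<bar> * P y) \<le> integral {-Y..Y} (\<lambda>y. U y * P y + 2 * K * P y)"
    proof (rule integral_le)
      show "(\<lambda>y. \<bar>U y\<bar> * P y) integrable_on {-Y..Y}" by (intro integrable_continuous_interval continuous_intros cU cP)
      show "(\<lambda>y. U y * P y + 2 * K * P y) integrable_on {-Y..Y}" by (intro integrable_continuous_interval continuous_intros cU cP)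
      fix y assume "y \<in> {-Y..Y}"
      then have "U y \<ge> - K" using K(2)[of y] by (auto simp: U_def)
      then have "\<bar>U y\<bar> \<le> U y + 2 * K" using K(1) by linarith
      then have "\<bar>U y\<bar> * P y \<le> (U y + 2 * K) * P y" using P0 by (rule mult_right_mono)
      then show "\<bar>U y\<bar> * P y \<le> U y * P y + 2 * K * P y" by (simp add: algebra_simps)
    qed
    also have "\<dots> = integral {-Y..Y} (\<lambda>y. U y * P y) + 2 * K * integral {-Y..Y} P"
    proof -
      have "(\<lambda>y. 2 * K * P y) integrable_on {-Y..Y}" by (intro integrable_continuous_interval continuous_intros cP)
      from integral_add[OF iU this] show ?thesis by simp
    qed
    also have "2 * K * integral {-Y..Y} P \<le> 2 * K * (2 * pi)"
      using integral_poisson_le[OF \<eta>(1) Y] K(1) unfolding P_def by (intro mult_left_mono) auto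
    finally show ?thesis using intU by (simp add: mult_ac)
  qed
  \<comment> \<open>On the axis the integrals for \<open>ln x\<close> and \<open>- ln x\<close>
    carry the weights \<open>q0\<close> and \<open>1 / q0\<close> and conjugate phases.
    Multiplication by \<open>q0^2\<close> and conjugation align them, so \<open>G\<close> enters
    only through \<open>G + cnj G\<close>, twice its real part.\<close>
  have conj: "Jint (ln x) + cnj (of_real (q0 ^ 2) * Jint (- ln x)) =
      - (of_real (2 * q0) * integral {-Y..Y} (\<lambda>y. of_real (U y * P y) * cis (y * ln x)))"
  proof -
    have q1: "exp (- \<eta> * ln x) = q0" "exp (- \<eta> * - ln x) = 1 / q0"
      using el[of "- \<eta>"] el[of \<eta>] by (simp_all add: q0_def powr_minus divide_inverse)
    have 1: "Jint (ln x) = - (of_real q0 * integral {-Y..Y} (\<lambda>y. G (Complex 0 y) * (of_real (P y) * cis (y * ln x))))"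
    proof -
      have "Jint (ln x) = integral {-Y..Y} (\<lambda>y. - of_real q0 * (G (Complex 0 y) * (of_real (P y) * cis (y * ln x))))"
        unfolding Jint_def kaxis q1 by (simp add: mult_ac)
      then show ?thesis by simp
    qed
    have 2: "Jint (- ln x) = - (of_real (1 / q0) * integral {-Y..Y} (\<lambda>y. G (Complex 0 y) * (of_real (P y) * cis (y * - ln x))))"
    proof -
      have "Jint (- ln x) = integral {-Y..Y} (\<lambda>y. - of_real (1 / q0) * (G (Complex 0 y) * (of_real (P y) * cis (y * - ln x))))"
        unfolding Jint_def kaxis q1 by (simp add: mult_ac)
      then show ?thesis by simp
    qed
    have 3: "cnj (integral {-Y..Y} (\<lambda>y. G (Complex 0 y) * (of_real (P y) * cis (y * - ln x)))) =
       integral {-Y..Y} (\<lambda>y. cnj (G (Complex 0 y)) * (of_real (P y) * cis (y * ln x)))"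
      using integral_linear[OF iG[of "- ln x"] bounded_linear_cnj] by (simp add: o_def cis_cnj)
    have i3: "(\<lambda>y. cnj (G (Complex 0 y)) * (of_real (P y) * cis (y * ln x))) integrable_on {-Y..Y}"
      unfolding cis_conv_exp by (intro integrable_continuous_interval continuous_intros cG cP)
    have "Jint (ln x) + cnj (of_real (q0 ^ 2) * Jint (- ln x)) =
       - of_real q0 * (integral {-Y..Y} (\<lambda>y. G (Complex 0 y) * (of_real (P y) * cis (y * ln x))) +
          integral {-Y..Y} (\<lambda>y. cnj (G (Complex 0 y)) * (of_real (P y) * cis (y * ln x))))"
      unfolding 1 2 complex_cnj_mult complex_cnj_minus 3 using q0 by (simp add: power2_eq_square algebra_simps)
    also have "integral {-Y..Y} (\<lambda>y. G (Complex 0 y) * (of_real (P y) * cis (y * ln x))) +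
          integral {-Y..Y} (\<lambda>y. cnj (G (Complex 0 y)) * (of_real (P y) * cis (y * ln x))) =
        integral {-Y..Y} (\<lambda>y. 2 * (of_real (U y * P y) * cis (y * ln x)))"
    proof (subst integral_add[OF iG i3, symmetric], rule integral_cong)
      fix y
      have "G (Complex 0 y) + cnj (G (Complex 0 y)) = of_real (2 * U y)" by (simp add: U_def complex_add_cnj)
      then show "G (Complex 0 y) * (of_real (P y) * cis (y * ln x)) + cnj (G (Complex 0 y)) * (of_real (P y) * cis (y * ln x))
        = 2 * (of_real (U y * P y) * cis (y * ln x))"
        by (metis (no_types, lifting) distrib_right mult.assoc of_real_mult of_real_numeral)
    qed
    finally show ?thesis by simp
  qed
  have "norm (integral {-Y..Y} (\<lambda>y. of_real (U y * P y) * cis (y * ln x))) \<le> integral {-Y..Y} (\<lambda>y. \<bar>U y\<bar> * P y)"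
  proof (rule integral_norm_bound_integral)
    show "(\<lambda>y. of_real (U y * P y) * cis (y * ln x)) integrable_on {-Y..Y}"
      unfolding cis_conv_exp by (intro integrable_continuous_interval continuous_intros cU cP)
    show "(\<lambda>y. \<bar>U y\<bar> * P y) integrable_on {-Y..Y}" by (intro integrable_continuous_interval continuous_intros cU cP)
    show "norm (of_real (U y * P y) * cis (y * ln x)) \<le> \<bar>U y\<bar> * P y" for y
      using P0[of y] by (simp add: norm_mult abs_mult)
  qed
  note osc = this
  have nc: "norm (cnj (of_real (q0 ^ 2) * w)) = q0\<^sup>2 * norm w" for w
    by (simp only: complex_mod_cnj norm_mult norm_of_real abs_power2)
  from osc have "norm (Jint (ln x) + cnj (of_real (q0 ^ 2) * Jint (- ln x))) \<le> 2 * q0 * (2 * pi * norm g0 + c + 4 * pi * K)"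
    unfolding conj using absU q0 by (simp add: norm_mult)
  moreover have "norm (cnj (of_real (q0 ^ 2) * (2 * pi * g0 + Jint (- ln x)))) \<le> q0 * c"
  proof -
    have "norm (cnj (of_real (q0 ^ 2) * (2 * pi * g0 + Jint (- ln x)))) = q0\<^sup>2 * norm (2 * pi * g0 + Jint (- ln x))"
      by (rule nc)
    also have "\<dots> \<le> q0\<^sup>2 * ((1 / q0) * c)" by (intro mult_left_mono e2) auto
    also have "\<dots> = q0 * c" using q0 by (simp add: power2_eq_square)
    finally show ?thesis .
  qed
  moreover have "2 * pi * g0 + cnj (of_real (q0 ^ 2) * (2 * pi * g0)) =
      (2 * pi * g0 + Jint (ln x)) + cnj (of_real (q0 ^ 2) * (2 * pi * g0 + Jint (- ln x)))
       - (Jint (ln x) + cnj (of_real (q0 ^ 2) * Jint (- ln x)))"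
    by (simp add: algebra_simps)
  ultimately have "norm (2 * pi * g0 + cnj (of_real (q0 ^ 2) * (2 * pi * g0)))
      \<le> q0 * c + q0 * c + 2 * q0 * (2 * pi * norm g0 + c + 4 * pi * K)"
    using e1 by (smt (verit) norm_triangle_ineq norm_triangle_ineq4)
  moreover have "norm (2 * pi * g0) - norm (cnj (of_real (q0 ^ 2) * (2 * pi * g0))) \<le> norm (2 * pi * g0 + cnj (of_real (q0 ^ 2) * (2 * pi * g0)))"
    using norm_triangle_ineq2[of "2 * pi * g0" "- cnj (of_real (q0 ^ 2) * (2 * pi * g0))"] by (simp del: complex_cnj_mult)
  moreover have "norm (2 * pi * g0) = 2 * pi * norm g0" by (simp add: norm_mult)
  moreover have "norm (cnj (of_real (q0 ^ 2) * (2 * pi * g0))) = q0\<^sup>2 * (2 * pi * norm g0)"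
    unfolding nc by (simp add: norm_mult)
  ultimately have fin: "2 * pi * norm g0 - q0\<^sup>2 * (2 * pi * norm g0) \<le> q0 * (4 * c + 8 * pi * K) + 4 * q0 * (pi * norm g0)"
    by (simp add: algebra_simps)
  define n where "n = pi * norm g0"
  have n0: "n \<ge> 0" by (simp add: n_def)
  \<comment> \<open>The unknown \<open>norm g0\<close> occurs on both sides. With
    \<open>q0 \<le> 1 / 4\<close> the coefficient left over is \<open>2 - 2/16 - 4/4 = 7/8\<close>,
    so it can be absorbed.\<close>
  have "q0\<^sup>2 \<le> (1 / 4)\<^sup>2" using q0 by (intro power_mono) auto
  then have "q0\<^sup>2 * n \<le> 1 / 16 * n" using n0 by (intro mult_right_mono) (auto simp: power2_eq_square)
  moreover have "q0 * n \<le> 1 / 4 * n" using q0 n0 by (intro mult_right_mono) auto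
  moreover have "2 * n - 2 * (q0\<^sup>2 * n) \<le> q0 * (4 * c + 8 * pi * K) + 4 * (q0 * n)"
    using fin by (simp add: n_def mult_ac)
  ultimately have "7 / 8 * n \<le> q0 * (4 * c + 8 * pi * K)" by linarith
  then have "7 / 8 * pi * norm g0 \<le> q0 * (4 * c + 8 * pi * K)" by (simp add: n_def mult_ac)
  also have "\<dots> \<le> 7 / 8 * pi * (q0 * (2 * c + 10 * K))"
  proof -
    have pi: "pi > 3" by (rule pi_gt3)
    have "4 * c \<le> 7 / 4 * pi * c" using pi c0 by (intro mult_right_mono) auto
    moreover have "8 * pi * K \<le> 35 / 4 * pi * K" using K(1) by (intro mult_right_mono) auto
    ultimately have "4 * c + 8 * pi * K \<le> 7 / 8 * pi * (2 * c + 10 * K)" by (simp add: algebra_simps)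
    then have "q0 * (4 * c + 8 * pi * K) \<le> q0 * (7 / 8 * pi * (2 * c + 10 * K))" using q0 by (intro mult_left_mono) auto
    then show ?thesis by (simp add: mult_ac)
  qed
  finally have "norm g0 \<le> q0 * (2 * c + 10 * K)" by simp
  then show ?thesis by (simp add: g0_def q0_def c_def)
qed

section \<open>Bounds for zeta to the right of the critical line\<close>

text \<open>Dividing by the value at the point moves the argument of \<open>Ln\<close> to a
  neighbourhood of \<open>1\<close>, away from the branch cut. There the real part of the logarithm
  differs from \<open>ln (norm f)\<close> by a constant.\<close>

lemma DERIV_ln_norm_horizontal:
  assumes "f holomorphic_on S" "open S" "Complex u t \<in> S" "f (Complex u t) \<noteq> 0"
  shows "((\<lambda>v. ln (norm (f (Complex v t)))) has_real_derivative
           Re (deriv f (Complex u t) / f (Complex u t))) (at u)"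
proof -
  define z where "z = Complex u t"
  have df: "(f has_field_derivative deriv f z) (at z)"
    by (rule holomorphic_derivI[OF assms(1,2)]) (use assms in \<open>simp add: z_def\<close>)
  have fz: "f z \<noteq> 0" using assms by (simp add: z_def)
  have "((\<lambda>w. Ln (f w / f z)) has_field_derivative deriv f z / f z) (at z)"
    using df fz by (auto intro!: derivative_eq_intros)
  moreover have "((\<lambda>v. Complex v t) has_vector_derivative 1) (at u)"
    unfolding Complex_eq by (auto intro!: derivative_eq_intros)
  ultimately have "((\<lambda>v. Ln (f (Complex v t) / f z)) has_vector_derivative 1 * (deriv f z / f z)) (at u)"
    using field_vector_diff_chain_at[of "\<lambda>v. Complex v t" 1 u "\<lambda>w. Ln (f w / f z)" "deriv f z / f z"]
    by (simp add: z_def o_def)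
  then have "((\<lambda>v. Re (Ln (f (Complex v t) / f z))) has_real_derivative Re (deriv f z / f z)) (at u)"
    using bounded_linear.has_vector_derivative[OF bounded_linear_Re]
    by (fastforce simp: has_real_derivative_iff_has_vector_derivative)
  from DERIV_add[OF DERIV_const[of "ln (norm (f z))"] this]
  have D: "((\<lambda>v. ln (norm (f z)) + Re (Ln (f (Complex v t) / f z))) has_real_derivative Re (deriv f z / f z)) (at u)"
    by simp
  have "isCont (\<lambda>v. f (Complex v t)) u"
  proof (rule isCont_o2[where g = f and f = "\<lambda>v. Complex v t"])
    show "isCont (\<lambda>v. Complex v t) u" unfolding Complex_eq by (intro continuous_intros)
    show "isCont f (Complex u t)" using df DERIV_isCont by (auto simp: z_def)
  qed
  then have "((\<lambda>v. f (Complex v t)) \<longlongrightarrow> f z) (nhds u)"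
    by (simp add: z_def continuous_at tendsto_nhds_iff)
  then have "eventually (\<lambda>v. f (Complex v t) \<noteq> 0) (nhds u)"
    using fz by (rule tendsto_imp_eventually_ne)
  then have "eventually (\<lambda>v. ln (norm (f (Complex v t))) = ln (norm (f z)) + Re (Ln (f (Complex v t) / f z))) (nhds u)"
    by eventually_elim (use fz in \<open>simp add: norm_divide ln_div\<close>)
  then show ?thesis using D unfolding z_def[symmetric] by (subst DERIV_cong_ev) auto
qed

lemma RH_log_deriv_holomorphic:
  assumes "Riemann_Hypothesis"
  shows "(\<lambda>s. deriv zeta s / zeta s) holomorphic_on {s. Re s > 1 / 2} - {1}"
proof -
  have op: "open ({s. Re s > 0} - {1::complex})" by (intro open_delete open_halfspace_Re_gt)
  have sub: "{s. Re s > 1 / 2} - {1} \<subseteq> {s. Re s > 0} - {1::complex}" by auto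
  show ?thesis
  proof (rule holomorphic_on_divide)
    show "deriv zeta holomorphic_on {s. Re s > 1 / 2} - {1}"
      by (rule holomorphic_on_subset[OF holomorphic_deriv[OF zeta_holomorphic op] sub])
    show "zeta holomorphic_on {s. Re s > 1 / 2} - {1}"
      by (rule holomorphic_on_subset[OF zeta_holomorphic sub])
    show "zeta s \<noteq> 0" if "s \<in> {s. Re s > 1 / 2} - {1}" for s
      using RH_zeta_zero[OF assms, of s] that by auto
  qed
qed

text \<open>The kernel bound is applied to a rectangle of half height \<open>l = ln L\<close> whose
  left edge is at \<open>1/2 + 1/l\<close> and whose right edge is at \<open>3\<close>. Heights at
  least \<open>L\<close> keep it away from the real axis and the pole; heights at most
  \<open>exp L\<close> make the logarithms of all ordinates \<open>O(L)\<close>.\<close>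

lemma RH_log_deriv_zeta_bound:
  assumes RH: "Riemann_Hypothesis"
  obtains C L0 where "C > 0"
    "\<And>L s. \<lbrakk>L \<ge> L0; 1 / 2 + 9 / ln L \<le> Re s; Re s \<le> 2; L \<le> \<bar>Im s\<bar>; \<bar>Im s\<bar> \<le> exp L\<rbrakk> \<Longrightarrow>
       norm (deriv zeta s / zeta s) \<le> C * L * exp (- ((Re s - 1 / 2) * ln L / 4))"
proof -
  obtain K0 where K0: "K0 > 0"
    "\<And>s. \<lbrakk>1 / 2 < Re s; Re s \<le> 3; 2 \<le> \<bar>Im s\<bar>\<rbrakk> \<Longrightarrow> Re (deriv zeta s / zeta s) \<ge> - K0 * ln \<bar>Im s\<bar>"
    "\<And>s. \<lbrakk>1 / 2 < Re s; Re s \<le> 3; 2 \<le> \<bar>Im s\<bar>\<rbrakk> \<Longrightarrow>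
       norm (deriv zeta s / zeta s) \<le> K0 * ln \<bar>Im s\<bar> * (1 + 1 / (Re s - 1 / 2))"
    using RH_log_deriv_zeta[OF RH] by blast
  have "eventually (\<lambda>L::real. K0 \<le> L) at_top" by (rule eventually_ge_at_top)
  moreover have "eventually (\<lambda>L::real. L - ln L \<ge> 2) at_top" by real_asymp
  moreover have "eventually (\<lambda>L::real. ln L \<ge> 2) at_top" by real_asymp
  moreover have "eventually (\<lambda>L::real. exp L + ln L \<le> exp (2 * L)) at_top" by real_asymp
  \<comment> \<open>The cost of the three outer edges: \<open>Re w <= 5/2\<close> gives
    \<open>exp (25/4)\<close> and \<open>x^(5/2) = L^(5/8)\<close>, the right edge contributes
    \<open>6\<close>, the horizontal edges \<open>L^3 (1 + l) exp (- l^2)\<close>, and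
    \<open>5 + 2 l\<close> bounds the length factor.\<close>
  moreover have "eventually (\<lambda>L::real. exp (25 / 4) * (6 * L powr (5 / 8) + 2 * L ^ 3 * (1 + ln L) * exp (- (ln L)\<^sup>2)) * (5 + 2 * ln L) \<le> L) at_top"
    by real_asymp
  ultimately have "eventually (\<lambda>L::real. K0 \<le> L \<and> L - ln L \<ge> 2 \<and> ln L \<ge> 2 \<and> exp L + ln L \<le> exp (2 * L) \<and>
      exp (25 / 4) * (6 * L powr (5 / 8) + 2 * L ^ 3 * (1 + ln L) * exp (- (ln L)\<^sup>2)) * (5 + 2 * ln L) \<le> L) at_top"
    by eventually_elim auto
  then obtain L0 where L0: "\<And>L. L \<ge> L0 \<Longrightarrow> K0 \<le> L \<and> L - ln L \<ge> 2 \<and> ln L \<ge> 2 \<and> exp L + ln L \<le> exp (2 * L) \<and>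
      exp (25 / 4) * (6 * L powr (5 / 8) + 2 * L ^ 3 * (1 + ln L) * exp (- (ln L)\<^sup>2)) * (5 + 2 * ln L) \<le> L"
    unfolding eventually_at_top_linorder by blast
  have main: "norm (deriv zeta s / zeta s) \<le> (2 * (2 + 20 * K0)) * L * exp (- ((Re s - 1 / 2) * ln L / 4))"
    if L: "L \<ge> L0" and s: "1 / 2 + 9 / ln L \<le> Re s" "Re s \<le> 2" "L \<le> \<bar>Im s\<bar>" "\<bar>Im s\<bar> \<le> exp L" for L s
  proof -
    define l where "l = ln L"
    have L1: "K0 \<le> L" "L - l \<ge> 2" "l \<ge> 2" "exp L + l \<le> exp (2 * L)"
      "exp (25 / 4) * (6 * L powr (5 / 8) + 2 * L ^ 3 * (1 + l) * exp (- l\<^sup>2)) * (5 + 2 * l) \<le> L"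
      using L0[OF L] by (auto simp: l_def)
    have Lpos: "L \<ge> 4" using L1 by linarith
    \<comment> \<open>\<open>\<eta>\<close> is the distance of \<open>s\<close> from the left edge,
      which is itself moved \<open>1/l\<close> off the critical line so that
      \<open>zeta' / zeta\<close> is holomorphic on the closed rectangle.\<close>
    define \<eta> where "\<eta> = Re s - 1 / 2 - 1 / l"
    define a where "a = 5 / 2 - 1 / l"
    define c where "c = Complex (1 / 2 + 1 / l) (Im s)"
    define G where "G = (\<lambda>w. deriv zeta (c + w) / zeta (c + w))"
    have l2: "0 < 1 / l" "1 / l \<le> 1 / 2" using L1(3) by (auto simp: field_simps)
    have a52: "a \<le> 5 / 2" "a \<ge> 0" using l2 unfolding a_def by linarith+
    have eta: "8 / l \<le> \<eta>" "0 < \<eta>" "\<eta> \<le> 3 / 2" "a - \<eta> \<ge> 1"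
    proof -
      show "8 / l \<le> \<eta>" using s(1) by (simp add: \<eta>_def l_def field_simps)
      then show "0 < \<eta>" using L1(3) by (smt (verit) divide_pos_pos)
      show "\<eta> \<le> 3 / 2" "a - \<eta> \<ge> 1" unfolding \<eta>_def a_def using s(2) l2 by linarith+
    qed
    have Im: "2 \<le> \<bar>Im (c + w)\<bar>" "\<bar>Im (c + w)\<bar> \<le> exp (2 * L)" if "\<bar>Im w\<bar> \<le> l" for w
      using s L1 that by (auto simp: c_def)
    have lnIm: "ln \<bar>Im (c + w)\<bar> \<le> 2 * L" "ln \<bar>Im (c + w)\<bar> \<ge> 0" if "\<bar>Im w\<bar> \<le> l" for w
    proof -
      have "ln \<bar>Im (c + w)\<bar> \<le> ln (exp (2 * L))" using Im[OF that] by (intro ln_mono) auto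
      then show "ln \<bar>Im (c + w)\<bar> \<le> 2 * L" by simp
      show "ln \<bar>Im (c + w)\<bar> \<ge> 0" using Im[OF that] by simp
    qed
    have Rec: "Re c = 1 / 2 + 1 / l" by (simp add: c_def)
    have Rer: "1 / 2 < Re (c + w)" "Re (c + w) \<le> 3" "1 / l \<le> Re (c + w) - 1 / 2" if "0 \<le> Re w" "Re w \<le> a" for w
      using that l2 unfolding plus_complex.simps Rec a_def by linarith+
    have holG: "G holomorphic_on cbox (Complex 0 (- l)) (Complex a l)"
    proof -
      have "(\<lambda>w. c + w) holomorphic_on cbox (Complex 0 (- l)) (Complex a l)" by (intro holomorphic_intros)
      from holomorphic_on_compose_gen[OF this RH_log_deriv_holomorphic[OF RH]]
      have "(\<lambda>s. deriv zeta s / zeta s) \<circ> (\<lambda>w. c + w) holomorphic_on cbox (Complex 0 (- l)) (Complex a l)"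
      proof
        show "(\<lambda>w. c + w) ` cbox (Complex 0 (- l)) (Complex a l) \<subseteq> {s. Re s > 1 / 2} - {1}"
        proof safe
          fix w assume w: "w \<in> cbox (Complex 0 (- l)) (Complex a l)"
          then show "1 / 2 < Re (c + w)" by (intro Rer) (auto simp: in_cbox_complex_iff)
          assume "c + w = 1"
          then have "Im (c + w) = 0" by simp
          moreover have "\<bar>Im w\<bar> \<le> l" using w by (auto simp: in_cbox_complex_iff)
          ultimately show False using Im(1)[of w] by simp
        qed
      qed simp
      then show ?thesis by (simp add: G_def o_def)
    qed
    have xp: "(L powr (1 / 4)) powr u = exp (u * l / 4)" for u
      using Lpos by (simp add: powr_powr) (simp add: powr_def l_def mult_ac)
    have "norm (G (of_real \<eta>)) \<le> (L powr (1 / 4)) powr (- \<eta>) *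
       (2 * ((exp (25 / 4) * (6 * L powr (5 / 8) + 2 * L ^ 3 * (1 + l) * exp (- l\<^sup>2))) * (2 * a + 2 * l)) + 10 * (K0 * (2 * L)))"
    proof (rule positive_real_part_kernel_bound[OF holG])
      show "0 < \<eta>" "\<eta> < a" "l > 0" using eta L1 by auto
      show "L powr (1 / 4) \<ge> 1" using Lpos by (intro ge_one_powr_ge_zero) auto
      \<comment> \<open>Of the \<open>9/l\<close> in the hypothesis, \<open>1/l\<close> is spent on
        the position of the left edge. The remaining \<open>8/l\<close> gives
        \<open>x powr (- \<eta>) \<le> exp (- 2) \<le> 1 / 4\<close>, as the absorption
        requires.\<close>
      have "exp (2::real) \<ge> 4"
      proof -
        have "exp (2::real) = exp 1 * exp 1" by (simp flip: exp_add)
        also have "\<dots> \<ge> 2 * 2" using exp_ge_add_one_self[of 1] by (intro mult_mono) auto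
        finally show ?thesis by simp
      qed
      moreover have "exp (- \<eta> * l / 4) \<le> exp (- 2)" using eta(1) L1(3) by (simp add: field_simps)
      ultimately show "(L powr (1 / 4)) powr (- \<eta>) \<le> 1 / 4"
        unfolding xp exp_minus by (smt (verit) exp_minus inverse_eq_divide frac_le)
      show "0 \<le> K0 * (2 * L)" using K0 Lpos by simp
      show "- (K0 * (2 * L)) \<le> Re (G (Complex 0 y))" if y: "\<bar>y\<bar> \<le> l" for y
      proof -
        have "Re (G (Complex 0 y)) \<ge> - K0 * ln \<bar>Im (c + Complex 0 y)\<bar>"
          unfolding G_def using Im[of "Complex 0 y"] y a52 by (intro K0(2) Rer) auto
        moreover have "K0 * ln \<bar>Im (c + Complex 0 y)\<bar> \<le> K0 * (2 * L)"
          using lnIm[of "Complex 0 y"] y K0 by (intro mult_left_mono) auto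
        ultimately show ?thesis by simp
      qed
      show "0 \<le> exp (25 / 4) * (6 * L powr (5 / 8) + 2 * L ^ 3 * (1 + l) * exp (- l\<^sup>2))"
        using Lpos L1 by (intro mult_nonneg_nonneg add_nonneg_nonneg) auto
    next
      fix w assume w: "0 \<le> Re w" "Re w \<le> a" "\<bar>Im w\<bar> \<le> l" "Re w = a \<or> \<bar>Im w\<bar> = l"
      have fac: "norm (w\<^sup>2 - of_real (\<eta>\<^sup>2)) = norm (w - of_real \<eta>) * norm (w + of_real \<eta>)"
        by (simp add: norm_mult[symmetric] power2_eq_square algebra_simps)
      have xw: "(L powr (1 / 4)) powr Re w \<le> L powr (5 / 8)"
        using w a52 Lpos by (subst powr_powr) (intro powr_mono, auto)
      have re2: "(Re w)\<^sup>2 \<le> 25 / 4"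
        using power_mono[of "Re w" "5/2" 2] w a52 by (simp add: power2_eq_square)
      have cub: "L powr (5 / 8) \<le> L" using powr_mono[of "5/8" 1 L] Lpos by simp
      have pos: "0 \<le> 6 * L powr (5 / 8)" "0 \<le> 2 * L ^ 3 * (1 + l) * exp (- l\<^sup>2)"
        using Lpos L1 by auto
      from w(4) show "norm (G w) * (L powr (1 / 4)) powr Re w * exp ((Re w)\<^sup>2 - (Im w)\<^sup>2) * (2 * \<eta> / norm (w\<^sup>2 - of_real (\<eta>\<^sup>2)))
         \<le> exp (25 / 4) * (6 * L powr (5 / 8) + 2 * L ^ 3 * (1 + l) * exp (- l\<^sup>2))"
      proof
        assume wa: "Re w = a"
        have 1: "norm (G w) \<le> 6" unfolding G_def by (rule norm_log_deriv_zeta_le) (simp add: Rec wa a_def)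
        have "(Re w)\<^sup>2 - (Im w)\<^sup>2 \<le> 25 / 4" using re2 zero_le_power2[of "Im w"] by linarith
        then have 2: "exp ((Re w)\<^sup>2 - (Im w)\<^sup>2) \<le> exp (25 / 4)" by simp
        have "norm (w - of_real \<eta>) \<ge> 1" using complex_Re_le_cmod[of "w - of_real \<eta>"] wa eta by simp
        moreover have "norm (w + of_real \<eta>) \<ge> 2 * \<eta>" using complex_Re_le_cmod[of "w + of_real \<eta>"] wa eta by simp
        ultimately have "norm (w\<^sup>2 - of_real (\<eta>\<^sup>2)) \<ge> 1 * (2 * \<eta>)" unfolding fac using eta by (intro mult_mono) auto
        then have 3: "2 * \<eta> / norm (w\<^sup>2 - of_real (\<eta>\<^sup>2)) \<le> 1" using eta by (simp add: divide_le_eq_1)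
        have "norm (G w) * (L powr (1 / 4)) powr Re w * exp ((Re w)\<^sup>2 - (Im w)\<^sup>2) * (2 * \<eta> / norm (w\<^sup>2 - of_real (\<eta>\<^sup>2)))
          \<le> 6 * L powr (5 / 8) * exp (25 / 4) * 1"
          using eta by (intro mult_mono 1 2 3 xw) auto
        also have "\<dots> = exp (25 / 4) * (6 * L powr (5 / 8))" by simp
        also have "\<dots> \<le> exp (25 / 4) * (6 * L powr (5 / 8) + 2 * L ^ 3 * (1 + l) * exp (- l\<^sup>2))"
          using pos by (intro mult_left_mono) auto
        finally show ?thesis .
      next
        assume wl: "\<bar>Im w\<bar> = l"
        have "norm (G w) \<le> K0 * ln \<bar>Im (c + w)\<bar> * (1 + 1 / (Re (c + w) - 1 / 2))"
          unfolding G_def using Im[of w] w by (intro K0(3) Rer) auto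
        also have "\<dots> \<le> L * (2 * L) * (1 + 1 / (1 / l))"
        proof (intro mult_mono add_left_mono divide_left_mono)
          show "1 / l \<le> Re (c + w) - 1 / 2" using w by (intro Rer)
          then have d: "0 < Re (c + w) - 1 / 2" using l2 by linarith
          then show "0 < (Re (c + w) - 1 / 2) * (1 / l)" using l2 by (intro mult_pos_pos)
          show "0 \<le> 1 + 1 / (Re (c + w) - 1 / 2)"
            using d by (intro add_nonneg_nonneg divide_nonneg_pos) linarith+
        qed (use lnIm[of w] w L1 Lpos K0 in auto)
        finally have 1: "norm (G w) \<le> 2 * L ^ 2 * (1 + l)" by (simp add: power2_eq_square mult_ac)
        have "(Im w)\<^sup>2 = l\<^sup>2" using wl by (metis power2_abs)
        then have "exp ((Re w)\<^sup>2 - (Im w)\<^sup>2) \<le> exp (25 / 4 + - l\<^sup>2)" using re2 by simp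
        then have 2: "exp ((Re w)\<^sup>2 - (Im w)\<^sup>2) \<le> exp (25 / 4) * exp (- l\<^sup>2)" by (simp only: exp_add)
        have "norm (w - of_real \<eta>) \<ge> l" using abs_Im_le_cmod[of "w - of_real \<eta>"] wl by simp
        moreover have "norm (w + of_real \<eta>) \<ge> l" using abs_Im_le_cmod[of "w + of_real \<eta>"] wl by simp
        ultimately have "norm (w\<^sup>2 - of_real (\<eta>\<^sup>2)) \<ge> l * l" unfolding fac using L1 by (intro mult_mono) auto
        moreover have "l * l \<ge> 2 * 2" using L1 by (intro mult_mono) auto
        ultimately have 3: "2 * \<eta> / norm (w\<^sup>2 - of_real (\<eta>\<^sup>2)) \<le> 1" using eta by (simp add: divide_le_eq_1)
        have xw': "(L powr (1 / 4)) powr Re w \<le> L" using xw cub by linarith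
        have "norm (G w) * (L powr (1 / 4)) powr Re w * exp ((Re w)\<^sup>2 - (Im w)\<^sup>2) * (2 * \<eta> / norm (w\<^sup>2 - of_real (\<eta>\<^sup>2)))
          \<le> (2 * L ^ 2 * (1 + l)) * L * (exp (25 / 4) * exp (- l\<^sup>2)) * 1"
          using eta Lpos L1 by (intro mult_mono 1 2 3 xw') auto
        also have "\<dots> = exp (25 / 4) * (2 * L ^ 3 * (1 + l) * exp (- l\<^sup>2))" by (simp add: eval_nat_numeral)
        also have "\<dots> \<le> exp (25 / 4) * (6 * L powr (5 / 8) + 2 * L ^ 3 * (1 + l) * exp (- l\<^sup>2))"
          using pos by (intro mult_left_mono) auto
        finally show ?thesis .
      qed
    qed
    also have "\<dots> \<le> (2 * exp (- ((Re s - 1 / 2) * l / 4))) * (2 * L + 20 * K0 * L)"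
    proof (intro mult_mono)
      \<comment> \<open>Moving the edge by \<open>1/l\<close> costs only
        \<open>x^(1/l) = exp (1/4)\<close>, a constant.\<close>
      have "(L powr (1 / 4)) powr (- \<eta>) = exp (1 / 4) * exp (- ((Re s - 1 / 2) * l / 4))"
        unfolding xp exp_add[symmetric] using L1 by (simp add: \<eta>_def field_simps)
      also have "exp (1 / 4) \<le> (2::real)"
        using exp_bound_half[of "1/4::real"] by simp
      finally show "(L powr (1 / 4)) powr (- \<eta>) \<le> 2 * exp (- ((Re s - 1 / 2) * l / 4))" by simp
      have "exp (25 / 4) * (6 * L powr (5 / 8) + 2 * L ^ 3 * (1 + l) * exp (- l\<^sup>2)) * (2 * a + 2 * l)
        \<le> exp (25 / 4) * (6 * L powr (5 / 8) + 2 * L ^ 3 * (1 + l) * exp (- l\<^sup>2)) * (5 + 2 * l)"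
        using Lpos L1 a52 by (intro mult_left_mono mult_nonneg_nonneg add_nonneg_nonneg) auto
      also note L1(5)
      finally show "2 * (exp (25 / 4) * (6 * L powr (5 / 8) + 2 * L ^ 3 * (1 + l) * exp (- l\<^sup>2)) * (2 * a + 2 * l)) + 10 * (K0 * (2 * L))
        \<le> 2 * L + 20 * K0 * L" by simp
      have "0 \<le> exp (25 / 4) * (6 * L powr (5 / 8) + 2 * L ^ 3 * (1 + l) * exp (- l\<^sup>2)) * (2 * a + 2 * l)"
        using Lpos L1 a52 by (intro mult_nonneg_nonneg add_nonneg_nonneg) auto
      then show "0 \<le> 2 * (exp (25 / 4) * (6 * L powr (5 / 8) + 2 * L ^ 3 * (1 + l) * exp (- l\<^sup>2)) * (2 * a + 2 * l)) + 10 * (K0 * (2 * L))"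
        using K0 Lpos by simp
    qed auto
    also have "G (of_real \<eta>) = deriv zeta s / zeta s"
    proof -
      have "c + of_real \<eta> = s" by (simp add: c_def \<eta>_def complex_eq_iff)
      then show ?thesis by (simp add: G_def)
    qed
    finally show ?thesis by (simp add: l_def algebra_simps)
  qed
  show ?thesis by (rule that[OF _ main]) (use K0 in auto)
qed

text \<open>Integrate the derivative of \<open>ln (norm zeta)\<close> along the horizontal segment
  from \<open>s\<close> to real part \<open>2\<close>, where the value is bounded. The decay rate
  \<open>l / 4\<close> of the integrand turns \<open>L\<close> into \<open>4 L / l\<close>. Bounding
  the absolute value of the logarithm controls \<open>zeta\<close> and \<open>1 / zeta\<close>
  together.\<close>

lemma RH_ln_norm_zeta_bound:
  assumes RH: "Riemann_Hypothesis"
  obtains C L0 where "C > 0"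
    "\<And>L s. \<lbrakk>L \<ge> L0; 1 / 2 + 9 / ln L \<le> Re s; L \<le> \<bar>Im s\<bar>; \<bar>Im s\<bar> \<le> exp L\<rbrakk> \<Longrightarrow>
       zeta s \<noteq> 0 \<and> \<bar>ln (norm (zeta s))\<bar> \<le> C * L / ln L"
proof -
  obtain C1 L1 where C1: "C1 > 0"
    "\<And>L s. \<lbrakk>L \<ge> L1; 1 / 2 + 9 / ln L \<le> Re s; Re s \<le> 2; L \<le> \<bar>Im s\<bar>; \<bar>Im s\<bar> \<le> exp L\<rbrakk> \<Longrightarrow>
       norm (deriv zeta s / zeta s) \<le> C1 * L * exp (- ((Re s - 1 / 2) * ln L / 4))"
    using RH_log_deriv_zeta_bound[OF RH] by blast
  have "zeta s \<noteq> 0 \<and> \<bar>ln (norm (zeta s))\<bar> \<le> (4 * C1 + 2) * L / ln L"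
    if L: "L \<ge> max L1 3" and s: "1 / 2 + 9 / ln L \<le> Re s" "L \<le> \<bar>Im s\<bar>" "\<bar>Im s\<bar> \<le> exp L" for L s
  proof -
    define l where "l = ln L"
    have l0: "l > 0" unfolding l_def using L by (intro ln_gt_zero) auto
    have lL: "l \<le> L" unfolding l_def using ln_le_minus_one[of L] L by simp
    have s1: "Re s > 1 / 2" using s(1) l0 by (smt (verit) divide_pos_pos l_def)
    have one: "Complex u (Im s) \<noteq> 1" for u using s L by (auto simp: complex_eq_iff)
    have nz: "zeta (Complex u (Im s)) \<noteq> 0" if "u > 1 / 2" for u
      using RH_zeta_zero[OF RH, of "Complex u (Im s)"] that one by auto
    have big: "\<bar>ln (norm (zeta z))\<bar> \<le> 2" if "Re z \<ge> 2" for z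
    proof -
      note b = norm_zeta_Re_ge_2[OF that]
      have "ln (norm (zeta z)) \<le> ln 2" using b by (intro ln_mono) auto
      moreover have "ln (1 / 3) \<le> ln (norm (zeta z))" using b by (intro ln_mono) auto
      moreover have "ln (1 / 3 :: real) \<ge> - 2" using ln_le_minus_one[of "3::real"] by (simp add: ln_div)
      moreover have "ln 2 \<le> (2::real)" using ln_le_minus_one[of "2::real"] by simp
      ultimately show ?thesis by linarith
    qed
    define A where "A = 4 * C1 * L / l"
    have A0: "A \<ge> 0" using C1 L l0 by (simp add: A_def)
    have "\<bar>ln (norm (zeta s))\<bar> \<le> A + 2"
    proof (cases "Re s \<ge> 2")
      case True
      then show ?thesis using big[of s] A0 by simp
    next
      case False
      define \<phi> where "\<phi> = (\<lambda>u. ln (norm (zeta (Complex u (Im s)))))"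
      define D where "D = (\<lambda>u. Re (deriv zeta (Complex u (Im s)) / zeta (Complex u (Im s))))"
      \<comment> \<open>\<open>- E\<close> is a primitive of the majorant of
        \<open>\<bar>D\<bar>\<close>, so \<open>\<phi> - E\<close> increases and
        \<open>\<phi> + E\<close> decreases; this replaces an integral estimate.\<close>
      define E where "E = (\<lambda>u. A * exp (- ((u - 1 / 2) * l / 4)))"
      have d\<phi>: "(\<phi> has_real_derivative D u) (at u)" if "u \<ge> Re s" for u
        unfolding \<phi>_def D_def
        by (rule DERIV_ln_norm_horizontal[OF zeta_holomorphic])
          (use that s1 one nz in \<open>auto intro!: open_delete open_halfspace_Re_gt\<close>)
      have D: "\<bar>D u\<bar> \<le> C1 * L * exp (- ((u - 1 / 2) * l / 4))" if "Re s \<le> u" "u \<le> 2" for u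
      proof -
        have "\<bar>D u\<bar> \<le> norm (deriv zeta (Complex u (Im s)) / zeta (Complex u (Im s)))"
          unfolding D_def by (rule abs_Re_le_cmod)
        also have "\<dots> \<le> C1 * L * exp (- ((u - 1 / 2) * l / 4))"
          using C1(2)[of L "Complex u (Im s)"] L s that by (simp add: l_def)
        finally show ?thesis .
      qed
      have dE: "(E has_real_derivative - (C1 * L * exp (- ((u - 1 / 2) * l / 4)))) (at u)" for u
        unfolding E_def A_def using l0 by (auto intro!: derivative_eq_intros simp: field_simps)
      have "\<phi> (Re s) - E (Re s) \<le> \<phi> 2 - E 2"
      proof (rule DERIV_nonneg_imp_nondecreasing[where f = "\<lambda>u. \<phi> u - E u"])
        fix u assume u: "Re s \<le> u" "u \<le> 2"
        have "((\<lambda>u. \<phi> u - E u) has_real_derivative D u - - (C1 * L * exp (- ((u - 1 / 2) * l / 4)))) (at u)"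
          by (intro DERIV_diff d\<phi> dE u)
        then show "\<exists>y. ((\<lambda>u. \<phi> u - E u) has_real_derivative y) (at u) \<and> 0 \<le> y"
          using D[OF u] by (intro exI[of _ "D u - - (C1 * L * exp (- ((u - 1 / 2) * l / 4)))"] conjI) auto
      qed (use False in auto)
      moreover have "\<phi> 2 + E 2 \<le> \<phi> (Re s) + E (Re s)"
      proof (rule DERIV_nonpos_imp_nonincreasing[where f = "\<lambda>u. \<phi> u + E u"])
        fix u assume u: "Re s \<le> u" "u \<le> 2"
        have "((\<lambda>u. \<phi> u + E u) has_real_derivative D u + - (C1 * L * exp (- ((u - 1 / 2) * l / 4)))) (at u)"
          by (intro DERIV_add d\<phi> dE u)
        then show "\<exists>y. ((\<lambda>u. \<phi> u + E u) has_real_derivative y) (at u) \<and> y \<le> 0"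
          using D[OF u] by (intro exI[of _ "D u + - (C1 * L * exp (- ((u - 1 / 2) * l / 4)))"] conjI) auto
      qed (use False in auto)
      moreover have "E 2 \<ge> 0" using A0 by (simp add: E_def)
      moreover have "E (Re s) \<le> A"
      proof -
        have "exp (- ((Re s - 1 / 2) * l / 4)) \<le> 1" using s1 l0 by simp
        then show ?thesis unfolding E_def using A0 by (simp add: mult_left_le)
      qed
      moreover have "\<bar>\<phi> 2\<bar> \<le> 2" unfolding \<phi>_def by (rule big) simp
      ultimately have "\<bar>\<phi> (Re s)\<bar> \<le> A + 2" by linarith
      then show ?thesis by (simp add: \<phi>_def)
    qed
    also have "A + 2 \<le> (4 * C1 + 2) * L / l" using l0 lL by (simp add: A_def field_simps)
    finally show ?thesis using nz[OF s1] by (simp add: l_def)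
  qed
  then show ?thesis using that[of "4 * C1 + 2" "max L1 3"] C1(1) by auto
qed

section \<open>Dirichlet polynomials and Perron's formula\<close>

text \<open>Only the integer part of the cutoff matters. With a natural cutoff, Perron's formula can
  be applied with the half-integer \<open>N + 1/2\<close> whatever real cutoff was given.\<close>

definition dirichlet_sum :: "nat \<Rightarrow> complex \<Rightarrow> complex" where
  "dirichlet_sum N w = (\<Sum>n\<in>{1..N}. of_nat n powr (- w))"

lemma zeta_partial_sum_eq_dirichlet_sum:
  assumes "X \<ge> 0"
  shows "zeta_partial_sum X = dirichlet_sum (nat \<lfloor>X\<rfloor>)"
proof
  fix s
  have "{n. 1 \<le> n \<and> real n \<le> X} = {1..nat \<lfloor>X\<rfloor>}"
    using assms by (auto simp: le_nat_floor of_nat_floor le_nat_iff le_floor_iff)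
  then show "zeta_partial_sum X s = dirichlet_sum (nat \<lfloor>X\<rfloor>) s"
    by (simp add: zeta_partial_sum_def dirichlet_sum_def)
qed

lemma dirichlet_sum_holomorphic: "dirichlet_sum N holomorphic_on S"
  unfolding dirichlet_sum_def by (intro holomorphic_intros) auto

lemma norm_of_nat_powr: "n \<ge> 1 \<Longrightarrow> norm (of_nat n powr (w::complex)) = real n powr Re w"
  by (subst norm_powr_real_powr) auto

lemma norm_of_real_powr: "x > 0 \<Longrightarrow> norm (of_real x powr (w::complex)) = x powr Re w"
  by (subst norm_powr_real_powr) auto

lemma norm_dirichlet_sum_le:
  assumes "Re w \<ge> 0"
  shows "norm (dirichlet_sum N w) \<le> N"
proof -
  have "norm (dirichlet_sum N w) \<le> (\<Sum>n\<in>{1..N}. 1)"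
    unfolding dirichlet_sum_def
  proof (rule sum_norm_le)
    fix n assume "n \<in> {1..N}"
    then show "norm (of_nat n powr (- w)) \<le> 1"
      using assms powr_mono[of "- Re w" 0 "real n"] by (subst norm_of_nat_powr) auto
  qed
  then show ?thesis by simp
qed

text \<open>The telescoping bound used for \<open>zeta\<close> also holds for partial sums: the
  terms after the first have total modulus below \<open>2/3\<close>.\<close>

lemma dirichlet_sum_nonzero_Re_ge_2:
  assumes "Re s \<ge> 2" "N \<ge> 1"
  shows "dirichlet_sum N s \<noteq> 0"
proof
  assume 0: "dirichlet_sum N s = 0"
  obtain m where m: "N = Suc m" using assms(2) by (cases N) auto
  have "dirichlet_sum N s = 1 + (\<Sum>n<m. of_nat (Suc (Suc n)) powr (- s))"
    unfolding m dirichlet_sum_def One_nat_def sum.atLeast1_atMost_eq sum.lessThan_Suc_shift by simp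
  then have "(1::complex) = - (\<Sum>n<m. of_nat (Suc (Suc n)) powr (- s))" using 0 by (simp add: eq_neg_iff_add_eq_0)
  then have "1 = norm (\<Sum>n<m. of_nat (Suc (Suc n)) powr (- s))" by (metis norm_minus_cancel norm_one)
  also have "\<dots> \<le> (\<Sum>n<m. 1 / (real n + 3 / 2) - 1 / (real (Suc n) + 3 / 2))"
    by (intro sum_norm_le norm_nat_powr_le_telescope assms)
  also have "\<dots> = 2 / 3 - 1 / (real m + 3 / 2)" by (subst sum_lessThan_telescope') simp
  also have "\<dots> \<le> 2 / 3" by simp
  finally show False by simp
qed

text \<open>Each term is at most \<open>N powr (- Re w)\<close>. The ratio of \<open>N\<close> to
  the half-integer is below \<open>1\<close>, so the product decays as \<open>Re w\<close> tends to
  minus infinity and the left edge can be pushed far out.\<close>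

lemma norm_dirichlet_sum_left_le:
  assumes N: "N \<ge> 1" and w: "Re w \<le> 0"
  shows "norm (dirichlet_sum N w) * (real N + 1 / 2) powr Re w \<le> N * (real N / (real N + 1 / 2)) powr (- Re w)"
proof -
  have "norm (dirichlet_sum N w) \<le> (\<Sum>n\<in>{1..N}. real N powr (- Re w))"
    unfolding dirichlet_sum_def
  proof (rule sum_norm_le)
    fix n assume "n \<in> {1..N}"
    then show "norm (of_nat n powr (- w)) \<le> real N powr (- Re w)"
      using w by (subst norm_of_nat_powr) (auto intro!: powr_mono2)
  qed
  then have "norm (dirichlet_sum N w) * (real N + 1 / 2) powr Re w \<le> (N * real N powr (- Re w)) * (real N + 1 / 2) powr Re w"
    by (intro mult_right_mono) auto
  also have "(N * real N powr (- Re w)) * (real N + 1 / 2) powr Re w = N * (real N / (real N + 1 / 2)) powr (- Re w)"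
    by (subst powr_divide) (auto simp: powr_minus_divide)
  finally show ?thesis .
qed

text \<open>The difference is the tail over \<open>m >= N + 1\<close>. Of the factor
  \<open>(X / m) powr Re w\<close>, the exponent \<open>2\<close> is reserved for convergence and
  the rest is bounded by its value at \<open>m = N + 1\<close>; this gives decay as
  \<open>Re w\<close> grows.\<close>

lemma norm_dirichlet_sum_minus_zeta_le:
  assumes w: "Re w \<ge> 2"
  shows "norm (dirichlet_sum N w - zeta w) * (real N + 1 / 2) powr Re w
     \<le> 3 * (real N + 1 / 2)\<^sup>2 * ((real N + 1 / 2) / (real N + 1)) powr (Re w - 2)"
proof -
  define X where "X = real N + 1 / 2"
  define r where "r = X / (real N + 1)"
  have X: "X > 0" and r: "0 < r" "r \<le> 1" by (auto simp: X_def r_def field_simps)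
  have eq: "dirichlet_sum N w = (\<Sum>n<N. of_nat (Suc n) powr (- w))"
    unfolding dirichlet_sum_def by (simp add: sum.atLeast1_atMost_eq)
  have "(\<lambda>n. of_nat (Suc (n + N)) powr (- w)) sums (zeta w - dirichlet_sum N w)"
    unfolding eq using sums_split_initial_segment[OF zeta_sums[of w], of N] w by simp
  then have eq2: "zeta w - dirichlet_sum N w = (\<Sum>n. of_nat (Suc (n + N)) powr (- w))" by (rule sums_unique)
  have le: "norm (of_nat (Suc (n + N)) powr (- w)) \<le> X powr (- Re w) * X\<^sup>2 * r powr (Re w - 2) * (1 / (real n + 1)\<^sup>2)" for n
  proof -
    define m where "m = real (Suc (n + N))"
    have m: "m \<ge> real N + 1" "m \<ge> real n + 1" "m > 0" by (auto simp: m_def)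
    have "norm (of_nat (Suc (n + N)) powr (- w)) = m powr (- Re w)"
      by (subst norm_of_nat_powr) (auto simp: m_def)
    also have "\<dots> = X powr (- Re w) * (X / m) powr (Re w)"
      using X m by (simp add: powr_divide powr_minus field_simps)
    also have "(X / m) powr (Re w) = (X / m) powr (Re w - 2) * (X / m) powr 2"
      by (simp flip: powr_add)
    also have "\<dots> \<le> r powr (Re w - 2) * (X / (real n + 1)) powr 2"
      using w X m by (intro mult_mono powr_mono2) (auto simp: r_def intro!: divide_left_mono)
    also have "(X / (real n + 1)) powr 2 = X\<^sup>2 * (1 / (real n + 1)\<^sup>2)"
      using X by (subst powr_numeral) (auto simp: power_divide)
    finally show ?thesis using X by (simp add: mult_ac)
  qed
  have su: "(\<lambda>n. X powr (- Re w) * X\<^sup>2 * r powr (Re w - 2) * (1 / (real n + 1)\<^sup>2)) sums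
     (X powr (- Re w) * X\<^sup>2 * r powr (Re w - 2) * (pi\<^sup>2 / 6))"
  proof (rule sums_mult)
    show "(\<lambda>n. 1 / (real n + 1)\<^sup>2) sums (pi\<^sup>2 / 6)"
      using inverse_squares_sums by (simp add: add.commute)
  qed
  have "norm (\<Sum>n. of_nat (Suc (n + N)) powr (- w)) \<le> (\<Sum>n. X powr (- Re w) * X\<^sup>2 * r powr (Re w - 2) * (1 / (real n + 1)\<^sup>2))"
    by (rule norm_suminf_le[OF le]) (use su sums_summable in blast)
  also have "\<dots> = X powr (- Re w) * X\<^sup>2 * r powr (Re w - 2) * (pi\<^sup>2 / 6)" by (rule sums_unique[OF su, symmetric])
  also have "\<dots> \<le> X powr (- Re w) * X\<^sup>2 * r powr (Re w - 2) * 3"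
  proof (intro mult_left_mono)
    have "pi * pi \<le> 4 * 4" using pi_less_4 by (intro mult_mono) auto
    then show "pi\<^sup>2 / 6 \<le> 3" by (simp add: power2_eq_square)
  qed auto
  finally have "norm (dirichlet_sum N w - zeta w) * X powr Re w \<le> X powr (- Re w) * X\<^sup>2 * r powr (Re w - 2) * 3 * X powr Re w"
    unfolding norm_minus_commute[of "dirichlet_sum N w"] eq2 by (intro mult_right_mono) auto
  also have "\<dots> = 3 * X\<^sup>2 * r powr (Re w - 2) * (X powr (- Re w) * X powr Re w)" by (simp only: mult_ac)
  also have "X powr (- Re w) * X powr Re w = 1" using X by (simp flip: powr_add)
  finally show ?thesis by (simp add: X_def r_def)
qed

text \<open>The kernel \<open>1 / (w - s)\<close> on a vertical line has primitive
  \<open>arsinh\<close>, which grows logarithmically. So a line close to \<open>s\<close> costs only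
  a logarithm of \<open>V / \<eta>\<close>.\<close>

lemma integral_inverse_dist_vertical_line_le:
  fixes \<eta> V :: real
  assumes "\<eta> > 0" "V > 0" "\<bar>t\<bar> \<le> V"
  shows "((\<lambda>y. 1 / norm (Complex \<eta> (y - t))) has_integral
           arsinh ((V - t) / \<eta>) - arsinh ((- V - t) / \<eta>)) {-V..V}"
    and "arsinh ((V - t) / \<eta>) - arsinh ((- V - t) / \<eta>) \<le> 2 * ln (4 * V / \<eta> + 1)"
proof -
  show "((\<lambda>y. 1 / norm (Complex \<eta> (y - t))) has_integral
           arsinh ((V - t) / \<eta>) - arsinh ((- V - t) / \<eta>)) {-V..V}"
  proof (rule fundamental_theorem_of_calculus)
    fix y :: real
    have "((\<lambda>y. arsinh ((y - t) / \<eta>)) has_real_derivative (1 / sqrt (((y - t) / \<eta>)\<^sup>2 + 1)) * (1 / \<eta>)) (at y within {-V..V})"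
    proof (rule has_field_derivative_at_within, rule DERIV_chain2[OF arsinh_real_has_field_derivative])
      show "((\<lambda>y. (y - t) / \<eta>) has_real_derivative 1 / \<eta>) (at y)"
        using assms by (auto intro!: derivative_eq_intros)
    qed
    moreover have "(1 / sqrt (((y - t) / \<eta>)\<^sup>2 + 1)) * (1 / \<eta>) = 1 / norm (Complex \<eta> (y - t))"
    proof -
      have "((y - t) / \<eta>)\<^sup>2 + 1 = (\<eta>\<^sup>2 + (y - t)\<^sup>2) / \<eta>\<^sup>2" 
        using assms by (simp add: power_divide add_divide_distrib)
      then have "sqrt (((y - t) / \<eta>)\<^sup>2 + 1) = norm (Complex \<eta> (y - t)) / \<eta>"
        using assms by (simp add: real_sqrt_divide complex_norm)
      then show ?thesis using assms by simp
    qed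
    ultimately show "((\<lambda>y. arsinh ((y - t) / \<eta>)) has_vector_derivative 1 / norm (Complex \<eta> (y - t))) (at y within {-V..V})"
      by (simp add: has_real_derivative_iff_has_vector_derivative)
  qed (use assms in auto)
  have ar: "arsinh x \<le> ln (2 * x + 1)" if "x \<ge> 0" for x :: real
  proof -
    have "sqrt (x\<^sup>2 + 1) \<le> x + 1" using that by (intro real_le_lsqrt) (auto simp: power2_eq_square algebra_simps)
    then show ?thesis unfolding arsinh_real_def using that arsinh_real_aux[of x] by (intro ln_mono) auto
  qed
  have b: "arsinh (u / \<eta>) \<le> ln (4 * V / \<eta> + 1)" if "0 \<le> u" "u \<le> 2 * V" for u
  proof -
    have "arsinh (u / \<eta>) \<le> ln (2 * (u / \<eta>) + 1)" using that assms by (intro ar) auto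
    also have "\<dots> \<le> ln (4 * V / \<eta> + 1)"
    proof (intro ln_mono)
      have "0 \<le> u / \<eta>" using that assms by simp
      then show "0 < 2 * (u / \<eta>) + 1" by linarith
      show "2 * (u / \<eta>) + 1 \<le> 4 * V / \<eta> + 1" using that assms by (simp add: field_simps)
    qed
    finally show ?thesis .
  qed
  have "arsinh ((- V - t) / \<eta>) = - arsinh ((V + t) / \<eta>)"
    by (subst arsinh_minus_real[symmetric]) (simp add: minus_divide_left)
  moreover have "arsinh ((V - t) / \<eta>) \<le> ln (4 * V / \<eta> + 1)" "arsinh ((V + t) / \<eta>) \<le> ln (4 * V / \<eta> + 1)"
    using assms by (auto intro!: b)
  ultimately show "arsinh ((V - t) / \<eta>) - arsinh ((- V - t) / \<eta>) \<le> 2 * ln (4 * V / \<eta> + 1)" by linarith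
qed

text \<open>It tells how far the outer vertical edges must be moved: an exponent of about
  \<open>2 * ln V / e\<close> brings the ratio \<open>1 - e\<close> down to
  \<open>1 / V^2\<close>.\<close>

lemma powr_log_decay:
  fixes a V c e :: real
  assumes "V > 1" "0 < e" "e < 1" "c * e \<ge> 2 * ln V" "c \<ge> 0"
  shows "(1 - e) powr c \<le> 1 / V\<^sup>2"
proof -
  have "c * ln (1 - e) \<le> c * (- e)"
    using ln_le_minus_one[of "1 - e"] assms by (intro mult_left_mono) auto
  also have "\<dots> \<le> - (2 * ln V)" using assms by simp
  finally have "(1 - e) powr c \<le> exp (- (2 * ln V))"
    using assms by (simp add: powr_def)
  also have "\<dots> = 1 / V\<^sup>2"
    using assms by (simp add: exp_minus exp_double inverse_eq_divide)
  finally show ?thesis .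
qed

text \<open>Perron's formula by Cauchy's formula in two half planes: to the right of the line \<open>Re w = b\<close>
  for \<open>(dirichlet_sum N - zeta) X powr w / (w - s)\<close>, to the left of it for
  \<open>dirichlet_sum N X powr w / (w - s)\<close>. The two integrals over the common edge differ by the integral
  of \<open>zeta\<close>. The half-integer \<open>X\<close> keeps \<open>X / n\<close> away from \<open>1\<close>.\<close>

lemma truncated_perron:
  fixes N :: nat and b V M :: real and s :: complex
  defines "X \<equiv> real N + 1 / 2"
  assumes N: "N \<ge> 1" and b: "0 < b" "b < 1" and s: "b < Re s" "Re s \<le> 2" "Im s \<noteq> 0" "\<bar>Im s\<bar> \<le> V / 2"
    and V: "V \<ge> 4"
    and M: "\<And>y. \<bar>y\<bar> \<le> V \<Longrightarrow> norm (zeta (Complex b y)) \<le> M"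
      "\<And>w. \<lbrakk>b \<le> Re w; Re w \<le> 2; \<bar>Im w\<bar> = V\<rbrakk> \<Longrightarrow> norm (zeta w) \<le> M"
  shows "norm ((dirichlet_sum N s - zeta s) * of_real X powr s + of_real X / (s - 1))
     \<le> X powr b * M * ln (4 * V / (Re s - b) + 1) + 60 * (X + M + 4) * X ^ 3 * ln V / V"
proof -
  let ?F = "dirichlet_sum N"
  define lV where "lV = ln V"
  have lV: "lV \<ge> 1"
  proof -
    have "exp 1 \<le> V" using exp_le V by linarith
    then have "ln (exp 1) \<le> ln V" by (intro ln_mono) (use V in auto)
    then show ?thesis by (simp add: lV_def)
  qed
  have X: "X \<ge> 3 / 2" "real N \<le> X" using N by (auto simp: X_def)
  have M0: "M \<ge> 0" using order_trans[OF norm_ge_zero M(1)[of 0]] V by simp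
  have s1: "s \<noteq> 1" using s by auto
  \<comment> \<open>The distances are adapted to \<open>powr_log_decay\<close>: the ratios on the
    two sides are \<open>1 - 1 / (2 * (N + 1))\<close> and \<open>1 - 1 / (2 * X)\<close>, and
    multiplying the defects by \<open>A - 2\<close> and \<open>B\<close> gives
    \<open>2 * ln V\<close> in both cases. The \<open>2\<close> in \<open>A\<close> is the exponent
    reserved for convergence.\<close>
  define A where "A = 2 + 4 * (real N + 1) * lV"
  define B where "B = 4 * X * lV"
  have A: "A \<ge> 3" "A \<le> 10 * X * lV"
  proof -
    have "4 * (real N + 1) * lV \<ge> 4 * 1 * 1" using lV by (intro mult_mono) auto
    then show "A \<ge> 3" by (simp add: A_def)
    have "4 * (real N + 1) * lV \<le> 8 * X * lV" using lV N by (intro mult_right_mono) (auto simp: X_def)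
    moreover have "1 * 1 \<le> X * lV" using X lV by (intro mult_mono) auto
    ultimately show "A \<le> 10 * X * lV" by (simp add: A_def)
  qed
  have B: "B \<ge> 1" "B + 1 \<le> 5 * X * lV"
  proof -
    have "1 * 1 \<le> X * lV" using X lV by (intro mult_mono) auto
    then show "B \<ge> 1" "B + 1 \<le> 5 * X * lV" by (auto simp: B_def)
  qed
  have nX: "norm (of_real X powr w :: complex) = X powr Re w" for w using X by (intro norm_of_real_powr) auto
  have far: "norm (w - s) \<ge> V / 2" if "\<bar>Im w\<bar> = V" for w
    using abs_Im_le_cmod[of "w - s"] that s by simp
  have Xle: "X powr u \<le> X\<^sup>2" if "u \<le> 2" for u
    using powr_mono[of u 2 X] that X by (simp add: powr_numeral)
  have N2: "real N \<le> X\<^sup>2"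
    using mult_mono[of 1 X "real N" X] X by (simp add: power2_eq_square)

  define p q p' q' where "p = Complex b (- V)" and "q = Complex A V"
    and "p' = Complex (- B) (- V)" and "q' = Complex b V"
  define g where "g = (\<lambda>w. (?F w - zeta w) * of_real X powr w / (w - s))"
  define f where "f = (\<lambda>w. ?F w * of_real X powr w / (w - s))"
  have sbox: "s \<in> box p q" and onebox: "1 \<in> box p q"
    using s b V A by (auto simp: p_def q_def in_box_complex_iff)
  have posRe: "Re w \<ge> b" if "w \<in> cbox p q" for w using that by (auto simp: p_def in_cbox_complex_iff)
  obtain E where E: "E holomorphic_on {s. Re s > 0}" "\<And>s. Re s > 0 \<Longrightarrow> s \<noteq> 1 \<Longrightarrow> zeta s = 1 / (s - 1) + E s"
    using zeta_regular_part by blast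
  have Ehol: "E holomorphic_on cbox p q"
    by (rule holomorphic_on_subset[OF E(1)]) (use posRe b in force)
  have Xhol: "(\<lambda>w. of_real X powr w :: complex) holomorphic_on S" for S
    using X by (intro holomorphic_intros) auto
  \<comment> \<open>The sum of the residues of \<open>g\<close> at \<open>s\<close> and at
    \<open>1\<close>; the second comes from the pole of \<open>zeta\<close>, which enters
    \<open>g\<close> with a minus sign.\<close>
  define Q where "Q = (?F s - zeta s) * of_real X powr s + of_real X / (s - 1)"
  have pi_sub: "path_image (rectpath p q) \<subseteq> cbox p q - {z}" if "z \<in> box p q" for z
    using that V A b by (subst path_image_rectpath_cbox_minus_box) (auto simp: p_def q_def)
  have cauchy: "((\<lambda>w. h w / (w - z)) has_contour_integral (2 * pi * \<i> * h z)) (rectpath p q)"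
    if h: "h holomorphic_on cbox p q" and z: "z \<in> box p q" for h z
    using Cauchy_integral_formula_convex_simple[OF _ h _ _ pi_sub[OF z]] winding_number_rectpath[OF z] z
    by (simp add: interior_cbox)
  \<comment> \<open>The two poles are separated by writing \<open>zeta = 1 / (w - 1) + E\<close> and
    splitting \<open>1 / ((w - 1) * (w - s))\<close> into partial fractions. Cauchy's formula for
    one simple pole then applies to each piece.\<close>
  have Ig: "(g has_contour_integral (2 * pi * \<i> * Q)) (rectpath p q)"
  proof -
    have "((\<lambda>w. (?F w - E w) * of_real X powr w / (w - s) -
         1 / (s - 1) * (of_real X powr w / (w - s) - of_real X powr w / (w - 1))) has_contour_integral
        (2 * pi * \<i> * ((?F s - E s) * of_real X powr s) -
         1 / (s - 1) * (2 * pi * \<i> * of_real X powr s - 2 * pi * \<i> * of_real X powr 1))) (rectpath p q)"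
      by (intro has_contour_integral_diff has_contour_integral_lmul
          cauchy[where h = "\<lambda>w. (?F w - E w) * of_real X powr w"] cauchy sbox onebox holomorphic_on_mult
          holomorphic_on_diff Xhol dirichlet_sum_holomorphic Ehol)
    moreover have "2 * pi * \<i> * ((?F s - E s) * of_real X powr s) -
         1 / (s - 1) * (2 * pi * \<i> * of_real X powr s - 2 * pi * \<i> * of_real X powr 1) = 2 * pi * \<i> * Q"
    proof -
      have "zeta s = 1 / (s - 1) + E s" using s b s1 by (intro E(2)) auto
      then have Es: "E s = zeta s - 1 / (s - 1)" by simp
      have "c * ((F - (Z - d)) * P) - d * (c * P - c * x) = c * ((F - Z) * P + x * d)" for c F Z d P x :: complex
        by (simp add: algebra_simps)
      from this[of "2 * pi * \<i>" "?F s" "zeta s" "1 / (s - 1)"] show ?thesis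
        using X unfolding Q_def Es by simp
    qed
    ultimately have "((\<lambda>w. (?F w - E w) * of_real X powr w / (w - s) -
         1 / (s - 1) * (of_real X powr w / (w - s) - of_real X powr w / (w - 1))) has_contour_integral
        (2 * pi * \<i> * Q)) (rectpath p q)" by simp
    then show ?thesis
    proof (rule has_contour_integral_eq)
      fix w assume w: "w \<in> path_image (rectpath p q)"
      then have w': "w \<noteq> s" "w \<noteq> 1" "w \<in> cbox p q" using pi_sub[OF sbox] pi_sub[OF onebox] by auto
      then have zw: "zeta w = 1 / (w - 1) + E w" using posRe[of w] b by (intro E(2)) auto
      have "(F - (d + e)) * P / k = (F - e) * P / k - P * (d * (1 / k))" for F d e P k :: complex
        by (simp add: algebra_simps add_divide_distrib diff_divide_distrib)
      from this[of "?F w" "1 / (w - 1)" "E w"]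
      have ge: "g w = (?F w - E w) * of_real X powr w / (w - s) - of_real X powr w * (1 / ((w - 1) * (w - s)))"
        unfolding g_def zw by simp
      have eq1: "1 / ((w - 1) * (w - s)) = 1 / (s - 1) * (1 / (w - s) - 1 / (w - 1))"
        using w' s1 by (simp add: divide_simps)
      have "P * (d * (x - y)) = d * (P * x - P * y)" for P d x y :: complex by (simp add: algebra_simps)
      from this[of _ "1 / (s - 1)" "1 / (w - s)" "1 / (w - 1)"]
      have pf: "P * (1 / ((w - 1) * (w - s))) = 1 / (s - 1) * (P / (w - s) - P / (w - 1))" for P
        unfolding eq1 times_divide_eq_right mult_1_right .
      show "(?F w - E w) * of_real X powr w / (w - s) -
         1 / (s - 1) * (of_real X powr w / (w - s) - of_real X powr w / (w - 1)) = g w"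
        unfolding ge pf ..
    qed
  qed
  have If: "(f has_contour_integral 0) (rectpath p' q')"
  proof -
    have sub: "path_image (rectpath p' q') \<subseteq> cbox p' q'"
      using V B b by (intro path_image_rectpath_subset_cbox) (auto simp: p'_def q'_def)
    have ns: "w \<noteq> s" if "w \<in> cbox p' q'" for w
      using that s by (auto simp: p'_def q'_def in_cbox_complex_iff)
    have "f holomorphic_on cbox p' q'" unfolding f_def
      by (intro holomorphic_intros dirichlet_sum_holomorphic Xhol) (use ns in auto)
    then show ?thesis
      using Cauchy_theorem_convex_simple[of f "cbox p' q'" "rectpath p' q'"] sub by simp
  qed
  have zetahol: "continuous_on (cbox p q - {1}) zeta"
    by (rule holomorphic_on_imp_continuous_on, rule holomorphic_on_subset[OF zeta_holomorphic])
      (use posRe b in force)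
  have contg: "continuous_on (cbox p q - {1, s}) g" unfolding g_def
    by (intro continuous_intros continuous_on_subset[OF zetahol] holomorphic_on_imp_continuous_on
        dirichlet_sum_holomorphic Xhol) auto
  have contf: "continuous_on (- {s}) f" unfolding f_def
    by (intro continuous_intros holomorphic_on_imp_continuous_on dirichlet_sum_holomorphic Xhol) auto

  have R: "norm (2 * pi * \<i> * Q + \<i> * integral {-V..V} (\<lambda>y. g (Complex b y)))
     \<le> 2 * ((X + M + 3) * X\<^sup>2 * (2 / V)) * A + 3 * X\<^sup>2 * (1 / V\<^sup>2) * (2 * V)"
  proof -
    have "norm (2 * pi * \<i> * Q + \<i> * integral {Im p..Im q} (\<lambda>y. g (Complex (Re p) y)))
       \<le> 2 * ((X + M + 3) * X\<^sup>2 * (2 / V)) * (Re q - Re p) + 3 * X\<^sup>2 * (1 / V\<^sup>2) * (Im q - Im p)"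
    proof (rule rectpath_integral_left_edge[OF _ _ _ Ig])
      show "continuous_on (cbox p q - box p q) g"
        by (rule continuous_on_subset[OF contg]) (use sbox onebox in auto)
      show "0 \<le> (X + M + 3) * X\<^sup>2 * (2 / V)" using X M0 V by (intro mult_nonneg_nonneg) auto
    next
      fix w assume w: "w \<in> cbox p q" "Im w = Im p \<or> Im w = Im q"
      then have ImV: "\<bar>Im w\<bar> = V" and Rew: "b \<le> Re w" using V by (auto simp: p_def q_def in_cbox_complex_iff)
      have "norm (?F w - zeta w) * X powr Re w \<le> (X + M + 3) * X\<^sup>2"
      proof (cases "Re w \<le> 2")
        case True
        have "norm (?F w - zeta w) \<le> N + M"
          using norm_dirichlet_sum_le[of w N] M(2)[OF Rew True ImV] Rew b norm_triangle_ineq4[of "?F w" "zeta w"]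
          by linarith
        then have "norm (?F w - zeta w) \<le> X + M + 3" using X by linarith
        then show ?thesis using Xle[OF True] X M0 by (intro mult_mono) auto
      next
        case False
        then have "norm (?F w - zeta w) * X powr Re w \<le> 3 * X\<^sup>2 * (X / (real N + 1)) powr (Re w - 2)"
          using norm_dirichlet_sum_minus_zeta_le[of w N] by (simp add: X_def)
        also have "(X / (real N + 1)) powr (Re w - 2) \<le> 1"
          using False X by (intro powr_le1) (auto simp: X_def field_simps)
        also have "3 * X\<^sup>2 * 1 \<le> (X + M + 3) * X\<^sup>2" using X M0 by (simp add: mult_right_mono)
        finally show ?thesis by (simp add: mult_left_mono)
      qed
      then have "norm (g w) \<le> (X + M + 3) * X\<^sup>2 / (V / 2)"
        unfolding g_def norm_divide norm_mult nX using far[OF ImV] V X M0 by (intro frac_le) auto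
      then show "norm (g w) \<le> (X + M + 3) * X\<^sup>2 * (2 / V)" by simp
    next
      fix w assume w: "w \<in> cbox p q" "Re w = Re q"
      then have Rew: "Re w = A" by (simp add: q_def)
      have e: "X / (real N + 1) = 1 - 1 / (2 * (real N + 1))" by (simp add: X_def field_simps)
      have "norm (?F w - zeta w) * X powr Re w \<le> 3 * X\<^sup>2 * (X / (real N + 1)) powr (A - 2)"
        using norm_dirichlet_sum_minus_zeta_le[of w N] A by (simp add: X_def Rew)
      also have "(X / (real N + 1)) powr (A - 2) \<le> 1 / V\<^sup>2"
        unfolding e by (rule powr_log_decay) (use V lV in \<open>auto simp: A_def lV_def[symmetric] field_simps\<close>)
      finally have "norm (?F w - zeta w) * X powr Re w \<le> 3 * X\<^sup>2 * (1 / V\<^sup>2)" by (simp add: mult_left_mono)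
      moreover have "norm (w - s) \<ge> 1" using complex_Re_le_cmod[of "w - s"] Rew A s by simp
      ultimately have "norm (g w) \<le> 3 * X\<^sup>2 * (1 / V\<^sup>2) / 1"
        unfolding g_def norm_divide norm_mult nX by (intro frac_le) auto
      then show "norm (g w) \<le> 3 * X\<^sup>2 * (1 / V\<^sup>2)" by simp
    qed (use V A b in \<open>auto simp: p_def q_def\<close>)
    also have "\<dots> \<le> 2 * ((X + M + 3) * X\<^sup>2 * (2 / V)) * A + 3 * X\<^sup>2 * (1 / V\<^sup>2) * (2 * V)"
      using X M0 V b by (intro add_mono mult_left_mono) (auto simp: p_def q_def)
    finally show ?thesis by (simp add: p_def q_def)
  qed

  have L: "norm (0 - \<i> * integral {-V..V} (\<lambda>y. f (Complex b y)))
     \<le> 2 * (X ^ 3 * (2 / V)) * (B + 1) + X * (1 / V\<^sup>2) * (2 * V)"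
  proof -
    have "norm (0 - \<i> * integral {Im p'..Im q'} (\<lambda>y. f (Complex (Re q') y)))
       \<le> 2 * (X ^ 3 * (2 / V)) * (Re q' - Re p') + X * (1 / V\<^sup>2) * (Im q' - Im p')"
    proof (rule rectpath_integral_right_edge[OF _ _ _ If])
      show "continuous_on (cbox p' q' - box p' q') f"
        by (rule continuous_on_subset[OF contf]) (use s in \<open>auto simp: p'_def q'_def in_cbox_complex_iff\<close>)
      show "0 \<le> X ^ 3 * (2 / V)" using X V by (intro mult_nonneg_nonneg) auto
    next
      fix w assume w: "w \<in> cbox p' q'" "Im w = Im p' \<or> Im w = Im q'"
      then have ImV: "\<bar>Im w\<bar> = V" and Rew: "Re w \<le> b" using V by (auto simp: p'_def q'_def in_cbox_complex_iff)
      have "norm (?F w) * X powr Re w \<le> X ^ 3"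
      proof (cases "Re w \<ge> 0")
        case True
        then have "norm (?F w) * X powr Re w \<le> X * X\<^sup>2"
          using norm_dirichlet_sum_le[of w N] X Xle[of "Re w"] Rew b by (intro mult_mono) auto
        then show ?thesis by (simp add: eval_nat_numeral)
      next
        case False
        then have "norm (?F w) * X powr Re w \<le> N * (real N / X) powr (- Re w)"
          using norm_dirichlet_sum_left_le[OF N, of w] by (simp add: X_def)
        also have "\<dots> \<le> real N * 1" using False X
          by (intro mult_left_mono powr_le1) (auto simp: field_simps)
        also have "\<dots> \<le> X\<^sup>2 * X" using mult_mono[OF N2, of 1 X] X by simp
        finally show ?thesis by (simp add: eval_nat_numeral)
      qed
      then have "norm (f w) \<le> X ^ 3 / (V / 2)"
        unfolding f_def norm_divide norm_mult nX using far[OF ImV] V X by (intro frac_le) auto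
      then show "norm (f w) \<le> X ^ 3 * (2 / V)" by simp
    next
      fix w assume w: "w \<in> cbox p' q'" "Re w = Re p'"
      then have Rew: "Re w = - B" by (simp add: p'_def)
      have e: "real N / X = 1 - 1 / (2 * X)" using X by (simp add: X_def field_simps)
      have "norm (?F w) * X powr Re w \<le> N * (real N / X) powr B"
        using norm_dirichlet_sum_left_le[OF N, of w] B Rew by (simp add: X_def)
      also have "\<dots> \<le> X * (1 / V\<^sup>2)"
      proof (intro mult_mono)
        show "(real N / X) powr B \<le> 1 / V\<^sup>2"
          unfolding e by (rule powr_log_decay) (use V lV X in \<open>auto simp: B_def lV_def[symmetric] field_simps\<close>)
      qed (use X in auto)
      finally have "norm (?F w) * X powr Re w \<le> X * (1 / V\<^sup>2)" .
      moreover have "norm (w - s) \<ge> 1" using abs_Re_le_cmod[of "w - s"] Rew B s b by simp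
      ultimately have "norm (f w) \<le> X * (1 / V\<^sup>2) / 1"
        unfolding f_def norm_divide norm_mult nX using X by (intro frac_le) auto
      then show "norm (f w) \<le> X * (1 / V\<^sup>2)" by simp
    qed (use V B b in \<open>auto simp: p'_def q'_def\<close>)
    also have "\<dots> \<le> 2 * (X ^ 3 * (2 / V)) * (B + 1) + X * (1 / V\<^sup>2) * (2 * V)"
      using X V b by (intro add_mono mult_left_mono) (auto simp: p'_def q'_def)
    finally show ?thesis by (simp add: p'_def q'_def)
  qed

  define \<eta> where "\<eta> = Re s - b"
  have \<eta>: "\<eta> > 0" using s by (simp add: \<eta>_def)
  let ?z = "\<lambda>y. zeta (Complex b y) * of_real X powr (Complex b y) / (Complex b y - s)"
  have cg: "continuous_on {-V..V} (\<lambda>y. g (Complex b y))"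
    by (rule continuous_on_vertical_line[OF contg]) (use s b A in \<open>auto simp: p_def q_def in_cbox_complex_iff complex_eq_iff\<close>)
  have cf: "continuous_on {-V..V} (\<lambda>y. f (Complex b y))"
    by (rule continuous_on_vertical_line[OF contf]) (use s in auto)
  \<comment> \<open>The Dirichlet sum cancels on the common edge, where its own size would be too
    large for the final estimate.\<close>
  have diff: "integral {-V..V} (\<lambda>y. g (Complex b y)) - integral {-V..V} (\<lambda>y. f (Complex b y)) = - integral {-V..V} ?z"
  proof -
    have "integral {-V..V} (\<lambda>y. g (Complex b y)) - integral {-V..V} (\<lambda>y. f (Complex b y)) =
       integral {-V..V} (\<lambda>y. g (Complex b y) - f (Complex b y))"
      by (rule integral_diff[symmetric]) (intro integrable_continuous_interval cg cf)+
    also have "(\<lambda>y. g (Complex b y) - f (Complex b y)) = (\<lambda>y. - ?z y)"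
      by (auto simp: g_def f_def algebra_simps diff_divide_distrib)
    finally show ?thesis by simp
  qed
  have Iz: "norm (integral {-V..V} ?z) \<le> X powr b * M * (2 * ln (4 * V / \<eta> + 1))"
  proof -
    note hi = integral_inverse_dist_vertical_line_le[of \<eta> V "Im s"]
    have ht: "\<bar>Im s\<bar> \<le> V" "V > 0" using s V by auto
    have "norm (integral {-V..V} ?z) \<le> integral {-V..V} (\<lambda>y. X powr b * M * (1 / norm (Complex \<eta> (y - Im s))))"
    proof (rule integral_norm_bound_integral)
      have "(\<lambda>y. f (Complex b y) - g (Complex b y)) integrable_on {-V..V}"
        by (intro integrable_continuous_interval continuous_intros cf cg)
      also have "(\<lambda>y. f (Complex b y) - g (Complex b y)) = ?z"
        by (auto simp: g_def f_def algebra_simps diff_divide_distrib)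
      finally show "?z integrable_on {-V..V}" .
      show "(\<lambda>y. X powr b * M * (1 / norm (Complex \<eta> (y - Im s)))) integrable_on {-V..V}"
        using has_integral_mult_right[OF hi(1)[OF \<eta> ht(2,1)], of "X powr b * M"] by blast
      fix y assume y: "y \<in> {-V..V}"
      have e: "norm (Complex b y - s) = norm (Complex \<eta> (y - Im s))"
        by (simp add: \<eta>_def cmod_def power2_commute)
      have "norm (zeta (Complex b y)) \<le> M" using y by (intro M(1)) auto
      then have "norm (?z y) \<le> M * X powr b / norm (Complex b y - s)"
        unfolding norm_divide norm_mult nX by (simp add: divide_right_mono mult_right_mono)
      then show "norm (?z y) \<le> X powr b * M * (1 / norm (Complex \<eta> (y - Im s)))"
        by (simp add: e mult.commute)
    qed
    also have "\<dots> = X powr b * M * (arsinh ((V - Im s) / \<eta>) - arsinh ((- V - Im s) / \<eta>))"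
      using has_integral_mult_right[OF hi(1)[OF \<eta> ht(2,1)], of "X powr b * M"] by (rule integral_unique)
    also have "\<dots> \<le> X powr b * M * (2 * ln (4 * V / \<eta> + 1))"
      using hi(2)[OF \<eta> ht(2,1)] M0 by (intro mult_left_mono) auto
    finally show ?thesis .
  qed
  have err: "2 * ((X + M + 3) * X\<^sup>2 * (2 / V)) * A + 3 * X\<^sup>2 * (1 / V\<^sup>2) * (2 * V) +
      (2 * (X ^ 3 * (2 / V)) * (B + 1) + X * (1 / V\<^sup>2) * (2 * V)) \<le> 60 * (X + M + 4) * X ^ 3 * lV / V"
  proof -
    define Z where "Z = X ^ 3 * lV / V"
    have "2 * ((X + M + 3) * X\<^sup>2 * (2 / V)) * A \<le> 2 * ((X + M + 3) * X\<^sup>2 * (2 / V)) * (10 * X * lV)"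
      using A X M0 V by (intro mult_left_mono) auto
    also have "\<dots> = 40 * (X + M + 3) * Z" by (simp add: Z_def eval_nat_numeral)
    finally have 1: "2 * ((X + M + 3) * X\<^sup>2 * (2 / V)) * A \<le> 40 * (X + M + 3) * Z" .
    have "2 * (X ^ 3 * (2 / V)) * (B + 1) \<le> 2 * (X ^ 3 * (2 / V)) * (5 * X * lV)"
      using B X V by (intro mult_left_mono) auto
    also have "\<dots> = 20 * X * Z" by (simp add: Z_def)
    finally have 2: "2 * (X ^ 3 * (2 / V)) * (B + 1) \<le> 20 * X * Z" .
    have "X\<^sup>2 * 1 \<le> X\<^sup>2 * (X * lV)" using X lV mult_mono[of 1 X 1 lV] by (intro mult_left_mono) auto
    then have "X\<^sup>2 / V \<le> Z" unfolding Z_def using V by (intro divide_right_mono) (auto simp: eval_nat_numeral mult_ac)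
    moreover have "3 * X\<^sup>2 * (1 / V\<^sup>2) * (2 * V) = 6 * (X\<^sup>2 / V)" using V by (simp add: power2_eq_square)
    ultimately have 3: "3 * X\<^sup>2 * (1 / V\<^sup>2) * (2 * V) \<le> 6 * Z" by simp
    have "X * (1 / V\<^sup>2) * (2 * V) = 2 * (X / V)" using V by (simp add: power2_eq_square)
    moreover have "X / V \<le> X\<^sup>2 / V" using X V by (intro divide_right_mono) (auto simp: power2_eq_square)
    ultimately have 4: "X * (1 / V\<^sup>2) * (2 * V) \<le> 2 * Z" using \<open>X\<^sup>2 / V \<le> Z\<close> by linarith
    have "Z \<ge> 0" using X lV V by (simp add: Z_def)
    then have "(40 * (X + M + 3) + 20 * X + 8) * Z \<le> (60 * (X + M + 4)) * Z"
      using X M0 by (intro mult_right_mono) auto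
    then have "40 * (X + M + 3) * Z + 20 * X * Z + 6 * Z + 2 * Z \<le> 60 * (X + M + 4) * Z"
      by (simp add: algebra_simps)
    then have "2 * ((X + M + 3) * X\<^sup>2 * (2 / V)) * A + 3 * X\<^sup>2 * (1 / V\<^sup>2) * (2 * V) +
      (2 * (X ^ 3 * (2 / V)) * (B + 1) + X * (1 / V\<^sup>2) * (2 * V)) \<le> 60 * (X + M + 4) * Z"
      using 1 2 3 4 by linarith
    then show ?thesis by (simp add: Z_def)
  qed
  let ?Ig = "integral {-V..V} (\<lambda>y. g (Complex b y))" and ?If = "integral {-V..V} (\<lambda>y. f (Complex b y))"
  have tri: "norm (a + b - c) \<le> norm a + norm b + norm c" for a b c :: complex
    using norm_triangle_ineq4[of "a + b" c] norm_triangle_ineq[of a b] by linarith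
  have eqQ: "(2 * pi * \<i> * Q + \<i> * ?Ig) + (0 - \<i> * ?If) - \<i> * (?Ig - ?If) = 2 * pi * \<i> * Q"
    by (simp add: algebra_simps)
  have "norm (2 * pi * \<i> * Q) \<le> norm (2 * pi * \<i> * Q + \<i> * ?Ig) + norm (0 - \<i> * ?If) + norm (\<i> * (?Ig - ?If))"
    using tri[of "2 * pi * \<i> * Q + \<i> * ?Ig" "0 - \<i> * ?If" "\<i> * (?Ig - ?If)"] unfolding eqQ .
  also have "norm (\<i> * (?Ig - ?If)) = norm (integral {-V..V} ?z)" unfolding diff by (simp add: norm_mult)
  finally have "2 * pi * norm Q \<le> 60 * (X + M + 4) * X ^ 3 * lV / V + X powr b * M * (2 * ln (4 * V / \<eta> + 1))"
    using R L Iz err by (simp add: norm_mult)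
  \<comment> \<open>Keeping only \<open>2\<close> of \<open>2 * pi\<close> cancels the factor
    \<open>2\<close> in front of the logarithm.\<close>
  moreover have "2 * norm Q \<le> 2 * pi * norm Q" using pi_ge_two by (intro mult_right_mono) auto
  moreover have "60 * (X + M + 4) * X ^ 3 * lV / V \<ge> 0" using X M0 lV V by simp
  ultimately have "norm Q \<le> X powr b * M * ln (4 * V / \<eta> + 1) + 60 * (X + M + 4) * X ^ 3 * lV / V"
    by linarith
  then show ?thesis by (simp add: Q_def \<eta>_def lV_def)
qed

section \<open>Zeros of the partial sums\<close>

theorem theorem5:
  assumes RH: "Riemann_Hypothesis"
  shows "\<exists>c\<^sub>2::real. \<forall>X::real \<Rightarrow> real.
           filterlim X at_top at_top \<and> X \<in> O[at_top](\<lambda>T. T) \<longrightarrow>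
           (\<forall>\<^sub>F T in at_top. \<forall>\<rho>::complex.
              zeta_partial_sum (X T) \<rho> = 0 \<and> X T powr (1 / 2) < Im \<rho> \<and> Im \<rho> \<le> T \<longrightarrow>
              Re \<rho> \<le> 1 / 2 + c\<^sub>2 * ln T / (ln (X T) * ln (ln T)))"
proof -
  obtain C L0 where C: "C > 0"
    "\<And>L s. \<lbrakk>L \<ge> L0; 1 / 2 + 9 / ln L \<le> Re s; L \<le> \<bar>Im s\<bar>; \<bar>Im s\<bar> \<le> exp L\<rbrakk> \<Longrightarrow>
       zeta s \<noteq> 0 \<and> \<bar>ln (norm (zeta s))\<bar> \<le> C * L / ln L"
    using RH_ln_norm_zeta_bound[OF RH] by blast
  obtain C2 where C2: "C2 \<ge> 0"
    "\<And>s. Re s \<ge> 1 / 4 \<Longrightarrow> s \<noteq> 1 \<Longrightarrow> norm (zeta s) \<le> 1 / norm (s - 1) + C2 * norm s"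
    using zeta_bound by blast
  \<comment> \<open>All largeness conditions are placed on \<open>L = ln T\<close> alone, without
    reference to the function \<open>X\<close>, which keeps the constant absolute.
    \<open>ln L \<ge> 36\<close> gives \<open>b \<le> 3 / 4\<close>,
    \<open>ln L \<ge> 9 * C + 1\<close> gives \<open>M \<le> exp L\<close>, and
    \<open>30240 = 60 * 7 * 8 * 9\<close> comes from the truncation error.\<close>
  define P where "P = (\<lambda>L::real. L \<ge> 1 \<and> ln L \<ge> 36 \<and> ln L \<ge> 9 * C + 1 \<and> 9 * L \<ge> L0 \<and> C2 \<le> L \<and>
     4 + L * (1 + 9 * L) \<le> exp (L / ln L) \<and> 9 * L \<le> exp (L / (2 * ln L)) \<and>
     30240 * L * exp (- L) \<le> 1 \<and> ln (4 * exp (9 * L) * ln L + 1) \<le> 10 * L \<and> 3 + 10 * L \<le> exp (L / ln L))"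
  have "eventually P at_top"
    unfolding P_def
  proof (intro eventually_conj)
    show "eventually (\<lambda>L::real. L \<ge> 1) at_top" by (rule eventually_ge_at_top)
    show "eventually (\<lambda>L::real. C2 \<le> L) at_top" by (rule eventually_ge_at_top)
    have "filterlim (\<lambda>L::real. ln L) at_top at_top" by (rule ln_at_top)
    then show "eventually (\<lambda>L::real. ln L \<ge> 9 * C + 1) at_top" "eventually (\<lambda>L::real. ln L \<ge> 36) at_top"
      by (auto simp: filterlim_at_top)
    have "eventually (\<lambda>L::real. L \<ge> L0 / 9) at_top" by (rule eventually_ge_at_top)
    then show "eventually (\<lambda>L::real. 9 * L \<ge> L0) at_top" by eventually_elim simp
    show "eventually (\<lambda>L::real. 4 + L * (1 + 9 * L) \<le> exp (L / ln L)) at_top" by real_asymp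
    show "eventually (\<lambda>L::real. 9 * L \<le> exp (L / (2 * ln L))) at_top" by real_asymp
    show "eventually (\<lambda>L::real. 30240 * L * exp (- L) \<le> 1) at_top" by real_asymp
    show "eventually (\<lambda>L::real. ln (4 * exp (9 * L) * ln L + 1) \<le> 10 * L) at_top" by real_asymp
    show "eventually (\<lambda>L::real. 3 + 10 * L \<le> exp (L / ln L)) at_top" by real_asymp
  qed
  \<comment> \<open>\<open>36 * C + 22 = 2 * (18 * C + 2) + 18\<close>: twice \<open>9 * C\<close>
    from the bounds for \<open>zeta\<close> and \<open>1 / zeta\<close>, \<open>2\<close> from
    absorbing lower order factors into \<open>exp D\<close>, a doubling from
    \<open>ln X \<ge> ln Y / 2\<close>, and \<open>18\<close> from the shift \<open>9 / l\<close> of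
    the line.\<close>
  define c2 where "c2 = 36 * C + 22"
  have main: "Re \<rho> \<le> 1 / 2 + c2 * ln T / (ln Y * ln (ln T))"
    if T: "T > 0" "P (ln T)" and Y: "Y \<ge> 4" "Y \<le> exp (2 * ln T)"
      and \<rho>: "zeta_partial_sum Y \<rho> = 0" "Y powr (1 / 2) < Im \<rho>" "Im \<rho> \<le> T" for T Y \<rho>
  proof (rule ccontr)
    assume neg: "\<not> Re \<rho> \<le> 1 / 2 + c2 * ln T / (ln Y * ln (ln T))"
    define L l where "L = ln T" and "l = ln L"
    have PL: "L \<ge> 1" "l \<ge> 36" "l \<ge> 9 * C + 1" "9 * L \<ge> L0" "C2 \<le> L" "4 + L * (1 + 9 * L) \<le> exp (L / l)"
      "9 * L \<le> exp (L / (2 * l))" "30240 * L * exp (- L) \<le> 1" "ln (4 * exp (9 * L) * l + 1) \<le> 10 * L"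
      "3 + 10 * L \<le> exp (L / l)"
      using T(2) by (auto simp: P_def L_def l_def)
    have TL: "T = exp L" using T by (simp add: L_def)
    define N where "N = nat \<lfloor>Y\<rfloor>"
    define X where "X = real N + 1 / 2"
    have N: "real N \<le> Y" "Y < real N + 1" using Y by (auto simp: N_def)
    have N1: "N \<ge> 1" using N Y by linarith
    have F0: "dirichlet_sum N \<rho> = 0"
      using \<rho>(1) Y by (simp add: zeta_partial_sum_eq_dirichlet_sum N_def)
    then have Re2: "Re \<rho> < 2" using dirichlet_sum_nonzero_Re_ge_2[of \<rho> N] N1 by force
    have lY: "ln Y > 0" using Y by simp
    define D where "D = L / l"
    have D0: "D > 0" using PL by (simp add: D_def)
    have big: "c2 * D < (Re \<rho> - 1 / 2) * ln Y"
    proof -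
      have "c2 * L / (ln Y * l) < Re \<rho> - 1 / 2" using neg by (simp add: L_def l_def)
      then have "c2 * L / (ln Y * l) * ln Y < (Re \<rho> - 1 / 2) * ln Y" using lY by (intro mult_strict_right_mono)
      also have "c2 * L / (ln Y * l) * ln Y = c2 * D" using lY by (simp add: D_def)
      finally show ?thesis .
    qed
    \<comment> \<open>A zero has real part below \<open>2\<close>, so a violation of the bound can
      only happen when \<open>ln Y\<close> is at least \<open>D = L / l\<close>.\<close>
    have lYD: "D \<le> ln Y"
    proof -
      have "(Re \<rho> - 1 / 2) * ln Y \<le> 3 / 2 * ln Y" using Re2 lY by (intro mult_right_mono) auto
      moreover have "3 / 2 * D \<le> c2 * D" using C(1) D0 by (intro mult_right_mono) (auto simp: c2_def)
      ultimately show ?thesis using big by linarith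
    qed
    have lY2: "ln Y \<le> 2 * L"
    proof -
      have "ln Y \<le> ln (exp (2 * L))" using Y by (intro ln_mono) (auto simp: L_def)
      then show ?thesis by simp
    qed
    have sig: "Re \<rho> - 1 / 2 \<ge> 10 / l"
    proof -
      have "20 * D \<le> c2 * D" using C(1) D0 by (intro mult_right_mono) (auto simp: c2_def)
      with big have a: "20 * D < (Re \<rho> - 1 / 2) * ln Y" by linarith
      have "Re \<rho> - 1 / 2 > 0"
      proof (rule ccontr)
        assume "\<not> Re \<rho> - 1 / 2 > 0"
        then have "(Re \<rho> - 1 / 2) * ln Y \<le> 0" using lY by (intro mult_nonpos_nonneg) auto
        then show False using a D0 by linarith
      qed
      then have "(Re \<rho> - 1 / 2) * ln Y \<le> (Re \<rho> - 1 / 2) * (2 * L)" using lY2 by (intro mult_left_mono) auto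
      with a have "20 * D < (Re \<rho> - 1 / 2) * (2 * L)" by linarith
      then have "L * (20 / l) < L * (2 * (Re \<rho> - 1 / 2))" by (simp only: D_def times_divide_eq_right mult_ac)
      then have "20 / l < 2 * (Re \<rho> - 1 / 2)" using PL by (subst (asm) mult_less_cancel_left_pos) auto
      then show ?thesis by simp
    qed
    define b where "b = 1 / 2 + 9 / l"
    have b: "b < Re \<rho>" "1 / l \<le> Re \<rho> - b" "1 / 2 \<le> b" "b \<le> 3 / 4"
    proof -
      have "9 / l \<le> 1 / 4" "0 \<le> 9 / l" "9 / l < 10 / l" using PL by (auto simp: field_simps)
      then show "b < Re \<rho>" "1 / 2 \<le> b" "b \<le> 3 / 4" using sig by (auto simp: b_def)
      have "10 / l - 9 / l = 1 / l" by (simp flip: diff_divide_distrib)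
      then show "1 / l \<le> Re \<rho> - b" using sig by (simp add: b_def)
    qed
    \<comment> \<open>\<open>V = T^9\<close>: up to a logarithm the truncation error is
      \<open>(X + M) * X ^ 3 / V\<close>, and \<open>X\<close> and \<open>M\<close> are at most
      constant multiples of \<open>T^2\<close>, so eight powers of \<open>T\<close> have to be
      beaten.\<close>
    define V where "V = exp (9 * L)"
    have V: "V \<ge> 4" "V / 2 \<ge> T"
    proof -
      have "exp (8 * L) \<ge> 4" using exp_ge_add_one_self[of "8 * L"] PL by linarith
      moreover have "V = exp (8 * L) * T" by (simp add: V_def TL flip: exp_add)
      moreover have "T \<ge> 1" using PL by (simp add: TL)
      ultimately show "V \<ge> 4" "V / 2 \<ge> T" using mult_mono[of 4 "exp (8 * L)" 1 T] mult_right_mono[of 2 "exp (8 * L)" T] by auto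
    qed
    \<comment> \<open>The height \<open>sqrt Y\<close> together with \<open>ln Y \<ge> D\<close>
      brings the zero into the range where the bounds for \<open>zeta\<close> are available.\<close>
    have Im_lower: "9 * L \<le> Im \<rho>"
    proof -
      have "9 * L \<le> exp (L / (2 * l))" using PL by simp
      also have "\<dots> \<le> exp (ln Y / 2)" using lYD by (simp add: D_def)
      also have "\<dots> = Y powr (1 / 2)" using Y by (simp add: powr_def)
      finally show ?thesis using \<rho>(2) by simp
    qed
    have ln9: "ln (9 * L) \<ge> l" "ln (9 * L) > 0" "9 / ln (9 * L) \<le> 9 / l"
    proof -
      show "ln (9 * L) \<ge> l" unfolding l_def using PL by (intro ln_mono) auto
      then show "ln (9 * L) > 0" "9 / ln (9 * L) \<le> 9 / l" using PL by (auto intro!: divide_left_mono mult_pos_pos)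
    qed
    have ratio: "C * (9 * L) / ln (9 * L) \<le> 9 * C * D"
    proof -
      have "C * (9 * L) / ln (9 * L) \<le> C * (9 * L) / l"
        using ln9 PL C(1) by (intro divide_left_mono mult_pos_pos) auto
      then show ?thesis by (simp add: D_def mult_ac)
    qed
    \<comment> \<open>The bound is used with \<open>9 * L\<close> in place of \<open>L\<close>, so
      that it reaches the height \<open>V\<close>. The line \<open>b\<close> remains admissible
      because \<open>9 / ln (9 * L) \<le> 9 / l\<close>.\<close>
    have zb: "zeta w \<noteq> 0 \<and> \<bar>ln (norm (zeta w))\<bar> \<le> 9 * C * D" if "b \<le> Re w" "9 * L \<le> \<bar>Im w\<bar>" "\<bar>Im w\<bar> \<le> V" for w
      using C(2)[of "9 * L" w] that ln9(3) PL(4) ratio by (auto simp: b_def V_def)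
    \<comment> \<open>The extra \<open>D\<close> in the exponent covers ordinates below
      \<open>9 * L\<close>, where the elementary polynomial bound for \<open>zeta\<close> is at most
      \<open>exp D\<close>.\<close>
    define M where "M = exp ((9 * C + 1) * D)"
    have zM: "norm (zeta w) \<le> M" if "b \<le> Re w" "9 * L \<le> \<bar>Im w\<bar>" "\<bar>Im w\<bar> \<le> V" for w
    proof -
      have "(9 * C + 1) * D = 9 * C * D + D" by (simp add: distrib_right)
      then have "ln (norm (zeta w)) \<le> (9 * C + 1) * D" using conjunct2[OF zb[OF that]] D0 by linarith
      then have "exp (ln (norm (zeta w))) \<le> M" by (simp add: M_def)
      then show ?thesis using zb[OF that] by simp
    qed
    have zlow: "exp (- (9 * C * D)) \<le> norm (zeta \<rho>)"
    proof -
      have z: "zeta \<rho> \<noteq> 0 \<and> \<bar>ln (norm (zeta \<rho>))\<bar> \<le> 9 * C * D"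
        by (rule zb) (use b(1) Im_lower \<rho>(3) V T PL(1) in linarith)+
      then have "- (9 * C * D) \<le> ln (norm (zeta \<rho>))" by linarith
      then have "exp (- (9 * C * D)) \<le> exp (ln (norm (zeta \<rho>)))" by (simp only: exp_le_cancel_iff)
      then show ?thesis using z by simp
    qed
    have M1: "norm (zeta (Complex b y)) \<le> M" if "\<bar>y\<bar> \<le> V" for y
    proof (cases "9 * L \<le> \<bar>y\<bar>")
      case True
      then show ?thesis using that by (intro zM) auto
    next
      case False
      let ?w = "Complex b y"
      have "norm (?w - 1) \<ge> 1 / 4" using abs_Re_le_cmod[of "?w - 1"] b by simp
      then have "1 / norm (?w - 1) \<le> 1 / (1 / 4)" by (intro divide_left_mono) auto
      moreover have "norm ?w \<le> 1 + 9 * L" using cmod_le[of ?w] b False by simp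
      then have "C2 * norm ?w \<le> L * (1 + 9 * L)" using PL C2(1) by (intro mult_mono) auto
      moreover have "norm (zeta ?w) \<le> 1 / norm (?w - 1) + C2 * norm ?w"
        using b by (intro C2(2)) (auto simp: complex_eq_iff)
      ultimately have "norm (zeta ?w) \<le> exp D" using PL by (simp add: D_def)
      also have "\<dots> \<le> M" using C(1) D0 by (simp add: M_def)
      finally show ?thesis .
    qed
    have M2: "norm (zeta w) \<le> M" if "b \<le> Re w" "Re w \<le> 2" "\<bar>Im w\<bar> = V" for w
    proof (rule zM)
      have "9 * L \<le> V" unfolding V_def using exp_ge_add_one_self[of "9 * L"] by linarith
      then show "9 * L \<le> \<bar>Im w\<bar>" using that by simp
    qed (use that in auto)
    have Im1: "Im \<rho> \<ge> 9" using Im_lower PL by simp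
    have perron: "norm ((dirichlet_sum N \<rho> - zeta \<rho>) * of_real X powr \<rho> + of_real X / (\<rho> - 1))
       \<le> X powr b * M * ln (4 * V / (Re \<rho> - b) + 1) + 60 * (X + M + 4) * X ^ 3 * ln V / V"
      unfolding X_def
      by (rule truncated_perron[OF N1 _ _ b(1) _ _ _ V(1) M1 M2]) (use b Re2 Im1 \<rho>(3) V(2) in auto)
    have X: "X \<ge> 3 / 2" "X \<le> 2 * exp (2 * L)" "Y / 2 \<le> X" "X / 2 \<le> Y"
    proof -
      show "X \<ge> 3 / 2" "Y / 2 \<le> X" "X / 2 \<le> Y" using N N1 Y by (auto simp: X_def)
      then show "X \<le> 2 * exp (2 * L)" using Y by (simp add: L_def)
    qed
    have Xb: "X powr b \<ge> 1" using X b by (intro ge_one_powr_ge_zero) auto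
    have M_ge: "M \<ge> 1" using C(1) D0 by (simp add: M_def)
    \<comment> \<open>Here the height above \<open>sqrt Y\<close> is decisive: it reduces the pole
      term from order \<open>X\<close> to order \<open>sqrt X\<close>, which is at most
      \<open>X powr b\<close>. The half-integer \<open>X\<close> may exceed \<open>Y\<close>, hence
      the detour through \<open>X / 2 \<le> Y\<close>.\<close>
    have t1: "norm (of_real X / (\<rho> - 1)) \<le> 2 * X powr b"
    proof -
      have "norm (\<rho> - 1) \<ge> Im \<rho>" using abs_Im_le_cmod[of "\<rho> - 1"] Im1 by simp
      moreover have "Im \<rho> \<ge> (X / 2) powr (1 / 2)"
        using \<rho>(2) powr_mono2[of "1/2" "X / 2" Y] X by simp
      ultimately have n: "norm (\<rho> - 1) \<ge> (X / 2) powr (1 / 2)" by simp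
      have "norm (of_real X / (\<rho> - 1)) \<le> X / (X / 2) powr (1 / 2)"
        unfolding norm_divide using n X by (intro frac_le) auto
      also have "\<dots> = 2 * (X / 2) powr (1 / 2)"
      proof -
        have "(X / 2) powr (1 / 2) * (X / 2) powr (1 / 2) = X / 2" using X by (simp flip: powr_add)
        moreover have "(X / 2) powr (1 / 2) > 0" using X by simp
        ultimately show ?thesis by (simp add: field_simps)
      qed
      also have "\<dots> \<le> 2 * X powr b"
      proof -
        have "(X / 2) powr (1 / 2) \<le> X powr (1 / 2)" using X by (intro powr_mono2) auto
        moreover have "X powr (1 / 2) \<le> X powr b" using X b by (intro powr_mono) auto
        ultimately show ?thesis by linarith
      qed
      finally show ?thesis .
    qed
    have t2: "ln (4 * V / (Re \<rho> - b) + 1) \<le> 10 * L"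
    proof -
      have "V / (Re \<rho> - b) \<le> V / (1 / l)" using b PL V by (intro divide_left_mono mult_pos_pos) auto
      then have le: "V / (Re \<rho> - b) \<le> V * l" by simp
      have "0 \<le> V / (Re \<rho> - b)" using b V by (intro divide_nonneg_pos) auto
      then have "ln (4 * (V / (Re \<rho> - b)) + 1) \<le> ln (4 * (V * l) + 1)"
        using le by (intro ln_mono) linarith+
      then have "ln (4 * V / (Re \<rho> - b) + 1) \<le> ln (4 * V * l + 1)" by (simp add: mult.assoc)
      also have "\<dots> \<le> 10 * L" using PL by (simp add: V_def)
      finally show ?thesis .
    qed
    have t3: "60 * (X + M + 4) * X ^ 3 * ln V / V \<le> 1"
    proof -
      define Z where "Z = exp (2 * L)"
      have Z1: "Z \<ge> 1" using PL by (simp add: Z_def)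
      have "M \<le> Z"
      proof -
        have "(9 * C + 1) * D \<le> l * D" using PL D0 by (intro mult_right_mono) auto
        also have "\<dots> = L" using PL by (simp add: D_def)
        also have "\<dots> \<le> 2 * L" using PL by simp
        finally show ?thesis by (simp add: M_def Z_def)
      qed
      then have "X + M + 4 \<le> 7 * Z" using X(2) Z1 unfolding Z_def by linarith
      moreover have "X ^ 3 \<le> (2 * Z) ^ 3" using X by (intro power_mono) (auto simp: Z_def)
      ultimately have "60 * (X + M + 4) * X ^ 3 * ln V / V \<le> 60 * (7 * Z) * (2 * Z) ^ 3 * (9 * L) / V"
        using X M_ge Z1 V PL by (intro divide_right_mono mult_mono) (auto simp: V_def)
      also have "\<dots> = 30240 * L * (Z ^ 4 / V)" by (simp add: eval_nat_numeral)
      also have "Z ^ 4 / V = exp (- L)"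
      proof -
        have "Z ^ 4 = exp (8 * L)" unfolding Z_def by (simp flip: exp_of_nat_mult)
        then show ?thesis by (simp add: V_def flip: exp_diff)
      qed
      finally show ?thesis using PL by simp
    qed
    have nX: "norm (of_real X powr \<rho> :: complex) = X powr Re \<rho>" using X by (intro norm_of_real_powr) auto
    have "norm (zeta \<rho>) * X powr Re \<rho> = norm ((dirichlet_sum N \<rho> - zeta \<rho>) * of_real X powr \<rho>)"
      by (simp add: F0 norm_mult nX)
    also have "\<dots> \<le> norm ((dirichlet_sum N \<rho> - zeta \<rho>) * of_real X powr \<rho> + of_real X / (\<rho> - 1)) + norm (of_real X / (\<rho> - 1))"
      using norm_triangle_ineq4[of "(dirichlet_sum N \<rho> - zeta \<rho>) * of_real X powr \<rho> + of_real X / (\<rho> - 1)" "of_real X / (\<rho> - 1)"]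
      by simp
    also have "\<dots> \<le> X powr b * M * ln (4 * V / (Re \<rho> - b) + 1) + 1 + 2 * X powr b"
      using perron t1 t3 by linarith
    also have "\<dots> \<le> X powr b * M * (10 * L) + X powr b * M * 1 + X powr b * M * 2"
    proof -
      have "1 * 1 \<le> X powr b * M" using Xb M_ge by (intro mult_mono) auto
      moreover have "X powr b * 1 \<le> X powr b * M" using M_ge by (intro mult_left_mono) auto
      moreover have "X powr b * M * ln (4 * V / (Re \<rho> - b) + 1) \<le> X powr b * M * (10 * L)"
        using t2 M_ge by (intro mult_left_mono) auto
      ultimately show ?thesis by linarith
    qed
    also have "\<dots> = X powr b * M * (3 + 10 * L)" by (simp add: algebra_simps)
    also have "\<dots> \<le> X powr b * M * exp D"
      using PL M_ge by (intro mult_left_mono) (auto simp: D_def)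
    also have "\<dots> = X powr b * exp ((9 * C + 2) * D)"
      by (simp add: M_def mult.assoc algebra_simps flip: exp_add)
    finally have up: "norm (zeta \<rho>) * X powr Re \<rho> \<le> X powr b * exp ((9 * C + 2) * D)" .
    have "exp (- (9 * C * D)) * X powr Re \<rho> \<le> norm (zeta \<rho>) * X powr Re \<rho>"
      using zlow by (intro mult_right_mono) auto
    with up have "exp (- (9 * C * D)) * X powr Re \<rho> \<le> X powr b * exp ((9 * C + 2) * D)" by linarith
    moreover have "X powr u = exp (u * ln X)" for u using X by (simp add: powr_def)
    ultimately have "exp (- (9 * C * D) + Re \<rho> * ln X) \<le> exp (b * ln X + (9 * C + 2) * D)"
      unfolding exp_add by simp
    then have "- (9 * C * D) + Re \<rho> * ln X \<le> b * ln X + (9 * C + 2) * D" by simp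
    then have 1: "(Re \<rho> - b) * ln X \<le> (18 * C + 2) * D" by (simp add: algebra_simps)
    \<comment> \<open>The half-integer satisfies \<open>X \<ge> Y / 2\<close>, and
      \<open>Y / 2\<close> is at least \<open>sqrt Y\<close> because \<open>Y \<ge> 4\<close>. So
      passing from \<open>X\<close> to \<open>Y\<close> costs a factor \<open>2\<close> in the
      logarithm.\<close>
    have "ln Y / 2 \<le> ln X"
    proof -
      have "Y powr (1 / 2) \<le> Y / 2"
      proof -
        have "Y powr (1 / 2) * 2 \<le> Y powr (1 / 2) * Y powr (1 / 2)"
        proof (intro mult_left_mono)
          have "(4::real) powr (1 / 2) \<le> Y powr (1 / 2)" using Y by (intro powr_mono2) auto
          then show "2 \<le> Y powr (1 / 2)" by (simp add: powr_half_sqrt)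
        qed auto
        also have "\<dots> = Y" using Y by (simp flip: powr_add)
        finally show ?thesis by simp
      qed
      then have "ln (Y powr (1 / 2)) \<le> ln X" using X Y by (intro ln_mono) auto
      then show ?thesis using Y by (simp add: ln_powr)
    qed
    then have "(Re \<rho> - b) * (ln Y / 2) \<le> (18 * C + 2) * D"
      using 1 b(1) mult_left_mono[of "ln Y / 2" "ln X" "Re \<rho> - b"] by linarith
    moreover have "9 / l * ln Y \<le> 18 * D"
      using lY2 PL by (simp add: D_def field_simps)
    moreover have "(Re \<rho> - 1 / 2) * ln Y = 2 * ((Re \<rho> - b) * (ln Y / 2)) + 9 / l * ln Y"
      by (simp add: b_def algebra_simps)
    moreover have "c2 * D = 2 * ((18 * C + 2) * D) + 18 * D" by (simp add: c2_def algebra_simps)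
    ultimately have "(Re \<rho> - 1 / 2) * ln Y \<le> c2 * D" by linarith
    then show False using big by simp
  qed
  show ?thesis
  proof (intro exI[of _ c2] allI impI)
    fix X :: "real \<Rightarrow> real"
    assume X: "filterlim X at_top at_top \<and> X \<in> O[at_top](\<lambda>T. T)"
    obtain c where c: "c > 0" "eventually (\<lambda>T. norm (X T) \<le> c * norm T) at_top"
      using X by (auto elim: landau_o.bigE)
    have "eventually (\<lambda>T. X T \<ge> 4) at_top" using X by (simp add: filterlim_at_top)
    moreover have "eventually (\<lambda>T. P (ln T)) at_top"
      using \<open>eventually P at_top\<close> ln_at_top by (rule eventually_compose_filterlim)
    moreover have "eventually (\<lambda>T. T \<ge> max c 1) at_top" by (rule eventually_ge_at_top)
    ultimately show "\<forall>\<^sub>F T in at_top. \<forall>\<rho>::complex.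
              zeta_partial_sum (X T) \<rho> = 0 \<and> X T powr (1 / 2) < Im \<rho> \<and> Im \<rho> \<le> T \<longrightarrow>
              Re \<rho> \<le> 1 / 2 + c2 * ln T / (ln (X T) * ln (ln T))"
      using c(2)
    proof eventually_elim
      case (elim T)
      \<comment> \<open>The constant of the O-estimate is absorbed by a second factor
        \<open>T\<close>, which gives \<open>ln X \<le> 2 * ln T\<close> without any constant
        depending on \<open>X\<close>.\<close>
      have "X T \<le> c * T" using elim by simp
      also have "\<dots> \<le> T * T" using elim by (intro mult_right_mono) auto
      also have "\<dots> = exp (2 * ln T)" using elim by (simp add: exp_double power2_eq_square)
      finally have "X T \<le> exp (2 * ln T)" .
      then show ?case using main[of T "X T"] elim by auto
    qed
  qed
qed

end
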